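(* Let $d\ge 2$ and let $\mathbf{K}$ be a compact set of Borel probability measures on $\mathrm{SL}(d,\mathbb{R})$. Assume that the following hold: (finite moment condition) there exist $\gamma>0$ and $C$ such that for every $\mu\in\mathbf{K}$ one has $\int_{\mathrm{SL}(d,\mathbb{R})}\|A\|^{\gamma}\,d\mu(A)<C$; (measures condition) for every $\mu\in\mathbf{K}$ there are no Borel probability measures $\nu_1,\nu_2$ on $\mathbb{RP}^{d-1}$ such that $(f_A)_*\nu_1=\nu_2$ for $\mu$-almost every $A\in\mathrm{SL}(d,\mathbb{R})$; (spaces condition) for every $\mu\in\mathbf{K}$ there are no two nonempty finite unions $U,U'$ of proper nonzero subspaces of $\mathbb{R}^d$ such that $A(U)=U'$ for $\mu$-almost every $A\in\mathrm{SL}(d,\mathbb{R})$. Then for any $\varepsilon>0$ there exist $\delta>0$ and $n_0\in\mathbb{N}$ (depending only on $\varepsilon$ and $\mathbf{K}$) such that for all $n\ge n_0$ and all $\mu_1,\dots,\mu_n\in\mathbf{K}$ $$\mathbb{P}\bigl\{\,\bigl|\log\|T_n\|-L_n\bigr|>\varepsilon n\bigr\}<e^{-\delta n},$$ and moreover, for every $v_0\in\mathbb{R}^d$ with $|v_0|=1$, $$\mathbb{P}\bigl\{\,\bigl|\log|T_nv_0|-L_n\bigr|>\varepsilon n\bigr\}<e^{-\delta n},$$ where $\mathbb{P}=\mu_1\times\mu_2\times\dots\times\mu_n$.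
   Context: Compactness of $\mathbf{K}$ is with respect to the topology of weak-$*$ (weak) convergence of probability measures. $|\cdot|$ is the Euclidean norm on $\mathbb{R}^d$ and $\|A\|$ is the corresponding operator norm. For $A\in\mathrm{SL}(d,\mathbb{R})$, $f_A:\mathbb{RP}^{d-1}\to\mathbb{RP}^{d-1}$ is the induced projective transformation. Given $\mu_1,\dots,\mu_n\in\mathbf{K}$, the matrices $A_i$ are chosen independently at random, $A_i$ having distribution $\mu_i$; $T_n=A_nA_{n-1}\cdots A_1$; and $L_n=\mathbb{E}\log\|T_n\|$, the expectation being over $\mu_1\times\dots\times\mu_n$. *)

theory Defs
  imports "HOL-Probability.Probability"
begin

definition borel_of :: "'a topology \<Rightarrow> 'a measure" where
  "borel_of X = sigma (topspace X) {U. openin X U}"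

lemma space_borel_of [simp]: "space (borel_of X) = topspace X"
  unfolding borel_of_def by (rule space_measure_of) (auto dest: openin_subset)

lemma sets_borel_of: "sets (borel_of X) = sigma_sets (topspace X) {U. openin X U}"
  unfolding borel_of_def by (rule sets_measure_of) (auto dest: openin_subset)

lemma sets_borel_of_top_of_set: "sets (borel_of (top_of_set S)) = sets (restrict_space borel S)"
proof -
  have "sets (restrict_space borel S) = {(\<lambda>x. x) -` A \<inter> S | A. A \<in> sigma_sets UNIV {U. open U}}"
    by (auto simp: sets_restrict_space borel_def)
  also have "\<dots> = sigma_sets S {(\<lambda>x. x) -` A \<inter> S | A. A \<in> {U. open U}}"
    by (rule sigma_sets_vimage_commute) auto
  also have "{(\<lambda>x. x) -` A \<inter> S | A. A \<in> {U. open U}} = {U. openin (top_of_set S) U}"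
    by (auto simp: openin_open)
  finally show ?thesis
    by (simp add: sets_borel_of)
qed

definition borel_prob_measures :: "'a topology \<Rightarrow> 'a measure set" where
  "borel_prob_measures X = {\<mu>. prob_space \<mu> \<and> sets \<mu> = sets (borel_of X)}"

text \<open>The coarsest topology on the Borel probability measures on \<open>X\<close> for which integration against
  each bounded continuous real function is continuous.\<close>

definition weak_topology :: "'a topology \<Rightarrow> 'a measure topology" where
  "weak_topology X = topology_generated_by
     {{\<mu> \<in> borel_prob_measures X. (\<integral>x. f x \<partial>\<mu>) \<in> V} | f V.
        continuous_map X euclideanreal f \<and> bounded (f ` topspace X) \<and> open V}"

lemma topspace_weak_topology [simp]: "topspace (weak_topology X) = borel_prob_measures X"
proof -
  have "borel_prob_measures X \<in> {{\<mu> \<in> borel_prob_measures X. (\<integral>x. f x \<partial>\<mu>) \<in> V} | f V.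
        continuous_map X euclideanreal f \<and> bounded (f ` topspace X) \<and> open V}"
    by (intro CollectI exI[of _ "\<lambda>_. 0"] exI[of _ UNIV])
       (auto simp: image_constant_conv)
  then show ?thesis
    unfolding weak_topology_def topology_generated_by_topspace by blast
qed

definition special_linear :: "(real^'n^'n) set" where
  "special_linear = {A. det A = 1}"

text \<open>Points of projective space are the lines through the origin; the topology is the quotient
  topology under the map taking a nonzero vector to the line it spans.\<close>

definition proj_points :: "(real^'n) set set" where
  "proj_points = {l. subspace l \<and> dim l = 1}"

definition proj_topology :: "(real^'n) set topology" where
  "proj_topology = topology (\<lambda>U. U \<subseteq> proj_points \<and> open {x. x \<noteq> 0 \<and> span {x} \<in> U})"

lemma span_singleton_proj_points: "x \<noteq> 0 \<Longrightarrow> span {x} \<in> proj_points"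
  by (simp add: proj_points_def dim_eq_card_independent)

lemma openin_proj_topology:
  "openin proj_topology U \<longleftrightarrow> U \<subseteq> proj_points \<and> open {x. x \<noteq> 0 \<and> span {x} \<in> U}"
proof -
  have "istopology (\<lambda>U. U \<subseteq> proj_points \<and> open {x::real^'n. x \<noteq> 0 \<and> span {x} \<in> U})"
    unfolding istopology_def
  proof (intro conjI allI impI)
    fix S T :: "(real^'n) set set"
    assume S: "S \<subseteq> proj_points \<and> open {x. x \<noteq> 0 \<and> span {x} \<in> S}"
      and T: "T \<subseteq> proj_points \<and> open {x. x \<noteq> 0 \<and> span {x} \<in> T}"
    show "S \<inter> T \<subseteq> proj_points" using S by blast
    have "{x. x \<noteq> 0 \<and> span {x} \<in> S \<inter> T} = {x. x \<noteq> 0 \<and> span {x} \<in> S} \<inter> {x. x \<noteq> 0 \<and> span {x} \<in> T}"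
      by blast
    then show "open {x. x \<noteq> 0 \<and> span {x} \<in> S \<inter> T}" using S T by auto
  next
    fix \<K> :: "(real^'n) set set set"
    assume K: "\<forall>S\<in>\<K>. S \<subseteq> proj_points \<and> open {x. x \<noteq> 0 \<and> span {x} \<in> S}"
    then show "\<Union>\<K> \<subseteq> proj_points" by blast
    have "{x. x \<noteq> 0 \<and> span {x} \<in> \<Union>\<K>} = (\<Union>S\<in>\<K>. {x. x \<noteq> 0 \<and> span {x} \<in> S})"
      by blast
    then show "open {x. x \<noteq> 0 \<and> span {x} \<in> \<Union>\<K>}" using K by auto
  qed
  then show ?thesis unfolding proj_topology_def by (subst topology_inverse') auto
qed

lemma topspace_proj_topology [simp]: "topspace (proj_topology :: (real^'n) set topology) = proj_points"
proof -
  have "{x::real^'n. x \<noteq> 0 \<and> span {x} \<in> proj_points} = - {0}"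
    using span_singleton_proj_points by auto
  then have "open {x::real^'n. x \<noteq> 0 \<and> span {x} \<in> proj_points}"
    by (simp only: open_Compl closed_singleton)
  then have "openin proj_topology (proj_points :: (real^'n) set set)"
    by (simp only: openin_proj_topology order_refl)
  then show ?thesis
    using openin_subset openin_proj_topology[of "topspace (proj_topology :: (real^'n) set topology)"]
    by blast
qed

definition proj_map :: "real^'n^'n \<Rightarrow> (real^'n) set \<Rightarrow> (real^'n) set" where
  "proj_map A l = (\<lambda>x. A *v x) ` l"

lemma proj_map_span: "proj_map A (span {x}) = span {A *v x}"
  unfolding proj_map_def
  using linear_span_image[OF matrix_vector_mul_linear[of A], of "{x}"] by simp

lemma proj_points_cases:
  assumes "l \<in> proj_points"
  obtains x where "x \<noteq> 0" "l = span {x}"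
proof -
  have l: "subspace l" "dim l = 1" using assms by (auto simp: proj_points_def)
  obtain B where B: "B \<subseteq> l" "independent B" "l \<subseteq> span B" "card B = 1"
    using basis_exists[of l] l(2) by metis
  then obtain x where x: "B = {x}" by (auto simp: card_1_singleton_iff)
  moreover have "x \<noteq> 0" using B(2) x by (auto simp: dependent_zero)
  moreover have "l = span {x}"
    using B(1,3) x span_minimal[OF B(1) l(1)] by blast
  ultimately show ?thesis using that by blast
qed

lemma continuous_map_proj_map:
  fixes A :: "real^'n^'n"
  assumes "A \<in> special_linear"
  shows "continuous_map proj_topology proj_topology (proj_map A)"
proof -
  have inv: "A *v x \<noteq> 0" if "x \<noteq> 0" for x
    using assms that invertible_det_nz[of A] matrix_left_invertible_ker[of A]
    by (auto simp: special_linear_def invertible_def)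
  have pts: "proj_map A l \<in> proj_points" if "l \<in> proj_points" for l
    using that by (auto elim!: proj_points_cases simp: proj_map_span inv intro!: span_singleton_proj_points)
  have "openin proj_topology {l \<in> proj_points. proj_map A l \<in> U}" if U: "openin proj_topology U" for U
  proof -
    have "{x. x \<noteq> 0 \<and> span {x} \<in> {l \<in> proj_points. proj_map A l \<in> U}}
        = (*v) A -` {x. x \<noteq> 0 \<and> span {x} \<in> U}"
      by (force simp: proj_map_span inv intro: span_singleton_proj_points)
    moreover have "open ((*v) A -` {x. x \<noteq> 0 \<and> span {x} \<in> U})"
      using U by (intro open_vimage) (auto simp: openin_proj_topology intro!: continuous_intros)
    ultimately show ?thesis by (auto simp: openin_proj_topology)
  qed
  then show ?thesis
    using pts by (auto simp: continuous_map_def)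
qed

lemma measurable_proj_map:
  fixes A :: "real^'n^'n"
  assumes "A \<in> special_linear"
  shows "proj_map A \<in> borel_of proj_topology \<rightarrow>\<^sub>M borel_of proj_topology"
proof -
  have cont: "continuous_map proj_topology proj_topology (proj_map A)"
    using assms by (rule continuous_map_proj_map)
  show ?thesis
  proof (rule measurable_sigma_sets[OF sets_borel_of])
    show "{U. openin proj_topology U} \<subseteq> Pow (topspace proj_topology)"
      using openin_subset by blast
    show "proj_map A \<in> space (borel_of proj_topology) \<rightarrow> topspace proj_topology"
      using cont by (auto simp: continuous_map_def)
    fix U :: "(real^'n) set set"
    assume "U \<in> {U. openin proj_topology U}"
    then have "openin proj_topology {l \<in> topspace proj_topology. proj_map A l \<in> U}"
      using cont by (auto simp: continuous_map_def)
    moreover have "{l \<in> topspace proj_topology. proj_map A l \<in> U}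
        = proj_map A -` U \<inter> space (borel_of proj_topology)"
      by auto
    ultimately show "proj_map A -` U \<inter> space (borel_of proj_topology) \<in> sets (borel_of proj_topology)"
      by (simp add: sets_borel_of sigma_sets.Basic)
  qed
qed

definition finite_subspace_union :: "(real^'n) set \<Rightarrow> bool" where
  "finite_subspace_union U \<longleftrightarrow>
     (\<exists>F. finite F \<and> F \<noteq> {} \<and> (\<forall>S\<in>F. subspace S \<and> S \<noteq> {0} \<and> S \<noteq> UNIV) \<and> U = \<Union>F)"

definition finite_moment_condition :: "(real^'n^'n) measure set \<Rightarrow> bool" where
  "finite_moment_condition K \<longleftrightarrow>
     (\<exists>\<gamma>>0. \<exists>C::real. \<forall>\<mu>\<in>K. (\<integral>\<^sup>+A. ennreal (onorm ((*v) A) powr \<gamma>) \<partial>\<mu>) < ennreal C)"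

definition measures_condition :: "(real^'n^'n) measure set \<Rightarrow> bool" where
  "measures_condition K \<longleftrightarrow>
     (\<forall>\<mu>\<in>K. \<not> (\<exists>\<nu>\<^sub>1\<in>borel_prob_measures proj_topology. \<exists>\<nu>\<^sub>2\<in>borel_prob_measures proj_topology.
        AE A in \<mu>. distr \<nu>\<^sub>1 (borel_of proj_topology) (proj_map A) = \<nu>\<^sub>2))"

definition spaces_condition :: "(real^'n^'n) measure set \<Rightarrow> bool" where
  "spaces_condition K \<longleftrightarrow>
     (\<forall>\<mu>\<in>K. \<not> (\<exists>U U'. finite_subspace_union U \<and> finite_subspace_union U' \<and>
        (AE A in \<mu>. (\<lambda>x. A *v x) ` U = U')))"

primrec rand_prod :: "nat \<Rightarrow> (nat \<Rightarrow> real^'n^'n) \<Rightarrow> real^'n^'n" where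
  "rand_prod 0 A = mat 1"
| "rand_prod (Suc n) A = A (Suc n) ** rand_prod n A"

definition expected_log_norm :: "nat \<Rightarrow> (nat \<Rightarrow> (real^'n^'n) measure) \<Rightarrow> real" where
  "expected_log_norm n \<mu> =
     (\<integral>A. ln (onorm ((*v) (rand_prod n A))) \<partial>(\<Pi>\<^sub>M i\<in>{1..n}. \<mu> i))"

end

theory Submission
  imports Defs
begin

text \<open>
  Write \<open>T = A\<^sub>n \<cdots> A\<^sub>1\<close> for the random product. Concentration follows once the growth of a single
  vector is, on average and up to \<open>\<epsilon> m\<close>, the growth of the norm over every block of \<open>m\<close> factors:
  cut the product into such blocks, let \<open>c\<close> be the sum of the expected log-norms of the blocks, and
  expand \<open>|T u| powr (\<plusminus>s)\<close> to second order on each block for a small \<open>s > 0\<close>. The errors of the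
  blocks multiply, which gives \<open>E |T v| powr (\<plusminus>s) \<le> exp (\<plusminus>s c + s \<epsilon> n + C')\<close> uniformly in the
  measures and in the unit vector \<open>v\<close> (\<open>exponential_moments\<close>). Chernoff's bound then localizes
  \<open>ln |T v|\<close> near \<open>c\<close>; the norm of \<open>T\<close> is comparable to the largest of the \<open>|T e\<^sub>i|\<close>, so \<open>ln \<parallel>T\<parallel>\<close> is
  near \<open>c\<close> as well, and by Jensen's inequality so is its expectation (\<open>large_deviations\<close>).

  For the comparison on a block (\<open>block_growth\<close>) write \<open>T = S T'\<close>, where \<open>T'\<close> consists of the first \<open>k\<close>
  factors and \<open>k\<close> stays fixed while \<open>m\<close> grows. A matrix \<open>S\<close> stretches \<open>x\<close> almost as much as its
  norm allows unless \<open>x\<close> is close to a certain hyperplane depending on \<open>S\<close>. Since \<open>T' u\<close> is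
  independent of \<open>S\<close>, it is enough that \<open>T' u\<close> is unlikely to be close to any given hyperplane;
  on the exceptional event the loss is at most a multiple of \<open>1 + ln \<parallel>S\<parallel>\<close>, whose expectation grows
  linearly in \<open>m\<close>, and this is multiplied by the small probability of the event.

  So the core is a statement about directions (\<open>dissolves\<close>): for every \<open>\<eta> > 0\<close> there are \<open>m\<close> and
  \<open>r > 0\<close> such that a product of \<open>m\<close> factors brings a vector \<open>r\<close>-close to a given proper subspace with
  probability at most \<open>\<eta>\<close>. Suppose not, let \<open>k\<close> be the least dimension for which this fails, and let
  \<open>W > 0\<close> be the asymptotic maximal mass near a subspace of dimension \<open>k\<close>. Take products of length
  \<open>j\<close> whose laws have mass almost \<open>W\<close> near some subspace, and pass to the limit \<open>j \<rightarrow> \<infinity>\<close> along an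
  ultrafilter, simultaneously at all times \<open>i\<close> counted backwards from the end. Let \<open>F i\<close> be the set of
  subspaces of dimension \<open>k\<close> that carry the full mass \<open>W\<close> in the limit at time \<open>i\<close>. Subspaces of smaller
  dimension carry no mass, so distinct members of \<open>F i\<close> have disjoint masses and \<open>F i\<close> has
  at most \<open>1 / W\<close> elements (\<open>card_heavy_le\<close>). No subspace carries more than \<open>W\<close>, so if \<open>S\<close> carries \<open>W\<close>
  after a step then almost every preimage of \<open>S\<close> carries \<open>W\<close> before it (\<open>heavy_preimage\<close>), where
  almost every refers to the limit measure of that step, which exists in \<open>K\<close> by compactness. Hence
  the cardinality of \<open>F i\<close> does not decrease with \<open>i\<close>; being bounded it is somewhere constant,
  and there almost every matrix maps the union of \<open>F (Suc i)\<close> onto the union of \<open>F i\<close>. This is what the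
  spaces condition excludes.
\<close>

section \<open>Operator norms, determinants and closeness to a subspace\<close>

abbreviation mnorm :: "real^'n^'n \<Rightarrow> real" where
  "mnorm A \<equiv> onorm ((*v) A)"

lemma norm_mult_vec_le: "norm (A *v x) \<le> mnorm A * norm x"
  by (rule onorm[OF matrix_vector_mul_bounded_linear])

lemma mnorm_nonneg: "0 \<le> mnorm A"
  by (rule onorm_pos_le[OF matrix_vector_mul_bounded_linear])

lemma mnorm_mult_le: "mnorm (A ** B) \<le> mnorm A * mnorm B"
proof -
  have "(*v) (A ** B) = (*v) A \<circ> (*v) B"
    by (auto simp: matrix_vector_mul_assoc)
  then show ?thesis
    using onorm_compose[OF matrix_vector_mul_bounded_linear[of A] matrix_vector_mul_bounded_linear[of B]]
    by simp
qed

lemma mnorm_le_norm: "mnorm (A::real^'n^'n) \<le> (real CARD('n))\<^sup>2 * norm A"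
proof -
  have "\<bar>A $ i $ j\<bar> \<le> norm A" for i j
    by (meson Finite_Cartesian_Product.norm_nth_le order_trans component_le_norm_cart)
  from onorm_le_matrix_component[of A, OF this] show ?thesis
    by (simp add: power2_eq_square mult.assoc)
qed

lemma mnorm_diff_le: "mnorm A \<le> mnorm B + mnorm (A - B)"
  using onorm_triangle[OF matrix_vector_mul_bounded_linear[of B] matrix_vector_mul_bounded_linear[of "A - B"]]
  by (simp add: matrix_vector_mult_diff_rdistrib)

lemma continuous_mnorm: "continuous_on UNIV (mnorm :: real^'n^'n \<Rightarrow> real)"
proof -
  let ?L = "(real CARD('n))\<^sup>2"
  have "?L-lipschitz_on UNIV (mnorm :: real^'n^'n \<Rightarrow> real)"
  proof (rule lipschitz_onI)
    fix A B :: "real^'n^'n"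
    have "mnorm A - mnorm B \<le> ?L * norm (A - B)"
      using mnorm_diff_le[of A B] mnorm_le_norm[of "A - B"] by linarith
    moreover have "mnorm B - mnorm A \<le> ?L * norm (A - B)"
      using mnorm_diff_le[of B A] mnorm_le_norm[of "B - A"] by (simp add: norm_minus_commute)
    ultimately show "dist (mnorm A) (mnorm B) \<le> ?L * dist A B"
      by (simp add: dist_norm abs_le_iff)
  qed simp
  then show ?thesis by (rule lipschitz_on_continuous_on)
qed

lemma borel_measurable_mnorm [measurable]: "mnorm \<in> borel_measurable borel"
  by (rule borel_measurable_continuous_onI[OF continuous_mnorm])

lemma abs_det_le_entries:
  fixes A :: "real^'n^'n"
  assumes "\<And>i j. \<bar>A $ i $ j\<bar> \<le> B"
  shows "\<bar>det A\<bar> \<le> fact CARD('n) * B ^ CARD('n)"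
proof -
  have "\<bar>det A\<bar> \<le> (\<Sum>p\<in>{p. p permutes (UNIV::'n set)}. \<bar>of_int (sign p) * (\<Prod>i\<in>UNIV. A $ i $ p i)\<bar>)"
    unfolding det_def by (rule sum_abs)
  also have "\<dots> \<le> (\<Sum>p\<in>{p. p permutes (UNIV::'n set)}. B ^ CARD('n))"
  proof (rule sum_mono)
    fix p :: "'n \<Rightarrow> 'n"
    have "\<bar>of_int (sign p) * (\<Prod>i\<in>UNIV. A $ i $ p i)\<bar> = (\<Prod>i\<in>UNIV. \<bar>A $ i $ p i\<bar>)"
      by (simp add: abs_mult abs_prod sign_def)
    also have "\<dots> \<le> (\<Prod>i\<in>(UNIV::'n set). B)"
      using assms by (intro prod_mono) auto
    finally show "\<bar>of_int (sign p) * (\<Prod>i\<in>UNIV. A $ i $ p i)\<bar> \<le> B ^ CARD('n)" by simp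
  qed
  also have "\<dots> = fact CARD('n) * B ^ CARD('n)"
    by (simp add: card_permutations)
  finally show ?thesis .
qed

text \<open>The powers of \<open>A\<close> keep determinant 1, while their norms, and with them their entries and
  determinants, would tend to 0 if \<open>A\<close> had norm less than 1.\<close>

lemma mnorm_ge_1:
  fixes A :: "real^'n^'n"
  assumes A: "det A = 1"
  shows "1 \<le> mnorm A"
proof (rule ccontr)
  assume "\<not> 1 \<le> mnorm A"
  then have lt: "0 \<le> mnorm A" "mnorm A < 1" using mnorm_nonneg[of A] by auto
  define P where "P k = (((**) A) ^^ k) (mat 1)" for k :: nat
  have det: "det (P k) = 1" for k
    by (induction k) (auto simp: P_def det_mul A)
  have nrm: "mnorm (P k) \<le> mnorm A ^ k" for k
  proof (induction k)
    case 0
    have "(*v) (mat 1 :: real^'n^'n) = id" by auto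
    then show ?case by (simp add: P_def onorm_id)
  next
    case (Suc k)
    have "mnorm (P (Suc k)) \<le> mnorm A * mnorm (P k)" by (simp add: P_def mnorm_mult_le)
    also have "\<dots> \<le> mnorm A * mnorm A ^ k" by (intro mult_left_mono Suc lt)
    finally show ?case by simp
  qed
  have "1 \<le> fact CARD('n) * (mnorm A ^ k) ^ CARD('n)" for k
  proof -
    have "\<bar>P k $ i $ j\<bar> \<le> mnorm A ^ k" for i j
      using matrix_component_le_onorm[of "P k" i j] nrm[of k] by linarith
    from abs_det_le_entries[of "P k", OF this] show ?thesis by (simp add: det)
  qed
  moreover have "(\<lambda>k. fact CARD('n) * (mnorm A ^ k) ^ CARD('n)) \<longlonglongrightarrow> fact CARD('n) * 0 ^ CARD('n)"
    using lt by (intro tendsto_intros LIMSEQ_power_zero) auto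
  ultimately have "1 \<le> fact CARD('n) * (0::real) ^ CARD('n)"
    using LIMSEQ_le_const by blast
  then show False by (simp add: power_0_left)
qed

definition inv_const :: "'n::finite itself \<Rightarrow> real" where
  "inv_const _ = real CARD('n) * fact CARD('n)"

lemma inv_const_ge_1: "1 \<le> inv_const TYPE('n::finite)"
proof -
  have "1 \<le> real CARD('n)" "1 \<le> (fact CARD('n) :: real)" by (simp_all add: Suc_leI)
  then show ?thesis unfolding inv_const_def
    by (metis mult_mono' mult_1 zero_le_one)
qed

text \<open>Cramer's rule: the coordinates of \<open>x\<close> are determinants of matrices with entries bounded by \<open>\<parallel>A\<parallel>\<close> as
  soon as \<open>A x\<close> is scaled to have norm \<open>\<parallel>A\<parallel>\<close>. So on the special linear group the norm alone controls
  the contraction of vectors, and a moment of the norm bounds positive and negative moments of \<open>|A x|\<close>.\<close>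

lemma norm_le_mult_vec:
  fixes A :: "real^'n^'n"
  assumes A: "det A = 1"
  shows "norm x \<le> inv_const TYPE('n) * mnorm A ^ CARD('n) * norm (A *v x)"
proof (cases "x = 0")
  case False
  let ?d = "real CARD('n)"
  have a1: "1 \<le> mnorm A" by (rule mnorm_ge_1[OF A])
  have inv: "invertible A" using A invertible_det_nz[of A] by simp
  have key: "norm z \<le> ?d * (fact CARD('n) * mnorm A ^ CARD('n))" if z: "norm (A *v z) \<le> mnorm A" for z
  proof -
    have "\<bar>z $ k\<bar> \<le> fact CARD('n) * mnorm A ^ CARD('n)" for k
    proof -
      define B where "B = (\<chi> i j. if j = k then (A *v z) $ i else A $ i $ j)"
      have "z = (\<chi> k. det (\<chi> i j. if j = k then (A *v z) $ i else A $ i $ j) / det A)"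
        by (rule iffD1[OF cramer]) (simp_all add: A)
      then have "z $ k = (\<chi> k. det (\<chi> i j. if j = k then (A *v z) $ i else A $ i $ j) / det A) $ k"
        by (rule arg_cong)
      then have "z $ k = det B" unfolding B_def using A by simp
      moreover have "\<bar>B $ i $ j\<bar> \<le> mnorm A" for i j
        using z component_le_norm_cart[of "A *v z" i] matrix_component_le_onorm[of A i j]
        by (auto simp: B_def)
      ultimately show ?thesis using abs_det_le_entries[of B "mnorm A"] by simp
    qed
    then have "(\<Sum>k\<in>UNIV. \<bar>z $ k\<bar>) \<le> ?d * (fact CARD('n) * mnorm A ^ CARD('n))"
      using sum_bounded_above[of UNIV "\<lambda>k. \<bar>z $ k\<bar>"] by simp
    then show ?thesis using norm_le_l1_cart[of z] by linarith
  qed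
  have nz: "A *v x \<noteq> 0"
    using False inv matrix_left_invertible_ker[of A] by (auto simp: invertible_def)
  \<comment> \<open>scaling that gives the image of \<open>x\<close> the norm of \<open>A\<close>\<close>
  define t where "t = mnorm A / norm (A *v x)"
  have "norm (t *\<^sub>R x) \<le> ?d * (fact CARD('n) * mnorm A ^ CARD('n))"
    by (rule key) (use nz a1 in \<open>simp add: t_def matrix_vector_mult_scaleR\<close>)
  then have "mnorm A * norm x \<le> ?d * (fact CARD('n) * mnorm A ^ CARD('n)) * norm (A *v x)"
    using nz a1 by (simp add: t_def field_simps)
  moreover have "norm x \<le> mnorm A * norm x"
    using a1 by (simp add: mult_le_cancel_right1)
  ultimately show ?thesis
    by (simp add: inv_const_def power_mult_distrib mult.assoc)
qed simp

text \<open>A row containing an entry of maximal absolute value points in a direction \<open>w\<close> whose orthogonal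
  complement is the only hyperplane near which \<open>A\<close> can contract much relative to its norm.\<close>

lemma row_functional:
  fixes A :: "real^'n^'n"
  assumes "0 < mnorm A"
  shows "\<exists>w. norm w = 1 \<and> (\<forall>x. mnorm A * \<bar>w \<bullet> x\<bar> \<le> (real CARD('n))\<^sup>2 * norm (A *v x))"
proof -
  define E where "E p = \<bar>A $ fst p $ snd p\<bar>" for p
  define M where "M = Max (range E)"
  have "M \<in> range E" unfolding M_def by (rule Max_in) auto
  then obtain i j where ij: "M = \<bar>A $ i $ j\<bar>" by (auto simp only: E_def)
  have "E (i', j') \<le> M" for i' j'
    unfolding M_def by (rule Max_ge) auto
  then have "\<bar>A $ i' $ j'\<bar> \<le> M" for i' j' by (simp add: E_def)
  from onorm_le_matrix_component[of A, OF this] have le: "mnorm A \<le> (real CARD('n))\<^sup>2 * M"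
    by (simp add: power2_eq_square mult.assoc)
  have M: "M \<le> norm (A $ i)" using component_le_norm_cart[of "A $ i" j] ij by simp
  have "0 < M"
  proof (rule ccontr)
    assume "\<not> 0 < M"
    then have "(real CARD('n))\<^sup>2 * M \<le> 0" by (simp add: mult_nonneg_nonpos)
    then show False using le assms by simp
  qed

  define w where "w = A $ i /\<^sub>R norm (A $ i)"
  have ri: "0 < norm (A $ i)" using M \<open>0 < M\<close> by linarith
  then have "norm w = 1" by (simp add: w_def)
  moreover have "mnorm A * \<bar>w \<bullet> x\<bar> \<le> (real CARD('n))\<^sup>2 * norm (A *v x)" for x
  proof -
    have "A $ i \<bullet> x = norm (A $ i) * (w \<bullet> x)"
      using ri by (simp add: w_def)
    moreover have "\<bar>A $ i \<bullet> x\<bar> \<le> norm (A *v x)"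
      using component_le_norm_cart[of "A *v x" i] by (simp add: matrix_vector_mul_component)
    ultimately have "M * \<bar>w \<bullet> x\<bar> \<le> norm (A *v x)"
      using M by (simp add: abs_mult) (meson abs_ge_zero mult_right_mono order_trans)
    then have "(real CARD('n))\<^sup>2 * M * \<bar>w \<bullet> x\<bar> \<le> (real CARD('n))\<^sup>2 * norm (A *v x)"
      by (simp add: mult.assoc mult_left_mono)
    then show ?thesis
      using le by (meson abs_ge_zero mult_right_mono order_trans)
  qed
  ultimately show ?thesis by blast
qed

text \<open>A cone around the subspace \<open>S\<close>, homogeneous in \<open>x\<close>: on lines it is a closed neighbourhood of the
  projectivization of \<open>S\<close>. Working with nonzero vectors modulo scaling avoids the projective space
  as a type.\<close>

definition near :: "real \<Rightarrow> (real^'n) set \<Rightarrow> (real^'n) set" where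
  "near r S = {x. infdist x S \<le> r * norm x}"

lemma closed_near: "closed (near r S)"
  unfolding near_def by (intro closed_Collect_le continuous_intros)

lemma near_sets [measurable]: "near r S \<in> sets borel"
  using closed_near by (rule borel_closed)

lemma near_mono: "r \<le> r' \<Longrightarrow> near r S \<subseteq> near r' S"
  unfolding near_def by (auto elim!: order_trans intro: mult_right_mono)

lemma mem_near_iff:
  assumes "subspace S"
  shows "x \<in> near r S \<longleftrightarrow> (\<exists>s\<in>S. norm (x - s) \<le> r * norm x)"
proof
  assume "x \<in> near r S"
  moreover obtain s where "s \<in> S" "infdist x S = dist x s"
    using infdist_attains_inf[of S x] closed_subspace[OF assms] subspace_0[OF assms] by blast
  ultimately show "\<exists>s\<in>S. norm (x - s) \<le> r * norm x"
    by (auto simp: near_def dist_norm)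
next
  assume "\<exists>s\<in>S. norm (x - s) \<le> r * norm x"
  then show "x \<in> near r S"
    unfolding near_def using infdist_le[of _ S x] by (force simp: dist_norm)
qed

lemma subspace_preimage: "subspace S \<Longrightarrow> subspace ((*v) (A::real^'m^'n) -` S)"
  by (auto simp: subspace_def matrix_vector_right_distrib matrix_vector_mult_scaleR)

lemma near_preimage:
  assumes S: "subspace S" and r: "0 \<le> r"
    and a: "norm (A *v x) \<le> a * norm x" and b: "\<And>y. norm y \<le> b * norm (A *v y)" and b0: "0 \<le> b"
    and A: "surj ((*v) A)" and x: "A *v x \<in> near r S"
  shows "x \<in> near (a * b * r) ((*v) A -` S)"
proof -
  obtain s where s: "s \<in> S" "norm (A *v x - s) \<le> r * norm (A *v x)"
    using x mem_near_iff[OF S] by blast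
  obtain y where y: "s = A *v y" using A by (metis surjD)
  have "norm (x - y) \<le> b * norm (A *v x - s)"
    using b[of "x - y"] by (simp add: y matrix_vector_mult_diff_distrib)
  also have "\<dots> \<le> b * (r * (a * norm x))"
    using s(2) a b0 r by (meson mult_left_mono order_trans)
  finally have "norm (x - y) \<le> a * b * r * norm x" by (simp add: mult_ac)
  then show ?thesis
    unfolding mem_near_iff[OF subspace_preimage[OF S]] using s(1) y by blast
qed

text \<open>Compactness of the sphere: otherwise unit vectors that come arbitrarily close to both \<open>S\<close> and \<open>T\<close>
  accumulate at a unit vector of \<open>S \<inter> T\<close>.\<close>

lemma near_Int:
  assumes S: "subspace S" and T: "subspace T" and r: "0 < r"
  shows "\<exists>r'>0. near r' S \<inter> near r' T \<subseteq> near r (S \<inter> T)"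
proof (rule ccontr)
  assume neg: "\<not> ?thesis"
  have "\<exists>x. norm x = 1 \<and> x \<in> near (1 / Suc n) S \<inter> near (1 / Suc n) T \<and> x \<notin> near r (S \<inter> T)" for n
  proof -
    have "\<not> near (1 / Suc n) S \<inter> near (1 / Suc n) T \<subseteq> near r (S \<inter> T)"
      using neg by (metis of_nat_0_less_iff zero_less_Suc zero_less_divide_1_iff)
    then obtain x where x: "x \<in> near (1 / Suc n) S" "x \<in> near (1 / Suc n) T" "x \<notin> near r (S \<inter> T)"
      by blast
    have st: "subspace (S \<inter> T)" by (rule subspace_inter[OF S T])
    have x0: "x \<noteq> 0" using x(3) subspace_0[OF st] unfolding mem_near_iff[OF st]
      by (metis diff_zero mult_zero_right norm_zero order_refl)
    have scale: "(c *\<^sub>R y) \<in> near q V" if V: "subspace V" and y: "y \<in> near q V" and c: "0 < c" for c q V and y :: "real^'a"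
    proof -
      obtain s where "s \<in> V" "norm (y - s) \<le> q * norm y" using y mem_near_iff[OF V] by blast
      then have "c *\<^sub>R s \<in> V" "norm (c *\<^sub>R y - c *\<^sub>R s) \<le> q * norm (c *\<^sub>R y)"
        using c V by (auto simp: subspace_scale simp flip: scaleR_diff_right)
      then show ?thesis using mem_near_iff[OF V] by blast
    qed
    let ?y = "(1 / norm x) *\<^sub>R x"
    have "norm ?y = 1" using x0 by simp
    moreover have "?y \<notin> near r (S \<inter> T)"
      using scale[OF st, of ?y r "norm x"] x0 x(3) by auto
    ultimately show ?thesis
      using scale[OF S x(1)] scale[OF T x(2)] x0 by (intro exI[of _ ?y]) simp
  qed
  then obtain x where x: "\<And>n. norm (x n) = 1" "\<And>n. x n \<in> near (1 / Suc n) S"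
    "\<And>n. x n \<in> near (1 / Suc n) T" "\<And>n. x n \<notin> near r (S \<inter> T)" by (metis IntD1 IntD2)
  have "compact (sphere (0::real^'a) 1)" by simp
  then obtain l h where l: "norm l = 1" "strict_mono (h::nat\<Rightarrow>nat)" "(x \<circ> h) \<longlonglongrightarrow> l"
    using x(1) unfolding compact_def by (metis dist_0_norm mem_sphere)
  have mem: "l \<in> V" if V: "subspace V" and xV: "\<And>n. x n \<in> near (1 / Suc n) V" for V
  proof -
    have "(\<lambda>n. infdist ((x \<circ> h) n) V) \<longlonglongrightarrow> infdist l V"
      by (intro tendsto_infdist l(3))
    moreover have "(\<lambda>n. infdist ((x \<circ> h) n) V) \<longlonglongrightarrow> 0"
    proof (rule tendsto_sandwich[OF _ _ tendsto_const])
      show "(\<lambda>n. 1 / Suc (h n)) \<longlonglongrightarrow> 0"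
        using LIMSEQ_subseq_LIMSEQ[OF LIMSEQ_inverse_real_of_nat l(2)]
        by (simp add: o_def field_simps)
      show "\<forall>\<^sub>F n in sequentially. infdist ((x \<circ> h) n) V \<le> 1 / Suc (h n)"
        using xV x(1) by (auto simp: near_def)
    qed (auto simp: infdist_nonneg)
    ultimately have "infdist l V = 0" by (rule LIMSEQ_unique)
    then show ?thesis
      using in_closed_iff_infdist_zero[OF closed_subspace[OF V]] subspace_0[OF V] by auto
  qed
  have "l \<in> S \<inter> T" using mem[OF S] mem[OF T] x by blast
  moreover obtain n where "dist ((x \<circ> h) n) l < r"
    using l(3) r by (metis LIMSEQ_iff_nz dist_norm order_refl lim_sequentially)
  ultimately have "infdist (x (h n)) (S \<inter> T) \<le> r * norm (x (h n))"
    using infdist_le[of l "S \<inter> T" "x (h n)"] x(1)[of "h n"] by simp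
  then show False using x(4)[of "h n"] by (simp add: near_def)
qed

text \<open>On nonzero vectors, a continuous homogeneous cut-off between the indicator functions of \<open>near r S\<close> and \<open>near (2 * r) S\<close>;
  continuity is what makes it compatible with weak convergence.\<close>

definition prox :: "real \<Rightarrow> (real^'n) set \<Rightarrow> real^'n \<Rightarrow> real" where
  "prox r S x = max 0 (min 1 (2 - infdist x S / (r * norm x)))"

lemma prox_bounds: "0 \<le> prox r S x" "prox r S x \<le> 1"
  by (auto simp: prox_def)

lemma prox_measurable [measurable]: "prox r S \<in> borel_measurable borel"
proof -
  have [measurable]: "(\<lambda>x. infdist x S) \<in> borel_measurable borel"
    by (intro borel_measurable_continuous_onI continuous_intros)
  show ?thesis unfolding prox_def[abs_def] by measurable
qed

lemma indicator_near_le_prox: "0 < r \<Longrightarrow> indicator (near r S) x \<le> prox r S x"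
  by (cases "x = 0") (auto simp: indicator_def near_def prox_def field_simps)

lemma prox_le_indicator_near:
  assumes "0 < r" "x \<noteq> 0"
  shows "prox r S x \<le> indicator (near (2 * r) S) x"
proof (cases "x \<in> near (2 * r) S")
  case False
  then have "2 < infdist x S / (r * norm x)"
    using assms by (simp add: near_def field_simps)
  then show ?thesis using False by (simp add: prox_def)
qed (simp add: prox_bounds)

lemma prox_lipschitz:
  assumes S: "subspace S" and r: "0 < r" and x: "x \<noteq> 0" and y: "y \<noteq> 0"
  shows "\<bar>prox r S x - prox r S y\<bar> \<le> 2 / r * (norm (x - y) / norm x)"
proof -
  have i1: "\<bar>infdist x S - infdist y S\<bar> \<le> norm (x - y)"
    using infdist_triangle_abs[of x S y] by (simp add: dist_norm)
  have i2: "0 \<le> infdist y S" "infdist y S \<le> norm y"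
    using infdist_le[OF subspace_0[OF S], of y] by (auto simp: infdist_nonneg)
  have "infdist x S / norm x - infdist y S / norm y
      = (infdist x S - infdist y S) / norm x + infdist y S / norm y * ((norm y - norm x) / norm x)"
    using x y by (simp add: field_simps)
  also have "\<bar>\<dots>\<bar> \<le> norm (x - y) / norm x + 1 * (norm (x - y) / norm x)"
  proof (intro abs_triangle_ineq[THEN order_trans] add_mono)
    show "\<bar>(infdist x S - infdist y S) / norm x\<bar> \<le> norm (x - y) / norm x"
      using i1 by (simp add: divide_right_mono)
    have "\<bar>norm y - norm x\<bar> \<le> norm (x - y)"
      using norm_triangle_ineq3[of y x] by (simp add: norm_minus_commute)
    then show "\<bar>infdist y S / norm y * ((norm y - norm x) / norm x)\<bar> \<le> 1 * (norm (x - y) / norm x)"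
      unfolding abs_mult using i2 y by (intro mult_mono) (auto simp: divide_right_mono)
  qed
  finally have "\<bar>infdist x S / norm x - infdist y S / norm y\<bar> \<le> 2 * (norm (x - y) / norm x)"
    by simp
  then have "\<bar>infdist x S / norm x - infdist y S / norm y\<bar> / r \<le> 2 * (norm (x - y) / norm x) / r"
    using r by (intro divide_right_mono) auto
  moreover have "\<bar>prox r S x - prox r S y\<bar> \<le> \<bar>infdist x S / (r * norm x) - infdist y S / (r * norm y)\<bar>"
    unfolding prox_def by (auto simp: max_def min_def abs_minus_commute)
  moreover have "infdist x S / (r * norm x) - infdist y S / (r * norm y)
     = (infdist x S / norm x - infdist y S / norm y) / r"
    by (simp add: diff_divide_distrib mult.commute)
  ultimately show ?thesis using r by (simp add: mult.commute)
qed

lemma near_hyperplane: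
  assumes "norm w = 1" "\<bar>w \<bullet> x\<bar> \<le> r * norm x"
  shows "x \<in> near r {y. w \<bullet> y = 0}"
proof -
  let ?s = "x - (w \<bullet> x) *\<^sub>R w"
  have "?s \<in> {y. w \<bullet> y = 0}" using assms(1) by (simp add: inner_diff_right dot_square_norm)
  moreover have "norm (x - ?s) \<le> r * norm x" using assms by simp
  ultimately show ?thesis using mem_near_iff[OF subspace_hyperplane[of w]] by blast
qed

section \<open>Limits along an ultrafilter\<close>

text \<open>The nonprincipal ultrafilters on the natural numbers. Limits along them exist for all sequences
  in a compact space, also where compactness does not provide convergent subsequences, and one
  ultrafilter serves countably many sequences at once.\<close>

definition ultra :: "nat filter \<Rightarrow> bool" where
  "ultra U \<longleftrightarrow> U \<noteq> bot \<and> U \<le> sequentially \<and>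
     (\<forall>P. eventually P U \<or> eventually (\<lambda>j. \<not> P j) U)"

text \<open>Zorn's lemma for the nontrivial filters below \<open>sequentially\<close>, ordered by reverse inclusion.\<close>

lemma ex_ultra: "\<exists>U. ultra U"
proof -
  define \<F> where "\<F> = {F :: nat filter. F \<noteq> bot \<and> F \<le> sequentially}"
  have "\<exists>U\<in>\<F>. \<forall>F\<in>\<F>. F \<le> U \<longrightarrow> F = U"
  proof -
    have "\<exists>m\<in>\<F>. \<forall>F\<in>\<F>. m \<ge> F \<longrightarrow> F = m"
    proof (rule predicate_Zorn)
      show "partial_order_on \<F> (relation_of (\<ge>) \<F>)"
        by (intro partial_order_on_relation_ofI) auto
    next
      fix C assume "C \<in> Chains (relation_of (\<ge>) \<F>)"
      then have C: "C \<subseteq> \<F>" "\<And>F G. F \<in> C \<Longrightarrow> G \<in> C \<Longrightarrow> F \<le> G \<or> G \<le> F"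
        by (auto simp: Chains_def relation_of_def)
      show "\<exists>u\<in>\<F>. \<forall>F\<in>C. F \<ge> u"
      proof (cases "C = {}")
        case True
        then show ?thesis by (intro bexI[of _ sequentially]) (auto simp: \<F>_def)
      next
        case False
        have "eventually P (Inf C) \<longleftrightarrow> (\<exists>F\<in>C. eventually P F)" for P
        proof (rule eventually_Inf_base[OF False])
          fix F G assume FG: "F \<in> C" "G \<in> C"
          from C(2)[OF FG] show "\<exists>H\<in>C. H \<le> inf F G"
            using FG by (auto intro: bexI[of _ F] bexI[of _ G])
        qed
        from this[of "\<lambda>_. False"] have "Inf C \<noteq> bot"
          using C(1) by (auto simp: \<F>_def)
        moreover have "Inf C \<le> sequentially"
          using False C(1) unfolding \<F>_def by (auto intro: Inf_lower2)
        ultimately show ?thesis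
          by (intro bexI[of _ "Inf C"]) (auto simp: \<F>_def Inf_lower)
      qed
    qed
    then show ?thesis by blast
  qed
  then obtain U where U: "U \<in> \<F>" "\<And>F. F \<in> \<F> \<Longrightarrow> F \<le> U \<Longrightarrow> F = U" by blast
  have "eventually P U \<or> eventually (\<lambda>j. \<not> P j) U" for P
  proof (cases "inf U (principal {j. P j}) = bot")
    case True
    then have "eventually (\<lambda>_. False) (inf U (principal {j. P j}))" by simp
    then show ?thesis
      unfolding eventually_inf_principal by (auto elim: eventually_mono)
  next
    case False
    then have "inf U (principal {j. P j}) \<in> \<F>"
      using U(1) by (auto simp: \<F>_def intro: le_infI1)
    then have "inf U (principal {j. P j}) = U" using U(2) by simp
    then have "U \<le> principal {j. P j}" by (metis inf.cobounded2)
    then show ?thesis by (auto simp: le_principal)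
  qed
  then show ?thesis using U(1) by (auto simp: ultra_def \<F>_def)
qed

context
  fixes U :: "nat filter"
  assumes U: "ultra U"
begin

lemma ultra_nontriv: "U \<noteq> bot"
  using U by (simp add: ultra_def)

lemma ultra_not: "(\<not> eventually P U) \<longleftrightarrow> eventually (\<lambda>j. \<not> P j) U"
proof (rule iffI)
  assume "\<not> eventually P U"
  moreover have "eventually P U \<or> eventually (\<lambda>j. \<not> P j) U"
    using U[unfolded ultra_def] by (elim conjE allE[of _ P])
  ultimately show "eventually (\<lambda>j. \<not> P j) U" by simp
next
  assume "eventually (\<lambda>j. \<not> P j) U"
  show "\<not> eventually P U"
  proof (rule notI)
    assume "eventually P U"
    with \<open>eventually (\<lambda>j. \<not> P j) U\<close> have "eventually (\<lambda>j. False) U" by (rule eventually_elim2) (rule notE)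
    then show False using ultra_nontriv unfolding eventually_False by (rule notE[rotated])
  qed
qed

lemma ultra_eventually_ge: "eventually (\<lambda>j. N \<le> j) U"
  using U by (auto simp: ultra_def intro: filter_leD eventually_ge_at_top)

lemma ultra_compactin:
  assumes K: "compactin T K" and f: "\<And>j. f j \<in> K"
  shows "\<exists>l\<in>K. \<forall>V. openin T V \<and> l \<in> V \<longrightarrow> eventually (\<lambda>j. f j \<in> V) U"
proof (rule ccontr)
  assume neg: "\<not> ?thesis"
  define \<V> where "\<V> = {V. openin T V \<and> \<not> eventually (\<lambda>j. f j \<in> V) U}"
  have "K \<subseteq> \<Union>\<V>"
  proof
    fix l assume "l \<in> K"
    then have "\<exists>V. (openin T V \<and> l \<in> V) \<and> \<not> eventually (\<lambda>j. f j \<in> V) U"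
      using neg by simp
    then show "l \<in> \<Union>\<V>" unfolding \<V>_def by (elim exE conjE) (rule UnionI, simp_all)
  qed
  moreover have "\<forall>V\<in>\<V>. openin T V" by (simp add: \<V>_def)
  ultimately obtain \<W> where W: "finite \<W>" "\<W> \<subseteq> \<V>" "K \<subseteq> \<Union>\<W>"
    using K unfolding compactin_def by meson
  have "eventually (\<lambda>j. \<forall>V\<in>\<W>. f j \<notin> V) U"
  proof (intro eventually_ball_finite ballI)
    fix V assume "V \<in> \<W>"
    then have "\<not> eventually (\<lambda>j. f j \<in> V) U" using W(2) by (auto simp: \<V>_def)
    then show "eventually (\<lambda>j. f j \<notin> V) U" by (simp only: ultra_not)
  qed fact
  moreover have "\<not> (\<forall>V\<in>\<W>. f j \<notin> V)" for j using f[of j] W(3) by blast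
  ultimately show False using ultra_nontriv by (simp add: eventually_False)
qed

lemma ultra_compact:
  fixes f :: "nat \<Rightarrow> 'a :: topological_space"
  assumes "compact K" "\<And>j. f j \<in> K"
  shows "\<exists>l\<in>K. (f \<longlongrightarrow> l) U"
proof -
  have "compactin euclidean K" using assms(1) by simp
  from ultra_compactin[where f = f, OF this assms(2)] show ?thesis
    by (auto simp: tendsto_def)
qed

definition ulim :: "(nat \<Rightarrow> real) \<Rightarrow> real" where
  "ulim f = Lim U f"

lemma tendsto_ulim:
  assumes "\<And>j. f j \<in> {a..b}"
  shows "(f \<longlongrightarrow> ulim f) U"
proof -
  obtain l where "(f \<longlongrightarrow> l) U"
    using ultra_compact[where f = f, OF compact_Icc assms] by blast
  then show ?thesis unfolding ulim_def
    using tendsto_Lim[OF ultra_nontriv] by blast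
qed

end

text \<open>Weak convergence tests a fixed function, but here the integrands \<open>g j\<close> vary with \<open>j\<close>. On an index set \<open>J n\<close> of the
  ultrafilter the \<open>g j\<close> exceed their limit \<open>h\<close> by at most \<open>1 / Suc n\<close> at the first \<open>n + 1\<close> points of a
  countable dense set. By equicontinuity the supremum \<open>s n\<close> of the \<open>g j\<close> over \<open>J n\<close> is continuous, and
  \<open>s n\<close> tends to \<open>h\<close> everywhere. Weak convergence applies to each \<open>s n\<close>, and
  dominated convergence to the passage \<open>n \<rightarrow> \<infinity>\<close>.\<close>

lemma ultra_integral_le:
  fixes M :: "nat \<Rightarrow> 'a::{metric_space,second_countable_topology} measure" and g :: "nat \<Rightarrow> 'a \<Rightarrow> real"
  assumes U: "ultra U"
    and M: "\<And>j. prob_space (M j)" "\<And>j. sets (M j) = sets (restrict_space borel X)"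
    and N: "prob_space N" "sets N = sets (restrict_space borel X)"
    and weak: "\<And>f :: 'a \<Rightarrow> real. continuous_on X f \<Longrightarrow> bounded (f ` X) \<Longrightarrow> ((\<lambda>j. \<integral>x. f x \<partial>M j) \<longlongrightarrow> (\<integral>x. f x \<partial>N)) U"
    and g01: "\<And>j x. x \<in> X \<Longrightarrow> g j x \<in> {0..1::real}"
    and equi: "\<And>x e. x \<in> X \<Longrightarrow> 0 < e \<Longrightarrow> \<exists>d>0. \<forall>y\<in>X. dist x y < d \<longrightarrow> (\<forall>j. \<bar>g j x - g j y\<bar> \<le> e)"
    and lim: "\<And>x. x \<in> X \<Longrightarrow> ((\<lambda>j. g j x) \<longlongrightarrow> h x) U"
    and W: "eventually (\<lambda>j. w \<le> (\<integral>x. g j x \<partial>M j)) U"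
  shows "w \<le> (\<integral>x. h x \<partial>N) \<and> h \<in> borel_measurable N"
proof -
  have spM: "space (M j) = X" for j
    using sets_eq_imp_space_eq[OF M(2)[of j]] by (simp add: space_restrict_space)
  have spN: "space N = X"
    using sets_eq_imp_space_eq[OF N(2)] by (simp add: space_restrict_space)
  have cont_meas: "f \<in> borel_measurable (M j)" "f \<in> borel_measurable N" if "continuous_on X f" for f :: "'a \<Rightarrow> real" and j
    using borel_measurable_continuous_on_restrict[OF that] measurable_cong_sets[OF M(2)[of j] refl]
      measurable_cong_sets[OF N(2) refl] by blast+
  have cont_int: "integrable (M j) f" "integrable N f" if "continuous_on X f" "\<And>x. x \<in> X \<Longrightarrow> f x \<in> {0..1}" for f :: "'a \<Rightarrow> real" and j
  proof -
    interpret prob_space "M j" by fact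
    show "integrable (M j) f"
      by (rule integrable_const_bound[where B = 1]) (use that cont_meas in \<open>auto simp: spM\<close>)
    interpret N: prob_space N by fact
    show "integrable N f"
      by (rule N.integrable_const_bound[where B = 1]) (use that cont_meas in \<open>auto simp: spN\<close>)
  qed
  have h01: "h x \<in> {0..1}" if "x \<in> X" for x
  proof -
    have "eventually (\<lambda>j. g j x \<in> {0..1}) U" using g01[OF that] by simp
    then show ?thesis
      using Lim_in_closed_set[OF closed_atLeastAtMost _ ultra_nontriv[OF U] lim[OF that]] by blast
  qed
  have "X \<noteq> {}" using prob_space.not_empty[OF N(1)] spN by simp
  obtain D where D: "countable D" "D \<subseteq> X" "X \<subseteq> closure D"
    using separable[of X] by blast
  have "D \<noteq> {}" using D \<open>X \<noteq> {}\<close> by auto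
  define a where "a = from_nat_into D"
  have a: "range a = D" unfolding a_def by (rule range_from_nat_into) fact+
  have aX: "a p \<in> X" for p using a D(2) by blast
  define J where "J n = {j. \<forall>p\<le>n. g j (a p) \<le> h (a p) + 1 / Suc n}" for n
  have J: "eventually (\<lambda>j. j \<in> J n) U" for n
  proof -
    have "eventually (\<lambda>j. \<forall>p\<in>{..n}. g j (a p) \<le> h (a p) + 1 / Suc n) U"
    proof (intro eventually_ball_finite ballI)
      fix p
      show "eventually (\<lambda>j. g j (a p) \<le> h (a p) + 1 / Suc n) U"
        using order_tendstoD(2)[OF lim[OF aX[of p]], of "h (a p) + 1 / Suc n"]
        by (auto elim: eventually_mono)
    qed simp
    then show ?thesis by (auto simp: J_def elim: eventually_mono)
  qed
  have Jne: "J n \<noteq> {}" for n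
    using J[of n] ultra_nontriv[OF U] eventually_False by fastforce
  define s where "s n x = (SUP j\<in>J n. g j x)" for n x
  have bdd: "bdd_above ((\<lambda>j. g j x) ` J n)" if "x \<in> X" for x n
    using g01[OF that] by (intro bdd_aboveI[of _ 1]) auto
  have s_ge: "g j x \<le> s n x" if "x \<in> X" "j \<in> J n" for j x n
    unfolding s_def using bdd[OF that(1)] that(2) by (intro cSUP_upper)
  have s_le: "s n x \<le> b" if "\<And>j. j \<in> J n \<Longrightarrow> g j x \<le> b" for n x b
    unfolding s_def using Jne that by (intro cSUP_least)
  have s01: "s n x \<in> {0..1}" if "x \<in> X" for n x
  proof -
    obtain j where "j \<in> J n" using Jne by blast
    then have "0 \<le> s n x" using s_ge[OF that, of j n] g01[OF that, of j] by auto
    moreover have "s n x \<le> 1" by (rule s_le) (use g01[OF that] in auto)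
    ultimately show ?thesis by simp
  qed
  have s_cont: "continuous_on X (s n)" for n
    unfolding continuous_on_iff
  proof (intro ballI allI impI)
    fix x :: 'a and e :: real assume xe: "x \<in> X" "0 < e"
    then obtain d where d: "d > 0" "\<And>y j. y \<in> X \<Longrightarrow> dist x y < d \<Longrightarrow> \<bar>g j x - g j y\<bar> \<le> e / 2"
      using equi[of x "e / 2"] by auto
    have "dist (s n y) (s n x) < e" if y: "y \<in> X" "dist y x < d" for y
    proof -
      have gd: "\<bar>g j x - g j y\<bar> \<le> e / 2" for j using d(2)[OF y(1)] y(2) by (simp add: dist_commute)
      have "s n x \<le> s n y + e / 2"
        by (rule s_le) (use gd s_ge[OF y(1)] in \<open>smt (verit)\<close>)
      moreover have "s n y \<le> s n x + e / 2"
        by (rule s_le) (use gd s_ge[OF xe(1)] in \<open>smt (verit)\<close>)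
      ultimately show ?thesis using xe(2) by (simp add: dist_real_def abs_if)
    qed
    then show "\<exists>d>0. \<forall>x'\<in>X. dist x' x < d \<longrightarrow> dist (s n x') (s n x) < e" using d(1) by blast
  qed
  have g_cont: "continuous_on X (g j)" for j
    unfolding continuous_on_iff
  proof (intro ballI allI impI)
    fix x :: 'a and e :: real assume xe: "x \<in> X" "0 < e"
    then obtain d where d: "d > 0" "\<And>y j. y \<in> X \<Longrightarrow> dist x y < d \<Longrightarrow> \<bar>g j x - g j y\<bar> \<le> e / 2"
      using equi[of x "e / 2"] by auto
    have "dist (g j y) (g j x) < e" if y: "y \<in> X" "dist y x < d" for y
      using d(2)[of y j] y xe(2) by (simp add: dist_commute dist_real_def abs_minus_commute)
    then show "\<exists>d>0. \<forall>x'\<in>X. dist x' x < d \<longrightarrow> dist (g j x') (g j x) < e"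
      using d(1) by blast
  qed
  have s_lim: "(\<lambda>n. s n x) \<longlonglongrightarrow> h x" if x: "x \<in> X" for x
  proof (rule LIMSEQ_I)
    fix e :: real assume e: "0 < e"
    then obtain d where d: "d > 0" "\<And>y j. y \<in> X \<Longrightarrow> dist x y < d \<Longrightarrow> \<bar>g j x - g j y\<bar> \<le> e / 4"
      using equi[OF x, of "e / 4"] by auto
    obtain y where "y \<in> D" "dist y x < d" using D(3) x d(1) by (meson closure_approachable subsetD)
    then obtain p where p: "dist x (a p) < d" using a by (auto simp: dist_commute)
    have gp: "\<bar>g j x - g j (a p)\<bar> \<le> e / 4" for j using d(2)[OF aX p] .
    have hp: "h (a p) \<le> h x + e / 4"
    proof (rule tendsto_le[OF ultra_nontriv[OF U] _ lim[OF aX]])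
      show "((\<lambda>j. g j x + e / 4) \<longlongrightarrow> h x + e / 4) U" by (intro tendsto_intros lim x)
      show "eventually (\<lambda>j. g j (a p) \<le> g j x + e / 4) U"
      proof (intro always_eventually allI)
        fix j show "g j (a p) \<le> g j x + e / 4" using gp[of j] by linarith
      qed
    qed
    obtain n1 where n1: "1 / Suc n1 < e / 4" using nat_approx_posE[of "e / 4"] e by auto
    have "norm (s n x - h x) < e" if n: "max p n1 \<le> n" for n
    proof -
      have "1 / real (Suc n) \<le> 1 / Suc n1" using n by (intro divide_left_mono) auto
      have "s n x \<le> h x + 3 * (e / 4)"
      proof (rule s_le)
        fix j assume "j \<in> J n"
        then have "g j (a p) \<le> h (a p) + 1 / Suc n" using n by (simp add: J_def)
        with \<open>1 / real (Suc n) \<le> 1 / Suc n1\<close> show "g j x \<le> h x + 3 * (e / 4)"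
          using gp[of j] hp n1 by linarith
      qed
      moreover have "h x \<le> s n x"
        by (rule tendsto_le[OF ultra_nontriv[OF U] tendsto_const lim[OF x]])
          (use J[of n] s_ge[OF x] in \<open>auto elim: eventually_mono\<close>)
      ultimately show ?thesis using e by simp
    qed
    then show "\<exists>no. \<forall>n\<ge>no. norm (s n x - h x) < e" by blast
  qed
  have h_meas: "h \<in> borel_measurable N"
    by (rule borel_measurable_LIMSEQ_real[of N s]) (use s_lim cont_meas(2)[OF s_cont] in \<open>auto simp: spN\<close>)
  have "w \<le> (\<integral>x. s n x \<partial>N)" for n
  proof (rule tendsto_le[OF ultra_nontriv[OF U] weak[OF s_cont] tendsto_const])
    show "bounded (s n ` X)" using s01 by (intro boundedI[of _ 1]) auto
    show "eventually (\<lambda>j. w \<le> (\<integral>x. s n x \<partial>M j)) U"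
      using W J[of n]
    proof eventually_elim
      case (elim j)
      have "(\<integral>x. g j x \<partial>M j) \<le> (\<integral>x. s n x \<partial>M j)"
        using s_ge elim(2) g01 s01 by (intro integral_mono cont_int s_cont g_cont) (auto simp: spM)
      then show ?case using elim(1) by simp
    qed
  qed
  moreover have "(\<lambda>n. \<integral>x. s n x \<partial>N) \<longlonglongrightarrow> (\<integral>x. h x \<partial>N)"
  proof (rule integral_dominated_convergence[where w = "\<lambda>_. 1"])
    show "integrable N (\<lambda>_. 1 :: real)"
      using prob_space.finite_measure[OF N(1)] finite_measure.integrable_const by blast
  qed (use h_meas cont_meas(2)[OF s_cont] s_lim s01 in \<open>auto simp: spN\<close>)
  ultimately have "w \<le> (\<integral>x. h x \<partial>N)" by (intro LIMSEQ_le_const) auto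
  then show ?thesis using h_meas by simp
qed

lemma weak_topology_tendsto:
  assumes conv: "\<And>V. openin (weak_topology X) V \<Longrightarrow> l \<in> V \<Longrightarrow> eventually (\<lambda>j. f j \<in> V) F"
    and l: "l \<in> borel_prob_measures X"
    and g: "continuous_map X euclideanreal g" "bounded (g ` topspace X)"
  shows "((\<lambda>j. \<integral>x. g x \<partial>f j) \<longlongrightarrow> (\<integral>x. g x \<partial>l)) F"
  unfolding tendsto_def
proof (intro allI impI)
  fix V :: "real set" assume V: "open V" "(\<integral>x. g x \<partial>l) \<in> V"
  let ?B = "{\<mu> \<in> borel_prob_measures X. (\<integral>x. g x \<partial>\<mu>) \<in> V}"
  have "openin (weak_topology X) ?B"
    unfolding weak_topology_def using g V(1)
    by (intro topology_generated_by_Basis) blast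
  then have "eventually (\<lambda>j. f j \<in> ?B) F"
    using conv V(2) l by blast
  then show "eventually (\<lambda>j. (\<integral>x. g x \<partial>f j) \<in> V) F"
    by (auto elim: eventually_mono)
qed

lemma orthonormal_frame:
  fixes S :: "(real^'n) set"
  assumes "subspace S" "dim S = k"
  shows "\<exists>b. (\<forall>i<k. norm (b i) = 1) \<and> (\<forall>i<k. \<forall>j<k. i \<noteq> j \<longrightarrow> b i \<bullet> b j = 0) \<and> S = span (b ` {..<k})"
proof -
  obtain B where B: "pairwise orthogonal B" "\<And>x. x \<in> B \<Longrightarrow> norm x = 1" "independent B" "card B = dim S" "span B = S"
    using orthonormal_basis_subspace[OF assms(1)] by metis
  have "finite B" using B(3) by (rule independent_imp_finite)
  then obtain b where b: "bij_betw b {..<k} B"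
    using B(4) assms(2) ex_bij_betw_nat_finite[of B] by (auto simp: atLeast0LessThan)
  show ?thesis
  proof (intro exI[of _ b] conjI allI impI)
    fix i assume "i < k" then show "norm (b i) = 1" using b B(2) by (auto simp: bij_betw_def)
  next
    fix i j assume "i < k" "j < k" "i \<noteq> j"
    then have "b i \<in> B" "b j \<in> B" "b i \<noteq> b j" using b by (auto simp: bij_betw_def inj_on_def)
    then show "b i \<bullet> b j = 0" using B(1) by (simp add: pairwise_def orthogonal_def)
  next
    show "S = span (b ` {..<k})" using b B(5) by (simp add: bij_betw_def)
  qed
qed

lemma frame_expansion:
  fixes b :: "nat \<Rightarrow> real^'n"
  assumes n: "\<And>i. i < k \<Longrightarrow> norm (b i) = 1" and o: "\<And>i j. i < k \<Longrightarrow> j < k \<Longrightarrow> i \<noteq> j \<Longrightarrow> b i \<bullet> b j = 0"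
    and s: "s \<in> span (b ` {..<k})"
  shows "s = (\<Sum>i<k. (s \<bullet> b i) *\<^sub>R b i)"
  using s
proof (induction rule: span_induct_alt)
  case base
  then show ?case by simp
next
  case (step c x y)
  then obtain l where l: "l < k" "x = b l" by auto
  have "(\<Sum>i<k. (x \<bullet> b i) *\<^sub>R b i) = (\<Sum>i<k. if i = l then b i else 0)"
    using n o l by (intro sum.cong) (auto simp: dot_square_norm)
  also have "\<dots> = x" using l by simp
  finally have x: "(\<Sum>i<k. (x \<bullet> b i) *\<^sub>R b i) = x" .
  have "(\<Sum>i<k. ((c *\<^sub>R x + y) \<bullet> b i) *\<^sub>R b i)
      = c *\<^sub>R (\<Sum>i<k. (x \<bullet> b i) *\<^sub>R b i) + (\<Sum>i<k. (y \<bullet> b i) *\<^sub>R b i)"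
    by (simp add: inner_add_left scaleR_add_left sum.distrib scaleR_sum_right)
  then show ?case using x step by simp
qed

text \<open>Compactness of the Grassmannian, in the form needed for measures: choose orthonormal frames of the
  \<open>S j\<close> and let them converge.\<close>

lemma ultra_subspace_limit:
  fixes S :: "nat \<Rightarrow> (real^'n) set"
  assumes U: "ultra U" and S: "\<And>j. subspace (S j)" "\<And>j. dim (S j) = k"
  shows "\<exists>L. subspace L \<and> dim L = k \<and>
    (\<forall>r>0. eventually (\<lambda>j. near (1 / Suc j) (S j) \<subseteq> near r L) U)"
proof -
  have "\<forall>j. \<exists>b. (\<forall>i<k. norm (b i) = 1) \<and> (\<forall>i<k. \<forall>l<k. i \<noteq> l \<longrightarrow> b i \<bullet> b l = 0) \<and> S j = span (b ` {..<k})"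
    using orthonormal_frame[OF S] by blast
  then obtain b where b: "\<And>j i. i < k \<Longrightarrow> norm (b j i) = 1"
      "\<And>j i l. i < k \<Longrightarrow> l < k \<Longrightarrow> i \<noteq> l \<Longrightarrow> b j i \<bullet> b j l = 0" "\<And>j. S j = span (b j ` {..<k})"
    by metis
  have "\<exists>c. ((\<lambda>j. b j i) \<longlongrightarrow> c) U" if "i < k" for i
    using ultra_compact[OF U compact_sphere[of 0 1], of "\<lambda>j. b j i"] b(1)[OF that] by auto
  then obtain c where c: "\<And>i. i < k \<Longrightarrow> ((\<lambda>j. b j i) \<longlongrightarrow> c i) U" by metis
  have cn: "norm (c i) = 1" if "i < k" for i
    using tendsto_unique[OF ultra_nontriv[OF U] tendsto_norm[OF c[OF that]]] b(1)[OF that] by simp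
  have co: "c i \<bullet> c l = 0" if "i < k" "l < k" "i \<noteq> l" for i l
    using tendsto_unique[OF ultra_nontriv[OF U] tendsto_inner[OF c[OF that(1)] c[OF that(2)]]] b(2)[OF that] by simp
  define L where "L = span (c ` {..<k})"
  have inj: "inj_on c {..<k}"
    using co cn by (intro inj_onI) (metis lessThan_iff norm_eq_1 zero_neq_one)
  have "pairwise orthogonal (c ` {..<k})"
    using co by (auto simp: pairwise_def orthogonal_def)
  moreover have "0 \<notin> c ` {..<k}" using cn by fastforce
  ultimately have "independent (c ` {..<k})" by (rule pairwise_orthogonal_independent)
  then have dimL: "dim L = k"
    unfolding L_def using inj by (simp add: dim_eq_card_independent card_image)
  have subL: "subspace L" unfolding L_def by (rule subspace_span)
  have "eventually (\<lambda>j. near (1 / Suc j) (S j) \<subseteq> near r L) U" if r: "0 < r" for r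
  proof -
    obtain n0 where n0: "1 / Suc n0 < min 1 (r / 2)"
      using nat_approx_posE[of "min 1 (r / 2)"] r by auto
    have "((\<lambda>j. \<Sum>i<k. norm (b j i - c i)) \<longlongrightarrow> (\<Sum>i<k. norm (c i - c i))) U"
      by (intro tendsto_intros c) auto
    then have "eventually (\<lambda>j. (\<Sum>i<k. norm (b j i - c i)) < r / 4) U"
      using r by (intro order_tendstoD(2)) auto
    moreover have "eventually (\<lambda>j. n0 \<le> j) U" by (rule ultra_eventually_ge[OF U])
    ultimately show ?thesis
    proof eventually_elim
      case (elim j)
      have "1 / real (Suc j) \<le> 1 / Suc n0" using elim(2) by (intro divide_left_mono) auto
      then have j: "1 / real (Suc j) \<le> 1" "1 / real (Suc j) \<le> r / 2" using n0 by auto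
      show ?case
      proof
        fix x assume "x \<in> near (1 / Suc j) (S j)"
        then obtain s where s: "s \<in> S j" "norm (x - s) \<le> 1 / Suc j * norm x"
          using mem_near_iff[OF S(1)] by blast
        have xs: "norm (x - s) \<le> r / 2 * norm x" "norm (x - s) \<le> 1 * norm x"
          using s(2) j by (meson mult_right_mono norm_ge_zero order_trans)+
        have ns: "norm s \<le> 2 * norm x" using xs(2) norm_triangle_ineq4[of x "x - s"] by simp
        define s' where "s' = (\<Sum>i<k. (s \<bullet> b j i) *\<^sub>R c i)"
        have "s' \<in> L" unfolding s'_def L_def by (intro span_sum span_scale span_base) auto
        moreover have "norm (s - s') \<le> r / 2 * norm x"
        proof -
          have "s = (\<Sum>i<k. (s \<bullet> b j i) *\<^sub>R b j i)"
            using frame_expansion[of k "b j" s] b s(1) by blast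
          then have "s - s' = (\<Sum>i<k. (s \<bullet> b j i) *\<^sub>R (b j i - c i))"
            by (simp add: s'_def sum_subtractf scaleR_diff_right)
          also have "norm \<dots> \<le> (\<Sum>i<k. norm s * norm (b j i - c i))"
          proof (intro sum_norm_le)
            fix i assume "i \<in> {..<k}"
            then have "\<bar>s \<bullet> b j i\<bar> \<le> norm s" using Cauchy_Schwarz_ineq2[of s "b j i"] b(1) by simp
            then show "norm ((s \<bullet> b j i) *\<^sub>R (b j i - c i)) \<le> norm s * norm (b j i - c i)"
              by (simp add: mult_right_mono)
          qed
          also have "\<dots> = norm s * (\<Sum>i<k. norm (b j i - c i))" by (simp add: sum_distrib_left)
          also have "\<dots> \<le> (2 * norm x) * (r / 4)"
            using ns elim(1) by (intro mult_mono sum_nonneg) auto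
          finally show ?thesis by (simp add: mult.commute)
        qed
        moreover have "norm (x - s') \<le> norm (x - s) + norm (s - s')"
          using norm_triangle_ineq[of "x - s" "s - s'"] by simp
        ultimately show "x \<in> near r L"
          unfolding mem_near_iff[OF subL] using xs(1) by (intro bexI[of _ s']) (auto simp: field_simps)
      qed
    qed
  qed
  then show ?thesis using subL dimL by blast
qed

section \<open>Laws of random matrix products\<close>

text \<open>The \<open>\<sigma>\<close>-algebra is left open up to measurability of the inclusion, so that this covers both measures
  living on the special linear group and laws of products, which are measures on all matrices.\<close>

definition sl_prob :: "(real^'n^'n) measure \<Rightarrow> bool" where
  "sl_prob M \<longleftrightarrow> prob_space M \<and> (\<lambda>A. A) \<in> borel_measurable M \<and> (AE A in M. det A = 1)"

text \<open>Laws of random nonzero vectors, which stand for laws of random directions.\<close>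

definition nz_prob :: "(real^'n) measure \<Rightarrow> bool" where
  "nz_prob N \<longleftrightarrow> prob_space N \<and> sets N = sets borel \<and> (AE x in N. x \<noteq> 0)"

lemma sl_prob_det: "sl_prob M \<Longrightarrow> AE A in M. det A = 1"
  by (simp add: sl_prob_def)

lemma measurable_of_sl_prob: "sl_prob M \<Longrightarrow> f \<in> borel \<rightarrow>\<^sub>M L \<Longrightarrow> f \<in> M \<rightarrow>\<^sub>M L"
  unfolding sl_prob_def using measurable_compose[of "\<lambda>A. A" M borel f L] by simp

lemma measurable_of_nz_prob: "nz_prob N \<Longrightarrow> f \<in> borel \<rightarrow>\<^sub>M L \<Longrightarrow> f \<in> N \<rightarrow>\<^sub>M L"
  unfolding nz_prob_def by (simp cong: measurable_cong_sets)

lemma borel_measurable_mult_vec [measurable]: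
  assumes [measurable]: "f \<in> borel_measurable M" "g \<in> borel_measurable M"
  shows "(\<lambda>w. (f w :: real^'n^'m) *v g w) \<in> borel_measurable M"
proof -
  have "continuous_on UNIV (\<lambda>p :: (real^'n^'m) \<times> (real^'n). fst p *v snd p)"
    unfolding matrix_vector_mult_def by (intro continuous_intros)
  then have "(\<lambda>p :: (real^'n^'m) \<times> (real^'n). fst p *v snd p) \<in> borel \<rightarrow>\<^sub>M borel"
    by (rule borel_measurable_continuous_onI)
  then have [measurable]: "(\<lambda>p :: (real^'n^'m) \<times> (real^'n). fst p *v snd p) \<in> borel \<Otimes>\<^sub>M borel \<rightarrow>\<^sub>M borel"
    by (simp add: borel_prod)
  have "(\<lambda>w. (\<lambda>p. fst p *v snd p) (f w, g w)) \<in> borel_measurable M" by measurable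
  then show ?thesis by simp
qed

lemma borel_measurable_mult_mat [measurable]:
  assumes [measurable]: "f \<in> borel_measurable M" "g \<in> borel_measurable M"
  shows "(\<lambda>w. (f w :: real^'n^'m) ** (g w :: real^'l^'n)) \<in> borel_measurable M"
proof -
  have "continuous_on UNIV (\<lambda>p :: (real^'n^'m) \<times> (real^'l^'n). fst p ** snd p)"
    unfolding matrix_matrix_mult_def by (intro continuous_intros)
  then have "(\<lambda>p :: (real^'n^'m) \<times> (real^'l^'n). fst p ** snd p) \<in> borel \<rightarrow>\<^sub>M borel"
    by (rule borel_measurable_continuous_onI)
  then have [measurable]: "(\<lambda>p :: (real^'n^'m) \<times> (real^'l^'n). fst p ** snd p) \<in> borel \<Otimes>\<^sub>M borel \<rightarrow>\<^sub>M borel"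
    by (simp add: borel_prod)
  have "(\<lambda>w. (\<lambda>p. fst p ** snd p) (f w, g w)) \<in> borel_measurable M" by measurable
  then show ?thesis by simp
qed

lemma measurable_sl_fst:
  assumes "sl_prob M"
  shows "(\<lambda>p. fst p) \<in> borel_measurable (M \<Otimes>\<^sub>M N)"
  using measurable_compose[OF measurable_fst, of "\<lambda>A. A" M borel] assms unfolding sl_prob_def by blast

lemma measurable_sl_snd:
  assumes "sl_prob N"
  shows "(\<lambda>p. snd p) \<in> borel_measurable (M \<Otimes>\<^sub>M N)"
  using measurable_compose[OF measurable_snd, of "\<lambda>A. A" N borel] assms unfolding sl_prob_def by blast

lemma measurable_nz_snd:
  assumes "nz_prob N"
  shows "(\<lambda>p. snd p) \<in> borel_measurable (M \<Otimes>\<^sub>M N)"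
  using measurable_compose[OF measurable_snd, of "\<lambda>x. x" N borel] measurable_ident_sets[of N borel] assms
  unfolding nz_prob_def by blast

lemma continuous_on_det: "continuous_on UNIV (det :: real^'n^'n \<Rightarrow> real)"
  unfolding det_def by (intro continuous_intros)

definition step :: "(real^'n^'n) measure \<Rightarrow> (real^'n) measure \<Rightarrow> (real^'n) measure" where
  "step M N = distr (M \<Otimes>\<^sub>M N) borel (\<lambda>(A, x). A *v x)"

definition conv :: "(real^'n^'n) measure \<Rightarrow> (real^'n^'n) measure \<Rightarrow> (real^'n^'n) measure" where
  "conv M N = distr (M \<Otimes>\<^sub>M N) borel (\<lambda>(A, B). A ** B)"

lemma sets_step [simp, measurable_cong]: "sets (step M N) = sets borel"
  by (simp add: step_def)

lemma sets_conv [simp, measurable_cong]: "sets (conv M N) = sets borel"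
  by (simp add: conv_def)

lemma mult_vec_nz: "det (A::real^'n^'n) = 1 \<Longrightarrow> x \<noteq> 0 \<Longrightarrow> A *v x \<noteq> 0"
  using norm_le_mult_vec[of A x] by auto

context
  fixes M :: "(real^'n^'n) measure" and N :: "(real^'n) measure"
  assumes M: "sl_prob M" and N: "nz_prob N"
begin

interpretation M: prob_space M using M by (simp add: sl_prob_def)
interpretation N: prob_space N using N by (simp add: nz_prob_def)
interpretation pair_prob_space M N ..

lemma step_measurable: "(\<lambda>(A, x). A *v x) \<in> borel_measurable (M \<Otimes>\<^sub>M N)"
  using borel_measurable_mult_vec[OF measurable_sl_fst[OF M] measurable_nz_snd[OF N]]
  by (simp add: case_prod_beta')

lemma nn_integral_step:
  assumes f: "f \<in> borel_measurable borel"
  shows "(\<integral>\<^sup>+y. f y \<partial>step M N) = (\<integral>\<^sup>+A. \<integral>\<^sup>+x. f (A *v x) \<partial>N \<partial>M)"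
proof -
  have "(\<integral>\<^sup>+y. f y \<partial>step M N) = (\<integral>\<^sup>+p. f (fst p *v snd p) \<partial>(M \<Otimes>\<^sub>M N))"
    unfolding step_def by (subst nn_integral_distr[OF step_measurable]) (simp_all add: f case_prod_beta')
  also have "\<dots> = (\<integral>\<^sup>+A. \<integral>\<^sup>+x. f (A *v x) \<partial>N \<partial>M)"
    using N.nn_integral_fst[of "\<lambda>p. f (fst p *v snd p)" M] measurable_compose[OF step_measurable f]
    by (simp add: case_prod_beta')
  finally show ?thesis .
qed

lemma nn_integral_step_swap:
  assumes f: "f \<in> borel_measurable borel"
  shows "(\<integral>\<^sup>+y. f y \<partial>step M N) = (\<integral>\<^sup>+x. \<integral>\<^sup>+A. f (A *v x) \<partial>M \<partial>N)"
  unfolding nn_integral_step[OF f]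
  using Fubini[of "\<lambda>p. f (fst p *v snd p)"] measurable_compose[OF step_measurable f]
  by (simp add: case_prod_beta')

lemma integral_step:
  fixes f :: "real^'n \<Rightarrow> real"
  assumes f: "f \<in> borel_measurable borel" and b: "\<And>x. \<bar>f x\<bar> \<le> B"
  shows "(\<integral>y. f y \<partial>step M N) = (\<integral>A. (\<integral>x. f (A *v x) \<partial>N) \<partial>M)"
proof -
  have "integrable (M \<Otimes>\<^sub>M N) (\<lambda>p. f (fst p *v snd p))"
    using measurable_compose[OF step_measurable f] b
    by (intro P.integrable_const_bound[of _ B]) (auto simp: case_prod_beta')
  from integral_fst'[OF this] show ?thesis
    unfolding step_def by (subst integral_distr[OF step_measurable]) (simp_all add: f case_prod_beta')
qed

lemma nz_prob_step: "nz_prob (step M N)"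
  unfolding nz_prob_def
proof (intro conjI)
  show "prob_space (step M N)" unfolding step_def by (intro P.prob_space_distr step_measurable)
  have "(\<integral>\<^sup>+y. indicator {0} y \<partial>step M N) = (\<integral>\<^sup>+A. \<integral>\<^sup>+x. indicator {0} (A *v x) \<partial>N \<partial>M)"
    by (rule nn_integral_step) auto
  also have "\<dots> = (\<integral>\<^sup>+A. 0 \<partial>M)"
  proof (rule nn_integral_cong_AE)
    show "AE A in M. (\<integral>\<^sup>+x. indicator {0} (A *v x) \<partial>N) = 0"
      using sl_prob_det[OF M]
    proof eventually_elim
      case (elim A)
      have "(\<integral>\<^sup>+x. indicator {0} (A *v x) \<partial>N) = (\<integral>\<^sup>+x. 0 \<partial>N)"
        using N unfolding nz_prob_def
        by (intro nn_integral_cong_AE) (auto elim!: eventually_mono simp: mult_vec_nz[OF elim] indicator_def)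
      then show ?case by simp
    qed
  qed
  finally have "emeasure (step M N) {0} = 0" by simp
  then show "AE x in step M N. x \<noteq> 0"
    by (intro AE_I[of _ _ "{0}"]) auto
qed simp

end

context
  fixes M N :: "(real^'n^'n) measure"
  assumes M: "sl_prob M" and N: "sl_prob N"
begin

interpretation M: prob_space M using M by (simp add: sl_prob_def)
interpretation N: prob_space N using N by (simp add: sl_prob_def)
interpretation pair_prob_space M N ..

lemma conv_measurable: "(\<lambda>(A, B). A ** B) \<in> borel_measurable (M \<Otimes>\<^sub>M N)"
  using borel_measurable_mult_mat[OF measurable_sl_fst[OF M] measurable_sl_snd[OF N]]
  by (simp add: case_prod_beta')

lemma nn_integral_conv:
  assumes f: "f \<in> borel_measurable borel"
  shows "(\<integral>\<^sup>+T. f T \<partial>conv M N) = (\<integral>\<^sup>+A. \<integral>\<^sup>+B. f (A ** B) \<partial>N \<partial>M)"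
proof -
  have "(\<integral>\<^sup>+y. f y \<partial>conv M N) = (\<integral>\<^sup>+p. f (fst p ** snd p) \<partial>(M \<Otimes>\<^sub>M N))"
    unfolding conv_def by (subst nn_integral_distr[OF conv_measurable]) (simp_all add: f case_prod_beta')
  also have "\<dots> = (\<integral>\<^sup>+A. \<integral>\<^sup>+x. f (A ** x) \<partial>N \<partial>M)"
    using N.nn_integral_fst[of "\<lambda>p. f (fst p ** snd p)" M] measurable_compose[OF conv_measurable f]
    by (simp add: case_prod_beta')
  finally show ?thesis .
qed

lemma sl_prob_conv: "sl_prob (conv M N)"
  unfolding sl_prob_def
proof (intro conjI)
  show "prob_space (conv M N)" unfolding conv_def by (intro P.prob_space_distr conv_measurable)
  show "(\<lambda>A. A) \<in> borel_measurable (conv M N)" by (simp add: measurable_ident_sets)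
  let ?Z = "{T :: real^'n^'n. det T \<noteq> 1}"
  have "open ?Z" using continuous_on_det by (intro open_Collect_neq) auto
  then have Z: "?Z \<in> sets borel" by simp
  have "(\<integral>\<^sup>+y. indicator ?Z y \<partial>conv M N) = (\<integral>\<^sup>+A. \<integral>\<^sup>+x. indicator ?Z (A ** x) \<partial>N \<partial>M)"
    using Z by (intro nn_integral_conv) auto
  also have "\<dots> = (\<integral>\<^sup>+A. 0 \<partial>M)"
  proof (rule nn_integral_cong_AE)
    show "AE A in M. (\<integral>\<^sup>+x. indicator ?Z (A ** x) \<partial>N) = 0"
      using sl_prob_det[OF M]
    proof eventually_elim
      case (elim A)
      have "(\<integral>\<^sup>+x. indicator ?Z (A ** x) \<partial>N) = (\<integral>\<^sup>+x. 0 \<partial>N)"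
        using N unfolding sl_prob_def
        by (intro nn_integral_cong_AE) (auto elim!: eventually_mono simp: det_mul elim indicator_def)
      then show ?case by simp
    qed
  qed
  finally have "emeasure (conv M N) ?Z = 0" using Z by simp
  then show "AE T in conv M N. det T = 1"
    using Z by (intro AE_I[of _ _ ?Z]) auto
qed

end

lemma measure_eq_borelI:
  fixes M N :: "'a::topological_space measure"
  assumes "sets M = sets borel" "sets N = sets borel"
    and "\<And>f. f \<in> borel_measurable borel \<Longrightarrow> (\<integral>\<^sup>+x. f x \<partial>M) = (\<integral>\<^sup>+x. f x \<partial>N)"
  shows "M = N"
proof (rule measure_eqI)
  fix B assume "B \<in> sets M"
  then have B: "B \<in> sets borel" using assms(1) by simp
  have "(\<integral>\<^sup>+x. indicator B x \<partial>M) = (\<integral>\<^sup>+x. indicator B x \<partial>N)"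
    by (rule assms(3)) (use B in simp)
  then show "emeasure M B = emeasure N B" using B assms(1,2) by simp
qed (use assms in simp)

lemma nn_integral_step_measurable:
  assumes N: "nz_prob N" and f: "f \<in> borel_measurable borel"
  shows "(\<lambda>A::real^'n^'n. \<integral>\<^sup>+x. f (A *v x) \<partial>N) \<in> borel_measurable borel"
proof -
  interpret prob_space N using N by (simp add: nz_prob_def)
  have [measurable_cong]: "sets N = sets borel" using N by (simp add: nz_prob_def)
  note [measurable] = f
  show ?thesis by measurable
qed

lemma nn_integral_conv_measurable:
  assumes N: "sl_prob N" and f: "f \<in> borel_measurable borel"
  shows "(\<lambda>A::real^'n^'n. \<integral>\<^sup>+B. f (A ** B) \<partial>N) \<in> borel_measurable borel"
proof -
  interpret prob_space N using N by (simp add: sl_prob_def)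
  have [measurable]: "(\<lambda>A. A) \<in> N \<rightarrow>\<^sub>M borel" using N by (simp add: sl_prob_def)
  have [measurable]: "(\<lambda>p::(real^'n^'n) \<times> (real^'n^'n). snd p) \<in> borel_measurable (borel \<Otimes>\<^sub>M N)"
    by (rule measurable_sl_snd[OF N])
  note [measurable] = f
  show ?thesis by (rule borel_measurable_nn_integral) (simp add: case_prod_beta')
qed

lemma step_conv:
  assumes M: "sl_prob M" and N: "sl_prob N" and X: "nz_prob X"
  shows "step (conv M N) X = step M (step N X)"
proof (rule measure_eq_borelI)
  fix f :: "real^'a \<Rightarrow> ennreal" assume f: "f \<in> borel_measurable borel"
  have f': "(\<lambda>x. f (A *v x)) \<in> borel_measurable borel" for A :: "real^'a^'a"
    using f by measurable
  show "(\<integral>\<^sup>+x. f x \<partial>step (conv M N) X) = (\<integral>\<^sup>+x. f x \<partial>step M (step N X))"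
    by (simp add: nn_integral_step[OF sl_prob_conv[OF M N] X f] nn_integral_step[OF M nz_prob_step[OF N X] f]
        nn_integral_conv[OF M N nn_integral_step_measurable[OF X f]] nn_integral_step[OF N X f']
        matrix_vector_mul_assoc)
qed auto

lemma conv_assoc:
  assumes M: "sl_prob M" and N: "sl_prob N" and X: "sl_prob X"
  shows "conv (conv M N) X = conv M (conv N X)"
proof (rule measure_eq_borelI)
  fix f :: "real^'a^'a \<Rightarrow> ennreal" assume f: "f \<in> borel_measurable borel"
  have f': "(\<lambda>x. f (A ** x)) \<in> borel_measurable borel" for A :: "real^'a^'a"
    using f by measurable
  show "(\<integral>\<^sup>+x. f x \<partial>conv (conv M N) X) = (\<integral>\<^sup>+x. f x \<partial>conv M (conv N X))"
    by (simp add: nn_integral_conv[OF sl_prob_conv[OF M N] X f] nn_integral_conv[OF M sl_prob_conv[OF N X] f]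
        nn_integral_conv[OF M N nn_integral_conv_measurable[OF X f]] nn_integral_conv[OF N X f']
        matrix_mul_assoc)
qed auto

text \<open>The head of the list is the factor that acts last. With this convention dropping an initial part
  of the list goes back in time.\<close>

definition law :: "(real^'n^'n) measure list \<Rightarrow> (real^'n^'n) measure" where
  "law xs = foldr conv xs (return borel (mat 1))"

definition vlaw :: "(real^'n^'n) measure list \<Rightarrow> (real^'n) measure \<Rightarrow> (real^'n) measure" where
  "vlaw xs N = foldr step xs N"

lemma sl_prob_return: "sl_prob (return borel (mat 1 :: real^'n^'n))"
proof -
  have "closed {T :: real^'n^'n. det T = 1}"
    using continuous_on_det by (intro closed_Collect_eq) auto
  then have "{T :: real^'n^'n. det T = 1} \<in> sets borel" by simp
  then show ?thesis
    by (auto simp: sl_prob_def AE_return prob_space_return measurable_ident_sets pred_def)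
qed

lemma law_simps [simp]: "law [] = return borel (mat 1)" "law (M # xs) = conv M (law xs)"
  by (simp_all add: law_def)

lemma vlaw_simps [simp]: "vlaw [] N = N" "vlaw (M # xs) N = step M (vlaw xs N)"
  by (simp_all add: vlaw_def)

lemma vlaw_append: "vlaw (xs @ ys) N = vlaw xs (vlaw ys N)"
  by (simp add: vlaw_def)

lemma sl_prob_law: "(\<And>M. M \<in> set xs \<Longrightarrow> sl_prob M) \<Longrightarrow> sl_prob (law xs)"
  by (induction xs) (auto intro: sl_prob_conv sl_prob_return)

lemma sets_law [simp, measurable_cong]: "sets (law xs) = sets borel"
  by (cases xs) auto

lemma nz_prob_vlaw: "(\<And>M. M \<in> set xs \<Longrightarrow> sl_prob M) \<Longrightarrow> nz_prob N \<Longrightarrow> nz_prob (vlaw xs N)"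
  by (induction xs) (auto intro: nz_prob_step)

lemma step_law: "(\<And>M. M \<in> set xs \<Longrightarrow> sl_prob M) \<Longrightarrow> nz_prob N \<Longrightarrow> step (law xs) N = vlaw xs N"
proof (induction xs)
  case Nil
  have "(\<integral>\<^sup>+x. f x \<partial>step (return borel (mat 1)) N) = (\<integral>\<^sup>+x. f x \<partial>N)" if "f \<in> borel_measurable borel" for f
    by (simp add: nn_integral_step[OF sl_prob_return Nil(2) that]
        nn_integral_return[OF _ nn_integral_step_measurable[OF Nil(2) that]])
  then show ?case using Nil(2) by (intro measure_eq_borelI) (auto simp: nz_prob_def)
qed (simp add: step_conv sl_prob_law)

lemma law_append:
  "(\<And>M. M \<in> set xs \<union> set ys \<Longrightarrow> sl_prob M) \<Longrightarrow> law (xs @ ys) = conv (law xs) (law ys)"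
proof (induction xs)
  case Nil
  then have ys: "sl_prob (law ys)" by (simp add: sl_prob_law)
  have "(\<integral>\<^sup>+x. f x \<partial>conv (return borel (mat 1)) (law ys)) = (\<integral>\<^sup>+x. f x \<partial>law ys)" if "f \<in> borel_measurable borel" for f
    by (simp add: nn_integral_conv[OF sl_prob_return ys that]
        nn_integral_return[OF _ nn_integral_conv_measurable[OF ys that]])
  then show ?case by (intro measure_eq_borelI) auto
qed (simp add: conv_assoc sl_prob_law)

lemma nz_prob_return: "v \<noteq> 0 \<Longrightarrow> nz_prob (return borel v)"
  by (auto simp: nz_prob_def AE_return prob_space_return pred_def)

section \<open>Long products leave every proper subspace\<close>

definition sl_borel :: "(real^'n^'n) measure \<Rightarrow> bool" where
  "sl_borel M \<longleftrightarrow> prob_space M \<and> sets M = sets (restrict_space borel special_linear)"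

lemma space_sl_borel: "sl_borel M \<Longrightarrow> space M = special_linear"
  using sets_eq_imp_space_eq[of M "restrict_space borel special_linear"]
  by (simp add: sl_borel_def space_restrict_space)

lemma sl_borel_sl_prob:
  assumes "sl_borel M"
  shows "sl_prob M"
  unfolding sl_prob_def
proof (intro conjI)
  show "prob_space M" using assms by (simp add: sl_borel_def)
  have "(\<lambda>A. A) \<in> restrict_space borel special_linear \<rightarrow>\<^sub>M borel"
    by (intro measurable_restrict_space1) simp
  then show "(\<lambda>A. A) \<in> borel_measurable M"
    using assms measurable_cong_sets[of M "restrict_space borel special_linear" borel borel]
    by (auto simp: sl_borel_def)
  show "AE A in M. det A = 1"
    by (intro AE_I2) (simp add: space_sl_borel[OF assms] special_linear_def)
qed

lemma surj_sl: "A \<in> special_linear \<Longrightarrow> surj ((*v) (A::real^'n^'n))"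
  using invertible_det_nz[of A] matrix_right_invertible_surjective[of A]
  by (auto simp: special_linear_def invertible_def)

lemma dim_preimage_sl:
  fixes A :: "real^'n^'n"
  assumes A: "A \<in> special_linear"
  shows "dim ((*v) A -` S) = dim S"
proof -
  have "inj ((*v) A)"
  proof (rule injI)
    fix x y :: "real^'n" assume "A *v x = A *v y"
    then have "A *v (x - y) = 0" by (simp add: matrix_vector_mult_diff_distrib)
    then show "x = y" using mult_vec_nz[of A "x - y"] A by (auto simp: special_linear_def)
  qed
  then have "dim ((*v) A ` ((*v) A -` S)) = dim ((*v) A -` S)"
    by (intro dim_image_eq matrix_vector_mul_linear) (auto intro: inj_on_subset)
  then show ?thesis using surj_sl[OF A] by (simp add: surj_image_vimage_eq)
qed

lemma ex_inverse_bound: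
  fixes A :: "real^'n^'n"
  assumes "det A = 1"
  shows "\<exists>c>0. \<forall>x. norm x \<le> c * norm (A *v x)"
  using norm_le_mult_vec[OF assms] inv_const_ge_1[where 'n='n] mnorm_ge_1[OF assms]
  by (intro exI[of _ "inv_const TYPE('n) * mnorm A ^ CARD('n)"] conjI mult_pos_pos zero_less_power) auto

text \<open>The eventual inequalities for neighbourhoods of \<open>S\<close> stand in for the statement that a limit of the
  measures \<open>N j\<close> along \<open>U\<close> gives \<open>S\<close> mass at least \<open>W\<close>.\<close>

definition heavy :: "nat filter \<Rightarrow> real \<Rightarrow> (nat \<Rightarrow> (real^'n) measure) \<Rightarrow> (real^'n) set \<Rightarrow> bool" where
  "heavy U W N S \<longleftrightarrow> (\<forall>r>0. \<forall>e>0. eventually (\<lambda>j. W - e \<le> measure (N j) (near r S)) U)"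

text \<open>The mass of \<open>S\<close> after the step is the average of the masses of \<open>(*v) A -` S\<close> before the step. The
  average is at least \<open>W\<close> and by \<open>light\<close> no term exceeds \<open>W\<close>, so almost all terms equal \<open>W\<close>. Since the
  masses are limits, the averaging has to pass through the cut-offs \<open>prox\<close> at scales \<open>r p\<close> tending
  to 0, with the limit over \<open>j\<close> taken first at each scale.\<close>

lemma heavy_preimage:
  fixes M :: "nat \<Rightarrow> (real^'n^'n) measure" and N :: "nat \<Rightarrow> (real^'n) measure"
  assumes U: "ultra U" and M: "\<And>j. sl_borel (M j)" and L: "sl_borel L" and N: "\<And>j. nz_prob (N j)"
    and weak: "\<And>f :: real^'n^'n \<Rightarrow> real. continuous_on special_linear f \<Longrightarrow> bounded (f ` special_linear) \<Longrightarrow>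
        ((\<lambda>j. \<integral>x. f x \<partial>M j) \<longlongrightarrow> (\<integral>x. f x \<partial>L)) U"
    and S: "subspace S" "dim S = k"
    and heavy: "heavy U W (\<lambda>j. step (M j) (N j)) S"
    and light: "\<And>S' e. subspace S' \<Longrightarrow> dim S' = k \<Longrightarrow> 0 < e \<Longrightarrow>
        \<exists>r>0. eventually (\<lambda>j. measure (N j) (near r S') \<le> W + e) U"
  shows "AE A in L. heavy U W N ((*v) A -` S)"
proof -
  interpret N: prob_space "N j" for j using N by (simp add: nz_prob_def)
  interpret L: prob_space L using L by (simp add: sl_borel_def)
  have abs_prox_le: "\<bar>prox q S x\<bar> \<le> 1" for q x
    using prox_bounds[of q S x] by simp
  have setsN [measurable_cong]: "sets (N j) = sets borel" for j using N by (simp add: nz_prob_def)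
  define r :: "nat \<Rightarrow> real" where "r p = 1 / Suc p" for p
  have r0: "0 < r p" for p by (simp add: r_def)
  define g where "g p j A = (\<integral>x. prox (r p) S (A *v x) \<partial>N j)" for p j and A :: "real^'n^'n"
  have pint: "integrable (N j) (\<lambda>x. prox q S (A *v x))" for q j and A :: "real^'n^'n"
    by (intro N.integrable_const_bound[of _ 1]) (auto simp: abs_prox_le)
  have g01: "g p j A \<in> {0..1}" for p j A
  proof -
    have "g p j A \<le> (\<integral>x. 1 \<partial>N j)"
      unfolding g_def by (intro integral_mono pint) (auto simp: prox_bounds)
    then show ?thesis
      unfolding g_def by (auto simp: prox_bounds N.prob_space)
  qed
  have dec: "g (Suc p) j A \<le> g p j A" for p j A
    unfolding g_def
  proof (intro integral_mono pint)
    fix x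
    have "infdist (A *v x) S / (r p * norm (A *v x)) \<le> infdist (A *v x) S / (r (Suc p) * norm (A *v x))"
    proof (cases "A *v x = 0")
      case False
      then show ?thesis
        by (intro divide_left_mono mult_right_mono mult_pos_pos infdist_nonneg)
           (auto simp: r_def frac_le)
    qed simp
    then show "prox (r (Suc p)) S (A *v x) \<le> prox (r p) S (A *v x)"
      unfolding prox_def by (auto simp: max_def min_def)
  qed
  define h where "h p A = ulim U (\<lambda>j. g p j A)" for p A
  have hlim: "((\<lambda>j. g p j A) \<longlongrightarrow> h p A) U" for p A
    unfolding h_def by (rule tendsto_ulim[OF U]) (rule g01)
  have h01: "h p A \<in> {0..1}" for p A
  proof -
    have "eventually (\<lambda>j. g p j A \<in> {0..1}) U" using g01 by simp
    then show ?thesis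
      using Lim_in_closed_set[OF closed_atLeastAtMost _ ultra_nontriv[OF U] hlim] by blast
  qed
  have hdec: "decseq (\<lambda>p. h p A)" for A
    by (intro decseq_SucI tendsto_le[OF ultra_nontriv[OF U] hlim hlim]) (simp add: dec)
  have equi: "\<exists>d>0. \<forall>B\<in>special_linear. dist A B < d \<longrightarrow> (\<forall>j. \<bar>g p j A - g p j B\<bar> \<le> e)"
    if A: "A \<in> special_linear" and e: "0 < e" for A :: "real^'n^'n" and e p
  proof -
    have detA: "det A = 1" using A by (simp add: special_linear_def)
    obtain c where c: "0 < c" and cA: "\<And>x. norm x \<le> c * norm (A *v x)"
      using ex_inverse_bound[OF detA] by blast
    define d where "d = e / (2 / r p * (c * (real CARD('n))\<^sup>2))"
    have den: "0 < 2 / r p * (c * (real CARD('n))\<^sup>2)" using r0 c by simp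
    have "\<bar>g p j A - g p j B\<bar> \<le> e" if B: "B \<in> special_linear" "dist A B < d" for B j
    proof -
      have detB: "det B = 1" using B by (simp add: special_linear_def)
      have pt: "\<bar>prox (r p) S (A *v x) - prox (r p) S (B *v x)\<bar> \<le> e" for x
      proof (cases "x = 0")
        case False
        have nz: "A *v x \<noteq> 0" "B *v x \<noteq> 0" using mult_vec_nz detA detB False by auto
        have "norm (A *v x - B *v x) \<le> mnorm (A - B) * norm x"
          using norm_mult_vec_le[of "A - B" x] by (simp add: matrix_vector_mult_diff_rdistrib)
        also have "\<dots> \<le> ((real CARD('n))\<^sup>2 * d) * (c * norm (A *v x))"
        proof (intro mult_mono cA)
          have "norm (A - B) < d" using B(2) by (simp add: dist_norm)
          then show "mnorm (A - B) \<le> (real CARD('n))\<^sup>2 * d"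
            using mnorm_le_norm[of "A - B"] by (auto elim!: order_trans intro: mult_left_mono)
          have "0 \<le> d"
            using \<open>norm (A - B) < d\<close> norm_ge_zero[of "A - B"] by linarith
          then show "0 \<le> (real CARD('n))\<^sup>2 * d" by simp
        qed auto
        finally have "norm (A *v x - B *v x) / norm (A *v x) \<le> (real CARD('n))\<^sup>2 * d * c"
          using nz by (simp add: field_simps)
        then have "2 / r p * (norm (A *v x - B *v x) / norm (A *v x)) \<le> 2 / r p * ((real CARD('n))\<^sup>2 * d * c)"
          using r0[of p] by (intro mult_left_mono) auto
        also have "\<dots> = e" using r0[of p] c by (simp add: d_def field_simps)
        finally show ?thesis using prox_lipschitz[OF S(1) r0 nz] by (meson order_trans)
      qed (use e in simp)
      have "g p j A - g p j B = (\<integral>x. prox (r p) S (A *v x) - prox (r p) S (B *v x) \<partial>N j)"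
        unfolding g_def using pint by simp
      also have "\<bar>\<dots>\<bar> \<le> (\<integral>x. e \<partial>N j)"
        by (rule integral_abs_bound[THEN order_trans], intro integral_mono) (use pt pint in auto)
      finally show ?thesis by (simp add: N.prob_space)
    qed
    moreover have "0 < d" unfolding d_def using den e by (rule divide_pos_pos[rotated])
    ultimately show ?thesis by blast
  qed
  have heavy_g: "eventually (\<lambda>j. W - e \<le> (\<integral>A. g p j A \<partial>M j)) U" if e: "0 < e" for e p
  proof -
    have "eventually (\<lambda>j. W - e \<le> measure (step (M j) (N j)) (near (r p) S)) U"
      using heavy e r0 unfolding heavy_def by blast
    then show ?thesis
    proof eventually_elim
      case (elim j)
      let ?Q = "step (M j) (N j)"
      have sl: "sl_prob (M j)" using M by (rule sl_borel_sl_prob)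
      interpret Q: prob_space ?Q using nz_prob_step[OF sl N] by (simp add: nz_prob_def)
      have "measure ?Q (near (r p) S) = (\<integral>y. indicator (near (r p) S) y \<partial>?Q)" by simp
      also have "\<dots> \<le> (\<integral>y. prox (r p) S y \<partial>?Q)"
        using indicator_near_le_prox[OF r0]
        by (intro integral_mono Q.integrable_const_bound[of _ 1]) (auto simp: abs_prox_le)
      also have "\<dots> = (\<integral>A. g p j A \<partial>M j)"
        unfolding g_def by (rule integral_step[OF sl N prox_measurable abs_prox_le])
      finally show ?case using elim by simp
    qed
  qed
  have int_h: "W - e \<le> (\<integral>A. h p A \<partial>L) \<and> h p \<in> borel_measurable L" if "0 < e" for e p
    by (rule ultra_integral_le[OF U, where X = special_linear and M = M and g = "g p"])
       (use M L weak g01 equi hlim heavy_g[OF that] in \<open>auto simp: sl_borel_def\<close>)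
  have h_meas [measurable]: "h p \<in> borel_measurable L" for p using int_h[of 1 p] by simp
  have int_h': "W \<le> (\<integral>A. h p A \<partial>L)" for p
    by (rule field_le_epsilon) (use int_h[of _ p] in \<open>simp add: algebra_simps\<close>)
  have cmp: "\<exists>p0. \<forall>p\<ge>p0. \<forall>j. g p j A \<le> measure (N j) (near q ((*v) A -` S))"
    if A: "A \<in> special_linear" and q: "0 < q" for A :: "real^'n^'n" and q
  proof -
    have detA: "det A = 1" using A by (simp add: special_linear_def)
    have m1: "1 \<le> mnorm A" by (rule mnorm_ge_1[OF detA])
    obtain c where c: "0 < c" and cA: "\<And>x. norm x \<le> c * norm (A *v x)"
      using ex_inverse_bound[OF detA] by blast
    obtain p0 where p0: "1 / Suc p0 < q / (2 * mnorm A * c)"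
      using nat_approx_posE[of "q / (2 * mnorm A * c)"] q m1 c by auto
    have "g p j A \<le> measure (N j) (near q ((*v) A -` S))" if p: "p0 \<le> p" for p j
    proof -
      have "r p \<le> 1 / Suc p0" unfolding r_def using p by (intro divide_left_mono) auto
      then have "r p \<le> q / (2 * mnorm A * c)" using p0 by simp
      then have rq: "mnorm A * c * (2 * r p) \<le> q" using m1 c by (simp add: field_simps)
      have "prox (r p) S (A *v x) \<le> indicator (near q ((*v) A -` S)) x" if "x \<noteq> 0" for x
      proof (cases "A *v x \<in> near (2 * r p) S")
        case True
        have "x \<in> near (mnorm A * c * (2 * r p)) ((*v) A -` S)"
          by (rule near_preimage[OF S(1) _ norm_mult_vec_le cA _ surj_sl[OF A] True]) (use r0[of p] c in auto)
        then have "x \<in> near q ((*v) A -` S)" using near_mono[OF rq] by blast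
        then show ?thesis using prox_bounds by simp
      next
        case False
        then show ?thesis
          using prox_le_indicator_near[OF r0 mult_vec_nz[OF detA that], of p S] by (simp add: indicator_def)
      qed
      moreover have "AE x in N j. x \<noteq> 0" using N by (simp add: nz_prob_def)
      ultimately have "g p j A \<le> (\<integral>x. indicator (near q ((*v) A -` S)) x \<partial>N j)"
        unfolding g_def
        by (intro integral_mono_AE pint N.integrable_const_bound[of _ 1]) (auto elim: eventually_mono)
      then show ?thesis by (simp add: setsN)
    qed
    then show ?thesis by blast
  qed
  define h' where "h' A = lim (\<lambda>p. h p A)" for A
  have h'lim: "(\<lambda>p. h p A) \<longlonglongrightarrow> h' A" for A
  proof -
    have "convergent (\<lambda>p. h p A)"
      using decseq_convergent[OF hdec[of A], of 0] h01 unfolding convergent_def by (metis atLeastAtMost_iff)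
    then show ?thesis by (simp add: h'_def convergent_LIMSEQ_iff)
  qed
  have h'_le: "h' A \<le> h p A" for A p
    using decseq_ge[OF hdec h'lim] .
  have h'_W: "h' A \<le> W" if A: "A \<in> special_linear" for A
  proof (rule field_le_epsilon)
    fix e :: real assume e: "0 < e"
    obtain q where q: "0 < q" "eventually (\<lambda>j. measure (N j) (near q ((*v) A -` S)) \<le> W + e) U"
      using light[OF subspace_preimage[OF S(1), of A] _ e] dim_preimage_sl[OF A] S(2) by auto
    obtain p0 where p0: "\<And>j. g p0 j A \<le> measure (N j) (near q ((*v) A -` S))"
      using cmp[OF A q(1)] by blast
    have "h p0 A \<le> W + e"
      by (rule tendsto_le[OF ultra_nontriv[OF U] tendsto_const hlim])
         (use q(2) in eventually_elim, use p0 in \<open>auto intro: order_trans\<close>)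
    then show "h' A \<le> W + e" using h'_le[of A p0] by simp
  qed
  have h'_meas [measurable]: "h' \<in> borel_measurable L"
    by (rule borel_measurable_LIMSEQ_real[OF h'lim h_meas])
  have h'01: "h' A \<in> {0..1}" for A
    by (rule Lim_in_closed_set[OF closed_atLeastAtMost always_eventually _ h'lim]) (use h01 in auto)
  have "(\<lambda>p. \<integral>A. h p A \<partial>L) \<longlonglongrightarrow> (\<integral>A. h' A \<partial>L)"
    by (rule integral_dominated_convergence[where w = "\<lambda>_. 1"]) (use h01 h'lim in auto)
  then have "W \<le> (\<integral>A. h' A \<partial>L)"
    by (rule LIMSEQ_le_const) (use int_h' in blast)
  have inth': "integrable L h'" by (intro L.integrable_const_bound[of _ 1]) (use h'01 in auto)
  have AEle: "AE A in L. h' A \<le> W"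
    by (intro AE_I2 h'_W) (simp add: space_sl_borel[OF L])
  have "AE A in L. h' A = W"
  proof -
    have "(\<integral>A. W - h' A \<partial>L) = 0"
    proof (rule antisym)
      show "(\<integral>A. W - h' A \<partial>L) \<le> 0" using \<open>W \<le> (\<integral>A. h' A \<partial>L)\<close> inth' by (simp add: L.prob_space)
      show "0 \<le> (\<integral>A. W - h' A \<partial>L)" using AEle by (intro integral_nonneg_AE) (auto elim: eventually_mono)
    qed
    then have "AE A in L. W - h' A = 0"
      using AEle inth' by (subst (asm) integral_nonneg_eq_0_iff_AE) (auto elim: eventually_mono)
    then show ?thesis by (auto elim: eventually_mono)
  qed
  then show ?thesis
  proof (rule AE_mp, intro AE_I2 impI)
    fix A assume "A \<in> space L" and hW: "h' A = W"
    then have A: "A \<in> special_linear" by (simp add: space_sl_borel[OF L])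
    show "heavy U W N ((*v) A -` S)"
      unfolding heavy_def
    proof (intro allI impI)
      fix q e :: real assume qe: "0 < q" "0 < e"
      obtain p0 where p0: "\<And>j. g p0 j A \<le> measure (N j) (near q ((*v) A -` S))"
        using cmp[OF A qe(1)] by blast
      have "W - e < h p0 A" using h'_le[of A p0] hW qe(2) by simp
      then have "eventually (\<lambda>j. W - e < g p0 j A) U" using order_tendstoD(1)[OF hlim] by blast
      then show "eventually (\<lambda>j. W - e \<le> measure (N j) (near q ((*v) A -` S))) U"
        by eventually_elim (use p0 in \<open>meson order_less_imp_le order_trans\<close>)
    qed
  qed
qed

text \<open>Bonferroni's inequality for events with small pairwise intersections.\<close>

lemma (in prob_space) prob_Union_ge:
  assumes "finite F" and "\<And>S. S \<in> F \<Longrightarrow> B S \<in> events" and "0 \<le> e"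
    and "\<And>S T. S \<in> F \<Longrightarrow> T \<in> F \<Longrightarrow> S \<noteq> T \<Longrightarrow> prob (B S \<inter> B T) \<le> e"
  shows "(\<Sum>S\<in>F. prob (B S)) - (real (card F))\<^sup>2 * e \<le> prob (\<Union>S\<in>F. B S)"
  using assms
proof (induction F rule: finite_induct)
  case (insert T F)
  have ev: "B T \<in> events" "(\<Union>S\<in>F. B S) \<in> events" using insert by auto
  have "prob (\<Union>S\<in>insert T F. B S) = prob (B T) + prob (\<Union>S\<in>F. B S) - prob (B T \<inter> (\<Union>S\<in>F. B S))"
    using finite_measure_Union'[OF ev] finite_measure_Diff'[OF ev(2) ev(1)]
    by (simp add: Int_commute)
  moreover have "prob (B T \<inter> (\<Union>S\<in>F. B S)) \<le> real (card F) * e"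
  proof -
    have "prob (\<Union>S\<in>F. B T \<inter> B S) \<le> (\<Sum>S\<in>F. prob (B T \<inter> B S))"
      using insert by (intro finite_measure_subadditive_finite) auto
    also have "\<dots> \<le> (\<Sum>S\<in>F. e)" using insert by (intro sum_mono) (metis insertI1 insertI2)
    finally show ?thesis by simp
  qed
  moreover have "(\<Sum>S\<in>F. prob (B S)) - (real (card F))\<^sup>2 * e \<le> prob (\<Union>S\<in>F. B S)"
    using insert by auto
  moreover have "(real (card F))\<^sup>2 * e + real (card F) * e \<le> (real (card (insert T F)))\<^sup>2 * e"
    using insert by (simp add: power2_eq_square algebra_simps)
  ultimately show ?case using insert(1,2) by simp
qed simp

text \<open>Two different subspaces of dimension \<open>k\<close> meet in a subspace of smaller dimension, whose
  neighbourhoods have negligible mass; so the masses of the members of \<open>F\<close> add up.\<close>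

lemma card_heavy_le:
  fixes N :: "nat \<Rightarrow> (real^'n) measure"
  assumes U: "ultra U" and N: "\<And>j. nz_prob (N j)" and W: "0 < W"
    and F: "finite F" "\<And>S. S \<in> F \<Longrightarrow> subspace S \<and> dim S = k \<and> heavy U W N S"
    and null: "\<And>S' e. subspace S' \<Longrightarrow> dim S' < k \<Longrightarrow> 0 < e \<Longrightarrow>
        \<exists>r>0. eventually (\<lambda>j. measure (N j) (near r S') \<le> e) U"
  shows "real (card F) * W \<le> 1"
proof (rule ccontr)
  assume neg: "\<not> real (card F) * W \<le> 1"
  define n where "n = real (card F)"
  \<comment> \<open>so that \<open>n * (W - e) - n\<^sup>2 * e\<close> is still greater than 1\<close>
  define e where "e = (n * W - 1) / (2 * (n + n\<^sup>2))"
  have n0: "0 < n" using neg by (cases "card F = 0") (auto simp: n_def)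
  then have den: "0 < n + n\<^sup>2" by (simp add: add_pos_pos)
  have e: "0 < e" using neg den by (simp add: e_def n_def)
  have "\<exists>r>0. eventually (\<lambda>j. measure (N j) (near r S \<inter> near r T) \<le> e) U"
    if ST: "S \<in> F" "T \<in> F" "S \<noteq> T" for S T
  proof -
    have s: "subspace S" "subspace T" "dim S = k" "dim T = k" using F(2) ST by auto
    have "dim (S \<inter> T) < k"
    proof (rule ccontr)
      assume "\<not> dim (S \<inter> T) < k"
      then have "S \<inter> T = S" "S \<inter> T = T"
        using subspace_dim_equal[OF subspace_inter[OF s(1,2)] s(1)]
          subspace_dim_equal[OF subspace_inter[OF s(1,2)] s(2)] s(3,4) by auto
      then show False using ST by simp
    qed
    then obtain r0 where r0: "0 < r0" "eventually (\<lambda>j. measure (N j) (near r0 (S \<inter> T)) \<le> e) U"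
      using null[OF subspace_inter[OF s(1,2)] _ e] by blast
    obtain r where r: "0 < r" "near r S \<inter> near r T \<subseteq> near r0 (S \<inter> T)"
      using near_Int[OF s(1,2) r0(1)] by blast
    have "eventually (\<lambda>j. measure (N j) (near r S \<inter> near r T) \<le> e) U"
      using r0(2)
    proof eventually_elim
      case (elim j)
      interpret prob_space "N j" using N by (simp add: nz_prob_def)
      have "sets (N j) = sets borel" using N by (simp add: nz_prob_def)
      then have "measure (N j) (near r S \<inter> near r T) \<le> measure (N j) (near r0 (S \<inter> T))"
        using r(2) by (intro finite_measure_mono) auto
      then show ?case using elim by simp
    qed
    then show ?thesis using r(1) by blast
  qed
  then obtain R where R: "\<And>S T. S \<in> F \<Longrightarrow> T \<in> F \<Longrightarrow> S \<noteq> T \<Longrightarrow>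
      0 < R S T \<and> eventually (\<lambda>j. measure (N j) (near (R S T) S \<inter> near (R S T) T) \<le> e) U"
    by metis
  let ?I = "{(S, T). S \<in> F \<and> T \<in> F \<and> S \<noteq> T}"
  define overlap where "overlap p j = measure (N j) (near (R (fst p) (snd p)) (fst p) \<inter> near (R (fst p) (snd p)) (snd p))" for p j
  define r where "r = Min (insert 1 ((\<lambda>(S, T). R S T) ` ?I))"
  have fin: "finite ?I"
    by (rule finite_subset[of _ "F \<times> F"]) (use F(1) in auto)
  have r0: "0 < r" unfolding r_def using fin R by (subst Min_gr_iff) auto
  have rR: "r \<le> R S T" if "S \<in> F" "T \<in> F" "S \<noteq> T" for S T
    unfolding r_def using fin that by (intro Min_le) auto
  have ev1: "eventually (\<lambda>j. \<forall>S\<in>F. W - e \<le> measure (N j) (near r S)) U"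
    using F r0 e unfolding heavy_def by (intro eventually_ball_finite) auto
  have ev2: "eventually (\<lambda>j. \<forall>p\<in>?I.
      overlap p j \<le> e) U"
    using R fin by (intro eventually_ball_finite) (auto simp: overlap_def)
  have incompatible: "\<not> ((\<forall>S\<in>F. W - e \<le> measure (N j) (near r S)) \<and>
      (\<forall>p\<in>?I.
      overlap p j \<le> e))" for j
  proof
    assume j: "(\<forall>S\<in>F. W - e \<le> measure (N j) (near r S)) \<and>
      (\<forall>p\<in>?I.
      overlap p j \<le> e)"
    interpret prob_space "N j" using N by (simp add: nz_prob_def)
    have sN: "sets (N j) = sets borel" using N by (simp add: nz_prob_def)
    have "prob (near r S \<inter> near r T) \<le> e" if ST: "S \<in> F" "T \<in> F" "S \<noteq> T" for S T
    proof -
      have "prob (near r S \<inter> near r T) \<le> prob (near (R S T) S \<inter> near (R S T) T)"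
        using near_mono[OF rR[OF ST]] sN by (intro finite_measure_mono) auto
      also have "\<dots> \<le> e" using bspec[OF conjunct2[OF j], of "(S, T)"] ST by (simp add: overlap_def)
      finally show ?thesis .
    qed
    then have "(\<Sum>S\<in>F. prob (near r S)) - (real (card F))\<^sup>2 * e \<le> prob (\<Union>S\<in>F. near r S)"
      using e F(1) sN by (intro prob_Union_ge) auto
    moreover have "(\<Sum>S\<in>F. W - e) \<le> (\<Sum>S\<in>F. prob (near r S))"
      using j by (intro sum_mono) auto
    moreover have "prob (\<Union>S\<in>F. near r S) \<le> 1" by (rule prob_le_1)
    ultimately have "(\<Sum>S\<in>F. W - e) - (real (card F))\<^sup>2 * e \<le> 1" by linarith
    then have "n * (W - e) - n\<^sup>2 * e \<le> 1" by (simp add: n_def)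
    moreover have "(n + n\<^sup>2) * e = (n * W - 1) / 2" using den by (simp add: e_def field_simps)
    ultimately have "n * W \<le> 1 + (n * W - 1) / 2" unfolding right_diff_distrib distrib_right by linarith
    moreover have "q \<le> 1 + (q - 1) / 2 \<Longrightarrow> q \<le> 1" for q :: real by (simp add: field_simps)
    ultimately have "n * W \<le> 1" by blast
    then show False using neg unfolding n_def by contradiction
  qed
  have "eventually (\<lambda>j. False) U"
    by (rule eventually_elim2[OF ev1 ev2]) (rule notE[OF incompatible], rule conjI)
  then show False using ultra_nontriv[OF U] by simp
qed

locale sl_family =
  fixes K :: "(real^'n^'n) measure set"
  assumes sl_borel_mem: "M \<in> K \<Longrightarrow> sl_borel M"
begin

text \<open>The start \<open>N\<close> is an arbitrary law, so that a bound for products of length \<open>m\<close> persists for longer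
  products: their earlier factors only change the start.\<close>

definition dissolves :: "nat \<Rightarrow> bool" where
  "dissolves k \<longleftrightarrow> (\<forall>\<eta>>0. \<exists>m r. 0 < r \<and> (\<forall>xs N S. set xs \<subseteq> K \<longrightarrow> length xs = m \<longrightarrow> nz_prob N \<longrightarrow>
     subspace S \<longrightarrow> dim S = k \<longrightarrow> measure (vlaw xs N) (near r S) \<le> \<eta>))"

lemma sl_prob_mem: "set xs \<subseteq> K \<Longrightarrow> M \<in> set xs \<Longrightarrow> sl_prob M"
  using sl_borel_mem sl_borel_sl_prob by blast

lemma nz_prob_vlaw_mem: "set xs \<subseteq> K \<Longrightarrow> nz_prob N \<Longrightarrow> nz_prob (vlaw xs N)"
  using nz_prob_vlaw[of xs N] sl_prob_mem by blast

lemma dissolves_0: "dissolves 0"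
  unfolding dissolves_def
proof (intro allI impI)
  fix \<eta> :: real assume "0 < \<eta>"
  have "measure (vlaw xs N) (near (1/2) S) \<le> \<eta>"
    if a: "set xs \<subseteq> K" "length xs = 0" "nz_prob N" "subspace S" "dim S = 0" for xs N S
  proof -
    have "S = {0}" using subspace_0[OF a(4)] a(5) by (auto simp: dim_eq_0)
    then have "near (1/2) S = {0}" by (auto simp: near_def)
    moreover have "measure N {0} = 0"
      using a(3) AE_iff_measurable[of "{0}" N "\<lambda>x. x \<noteq> 0"] sets_eq_imp_space_eq[of N borel]
      by (auto simp: measure_def nz_prob_def)
    ultimately show ?thesis using a(2) \<open>0 < \<eta>\<close> by simp
  qed
  then show "\<exists>m r. 0 < r \<and> (\<forall>xs N S. set xs \<subseteq> K \<longrightarrow> length xs = m \<longrightarrow> nz_prob N \<longrightarrow>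
     subspace S \<longrightarrow> dim S = 0 \<longrightarrow> measure (vlaw xs N) (near r S) \<le> \<eta>)"
    by (intro exI[of _ "0::nat"] exI[of _ "1/2::real"]) simp
qed

end

text \<open>Compactness of \<open>K\<close> in the form in which it enters: weak limits along ultrafilters.\<close>

locale dissolving_family = sl_family K for K :: "(real^'n^'n) measure set" +
  assumes weak_limits: "\<And>U f. ultra U \<Longrightarrow> (\<And>j. f j \<in> K) \<Longrightarrow> \<exists>L\<in>K. \<forall>g :: real^'n^'n \<Rightarrow> real.
      continuous_on special_linear g \<longrightarrow> bounded (g ` special_linear) \<longrightarrow>
      ((\<lambda>j. \<integral>A. g A \<partial>f j) \<longlongrightarrow> (\<integral>A. g A \<partial>L)) U"
    and spaces: "spaces_condition K"
begin

text \<open>The argument by contradiction described at the beginning, for the least dimension \<open>k\<close> that does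
  not dissolve.\<close>

lemma dissolves: "k < CARD('n) \<Longrightarrow> dissolves k"
proof (induction k rule: less_induct)
  case (less k)
  show ?case
  proof (rule ccontr)
    assume neg: "\<not> dissolves k"
    then have k0: "0 < k" using dissolves_0 by (cases k) auto
    define ok where "ok c m r \<longleftrightarrow> (\<forall>xs N S. set xs \<subseteq> K \<longrightarrow> length xs = m \<longrightarrow> nz_prob N \<longrightarrow>
       subspace S \<longrightarrow> dim S = k \<longrightarrow> measure (vlaw xs N) (near r S) \<le> c)" for c :: real and m and r :: real
    \<comment> \<open>the mass bounds valid for some length and some width of the neighbourhoods\<close>
    define Q where "Q = {c. \<exists>m r. 0 < r \<and> ok c m r}"
    have "\<exists>\<eta>>0. \<not> (\<exists>m r. 0 < r \<and> ok \<eta> m r)"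
      using neg unfolding dissolves_def ok_def not_all not_imp .
    then obtain \<eta> where \<eta>: "0 < \<eta>" "\<And>m r. 0 < r \<Longrightarrow> \<not> ok \<eta> m r" by blast
    have Q\<eta>: "\<eta> \<le> c" if cQ: "c \<in> Q" for c
    proof (rule ccontr)
      assume "\<not> \<eta> \<le> c"
      then have "c \<le> \<eta>" by simp
      obtain m r where mr: "0 < r" "ok c m r" using cQ unfolding Q_def by blast
      have "ok \<eta> m r"
        unfolding ok_def
      proof (intro allI impI)
        fix xs and N :: "(real^'n) measure" and S :: "(real^'n) set"
        assume "set xs \<subseteq> K" "length xs = m" "nz_prob N" "subspace S" "dim S = k"
        then have "measure (vlaw xs N) (near r S) \<le> c" using mr(2) by (simp add: ok_def)
        then show "measure (vlaw xs N) (near r S) \<le> \<eta>" using \<open>c \<le> \<eta>\<close> by simp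
      qed
      then show False using \<eta>(2)[OF mr(1)] by contradiction
    qed
    have "ok 1 0 1"
      unfolding ok_def nz_prob_def by (simp add: prob_space.prob_le_1)
    then have "1 \<in> Q" unfolding Q_def using zero_less_one by blast
    define W where "W = Inf Q"
    have bdd: "bdd_below Q" using Q\<eta> by (intro bdd_belowI)
    have W0: "0 < W"
    proof -
      have "\<eta> \<le> W" unfolding W_def using \<open>1 \<in> Q\<close> Q\<eta> by (intro cInf_greatest) auto
      then show ?thesis using \<eta>(1) by linarith
    qed
    have small: "\<exists>c\<in>Q. c < W + e" if "0 < e" for e
      using cInf_less_iff[of Q "W + e"] bdd \<open>1 \<in> Q\<close> that unfolding W_def by auto
    have "\<exists>xs N S. set xs \<subseteq> K \<and> length xs = j \<and> nz_prob N \<and> subspace S \<and> dim S = k \<and>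
        W - 1 / Suc j < measure (vlaw xs N) (near (1 / Suc j) S)" for j
    proof -
      have "W - 1 / Suc j \<notin> Q"
      proof
        assume "W - 1 / Suc j \<in> Q"
        then have "W \<le> W - 1 / Suc j" using cInf_lower[OF _ bdd] unfolding W_def by blast
        then show False by simp
      qed
      moreover have "0 < 1 / real (Suc j)" by simp
      ultimately have "\<not> ok (W - 1 / Suc j) j (1 / Suc j)" unfolding Q_def by blast
      then show ?thesis unfolding ok_def not_all not_imp not_le by blast
    qed
    then obtain xs N S where xs: "\<And>j. set (xs j) \<subseteq> K" "\<And>j. length (xs j) = j" and N: "\<And>j. nz_prob (N j)"
      and S: "\<And>j. subspace (S j)" "\<And>j. dim (S j) = k"
      and big: "\<And>j. W - 1 / Suc j < measure (vlaw (xs j) (N j)) (near (1 / Suc j) (S j))"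
      by metis
    obtain U where U: "ultra U" using ex_ultra by blast
    have "xs 1 ! 0 \<in> K" using xs[of 1] nth_mem[of 0 "xs 1"] by auto
    \<comment> \<open>the measure of the step from time \<open>Suc i\<close> to time \<open>i\<close>; the value for \<open>i \<ge> j\<close> is an arbitrary member of \<open>K\<close>\<close>
    define M where "M i j = (if i < j then xs j ! i else xs 1 ! 0)" for i j :: nat
    have MK: "M i j \<in> K" for i j
      using xs[of j] nth_mem[of i "xs j"] \<open>xs 1 ! 0 \<in> K\<close> by (auto simp: M_def)
    \<comment> \<open>the law of the vector at time \<open>i\<close>, counted backwards from the end\<close>
    define P where "P i j = vlaw (drop i (xs j)) (N j)" for i j
    have dropK: "set (drop i (xs j)) \<subseteq> K" for i j using xs(1) set_drop_subset by fastforce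
    have P: "nz_prob (P i j)" for i j
      unfolding P_def using nz_prob_vlaw_mem[OF dropK N] .
    have Pstep: "P i j = step (M i j) (P (Suc i) j)" if "i < j" for i j
      using that xs(2)[of j] by (simp add: P_def M_def flip: Cons_nth_drop_Suc)
    \<comment> \<open>seen from its last \<open>m\<close> steps, \<open>P i j\<close> is the law of a product of length \<open>m\<close> with a random start\<close>
    have Plong: "\<exists>ys N'. set ys \<subseteq> K \<and> length ys = m \<and> nz_prob N' \<and> P i j = vlaw ys N'"
      if "i + m \<le> j" for i j m
    proof (intro exI conjI)
      let ?l = "drop i (xs j)"
      show "set (take m ?l) \<subseteq> K" using dropK set_take_subset by fast
      show "length (take m ?l) = m" using that xs(2)[of j] by simp
      show "nz_prob (vlaw (drop m ?l) (N j))"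
        using dropK set_drop_subset N by (intro nz_prob_vlaw_mem) fast+
      show "P i j = vlaw (take m ?l) (vlaw (drop m ?l) (N j))"
        unfolding P_def by (metis append_take_drop_id vlaw_append)
    qed
    have light: "\<exists>r>0. eventually (\<lambda>j. measure (P i j) (near r S') \<le> W + e) U"
      if S': "subspace S'" "dim S' = k" and e: "0 < e" for i S' e
    proof -
      obtain c m r where c: "c < W + e" "0 < r" "ok c m r" using small[OF e] by (auto simp: Q_def)
      have "eventually (\<lambda>j. measure (P i j) (near r S') \<le> W + e) U"
        using ultra_eventually_ge[OF U, of "i + m"]
      proof eventually_elim
        case (elim j)
        from Plong[OF elim] obtain ys N' where ys: "set ys \<subseteq> K" "length ys = m" "nz_prob N'" "P i j = vlaw ys N'"
          by blast
        have "measure (vlaw ys N') (near r S') \<le> c" using c(3) ys(1-3) S' unfolding ok_def by blast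
        then show ?case using c(1) ys(4) by simp
      qed
      then show ?thesis using c(2) by blast
    qed
    have null: "\<exists>r>0. eventually (\<lambda>j. measure (P i j) (near r S') \<le> e) U"
      if S': "subspace S'" "dim S' < k" and e: "0 < e" for i S' e
    proof -
      have "dissolves (dim S')" using less S' by simp
      then obtain m r where c: "0 < r" "\<forall>xs N S. set xs \<subseteq> K \<longrightarrow> length xs = m \<longrightarrow> nz_prob N \<longrightarrow>
         subspace S \<longrightarrow> dim S = dim S' \<longrightarrow> measure (vlaw xs N) (near r S) \<le> e"
        using e unfolding dissolves_def by blast
      have "eventually (\<lambda>j. measure (P i j) (near r S') \<le> e) U"
        using ultra_eventually_ge[OF U, of "i + m"]
      proof eventually_elim
        case (elim j)
        from Plong[OF elim] obtain ys N' where ys: "set ys \<subseteq> K" "length ys = m" "nz_prob N'" "P i j = vlaw ys N'"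
          by blast
        have "measure (vlaw ys N') (near r S') \<le> e" using c(2) ys(1-3) S' by blast
        then show ?case using ys(4) by simp
      qed
      then show ?thesis using c(1) by blast
    qed
    define F where "F i = {S. subspace S \<and> dim S = k \<and> heavy U W (P i) S}" for i
    have "finite (F i) \<and> card (F i) \<le> nat \<lfloor>1 / W\<rfloor>" for i
    proof (rule finite_if_finite_subsets_card_bdd)
      fix G assume G: "G \<subseteq> F i" "finite G"
      have "real (card G) * W \<le> 1"
        by (rule card_heavy_le[OF U P[of i] W0 G(2), where k = k]) (use G(1) null in \<open>auto simp: F_def\<close>)
      then show "card G \<le> nat \<lfloor>1 / W\<rfloor>" using W0 by (simp add: le_nat_floor field_simps)
    qed
    then have Ffin: "finite (F i)" and Fcard: "card (F i) \<le> nat \<lfloor>1 / W\<rfloor>" for i by auto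
    have "\<exists>L\<in>K. AE A in L. \<forall>S\<in>F i. (*v) A -` S \<in> F (Suc i)" for i
    proof -
      obtain L where L: "L \<in> K" "\<And>g :: real^'n^'n \<Rightarrow> real. continuous_on special_linear g \<Longrightarrow>
          bounded (g ` special_linear) \<Longrightarrow> ((\<lambda>j. \<integral>A. g A \<partial>M i j) \<longlongrightarrow> (\<integral>A. g A \<partial>L)) U"
        using weak_limits[OF U, of "M i"] MK by blast
      have "AE A in L. (*v) A -` S' \<in> F (Suc i)" if S': "S' \<in> F i" for S'
      proof -
        have s: "subspace S'" "dim S' = k" "heavy U W (P i) S'" using S' by (auto simp: F_def)
        have "heavy U W (\<lambda>j. step (M i j) (P (Suc i) j)) S'"
          unfolding heavy_def
        proof (intro allI impI)
          fix r e :: real assume "0 < r" "0 < e"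
          then have "eventually (\<lambda>j. W - e \<le> measure (P i j) (near r S')) U"
            using s(3) by (auto simp: heavy_def)
          then show "eventually (\<lambda>j. W - e \<le> measure (step (M i j) (P (Suc i) j)) (near r S')) U"
            using ultra_eventually_ge[OF U, of "Suc i"]
            by eventually_elim (simp add: Pstep)
        qed
        from heavy_preimage[OF U sl_borel_mem[OF MK] sl_borel_mem[OF L(1)] P L(2) s(1,2) this light]
        have "AE A in L. heavy U W (P (Suc i)) ((*v) A -` S')" by blast
        then show ?thesis
          by (rule AE_mp, intro AE_I2)
             (use s in \<open>auto simp: F_def space_sl_borel[OF sl_borel_mem[OF L(1)]] subspace_preimage dim_preimage_sl\<close>)
      qed
      then have "AE A in L. \<forall>S\<in>F i. (*v) A -` S \<in> F (Suc i)"
        by (rule AE_finite_allI[OF Ffin])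
      then show ?thesis using L(1) by blast
    qed
    then have "\<forall>i. \<exists>L. L \<in> K \<and> (AE A in L. \<forall>S\<in>F i. (*v) A -` S \<in> F (Suc i))"
      by (simp add: Bex_def)
    from choice[OF this]
    obtain L where "\<forall>i. L i \<in> K \<and> (AE A in L i. \<forall>S\<in>F i. (*v) A -` S \<in> F (Suc i))" ..
    then have L: "L i \<in> K" "AE A in L i. \<forall>S\<in>F i. (*v) A -` S \<in> F (Suc i)" for i
      by simp_all
    have inj: "inj_on (\<lambda>S. (*v) A -` S) X" if "A \<in> special_linear" for A :: "real^'n^'n" and X
    proof (rule inj_onI)
      fix S T :: "(real^'n) set" assume "(*v) A -` S = (*v) A -` T"
      then have "(*v) A ` ((*v) A -` S) = (*v) A ` ((*v) A -` T)" by simp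
      then show "S = T" by (simp only: surj_image_vimage_eq[OF surj_sl[OF that]])
    qed
    have ex: "\<exists>A\<in>special_linear. \<forall>S\<in>F i. (*v) A -` S \<in> F (Suc i)" for i
    proof (rule ccontr)
      assume n: "\<not> ?thesis"
      interpret prob_space "L i" using sl_borel_mem[OF L(1)] by (simp add: sl_borel_def)
      have "AE A in L i. False"
        by (rule AE_mp[OF L(2)], intro AE_I2) (use n in \<open>auto simp: space_sl_borel[OF sl_borel_mem[OF L(1)]]\<close>)
      then show False by simp
    qed
    have mono: "card (F i) \<le> card (F (Suc i))" for i
    proof -
      obtain A where A: "A \<in> special_linear" "\<forall>S\<in>F i. (*v) A -` S \<in> F (Suc i)" using ex by blast
      show ?thesis
        by (rule card_inj_on_le[OF inj[OF A(1)] _ Ffin]) (use A in auto)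
    qed
    have "F 0 \<noteq> {}"
    proof -
      from ultra_subspace_limit[of U S, OF U S] obtain L0 where "subspace L0 \<and> dim L0 = k \<and>
        (\<forall>r>0. eventually (\<lambda>j. near (1 / Suc j) (S j) \<subseteq> near r L0) U)" ..
      then have L0: "subspace L0" "dim L0 = k"
        "\<And>r. 0 < r \<Longrightarrow> eventually (\<lambda>j. near (1 / Suc j) (S j) \<subseteq> near r L0) U"
        by simp_all
      have "heavy U W (P 0) L0"
        unfolding heavy_def
      proof (intro allI impI)
        fix r e :: real assume re: "0 < r" "0 < e"
        obtain n0 where n0: "1 / Suc n0 < e" using nat_approx_posE[OF re(2)] by auto
        show "eventually (\<lambda>j. W - e \<le> measure (P 0 j) (near r L0)) U"
          using L0(3)[OF re(1)] ultra_eventually_ge[OF U, of n0]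
        proof eventually_elim
          case (elim j)
          interpret prob_space "P 0 j" using P by (simp add: nz_prob_def)
          have "sets (P 0 j) = sets borel" using P by (simp add: nz_prob_def)
          then have "measure (P 0 j) (near (1 / Suc j) (S j)) \<le> measure (P 0 j) (near r L0)"
            using elim(1) by (intro finite_measure_mono) auto
          moreover have "1 / real (Suc j) \<le> 1 / Suc n0" using elim(2) by (intro divide_left_mono) auto
          ultimately show ?case using big[of j] n0 by (simp add: P_def)
        qed
      qed
      then show ?thesis using L0 by (auto simp: F_def)
    qed
    then have "0 < card (F 0)" using Ffin by (simp add: card_gt_0_iff)
    then have Fpos: "0 < card (F i)" for i
    proof (induction i)
      case (Suc i)
      then show ?case using mono[of i] by linarith
    qed
    \<comment> \<open>a bounded sequence of natural numbers cannot increase strictly\<close>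
    have "\<exists>i. card (F (Suc i)) = card (F i)"
    proof (rule ccontr)
      assume "\<not> ?thesis"
      then have "card (F (Suc i)) \<noteq> card (F i)" for i by blast
      then have less: "card (F i) < card (F (Suc i))" for i
        using mono[of i] le_neq_implies_less by metis
      have "i \<le> card (F i)" for i
      proof (induction i)
        case (Suc i)
        then show ?case using less[of i] by linarith
      qed simp
      from this[of "Suc (nat \<lfloor>1 / W\<rfloor>)"] show False
        using Fcard[of "Suc (nat \<lfloor>1 / W\<rfloor>)"] by linarith
    qed
    then obtain i where i: "card (F (Suc i)) = card (F i)" by blast
    have AEU: "AE A in L i. (\<lambda>x. A *v x) ` (\<Union>(F (Suc i))) = \<Union>(F i)"
    proof (rule AE_mp[OF L(2)], intro AE_I2 impI)
      fix A assume "A \<in> space (L i)" and A2: "\<forall>S\<in>F i. (*v) A -` S \<in> F (Suc i)"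
      then have A: "A \<in> special_linear" by (simp add: space_sl_borel[OF sl_borel_mem[OF L(1)]])
      have eq: "(\<lambda>S. (*v) A -` S) ` F i = F (Suc i)"
        by (rule card_subset_eq[OF Ffin]) (use A2 i card_image[OF inj[OF A]] in auto)
      have "(*v) A ` (\<Union>(F (Suc i))) = (\<Union>S\<in>F i. (*v) A ` ((*v) A -` S))"
        unfolding eq[symmetric] by blast
      also have "\<dots> = \<Union>(F i)" using surj_sl[OF A] by (simp add: surj_image_vimage_eq)
      finally show "(\<lambda>x. A *v x) ` (\<Union>(F (Suc i))) = \<Union>(F i)" .
    qed
    have fsu: "finite_subspace_union (\<Union>(F i'))" for i'
      unfolding finite_subspace_union_def
    proof (intro exI[of _ "F i'"] conjI ballI Ffin refl)
      show "F i' \<noteq> {}" using Fpos[of i'] by auto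
    next
      fix T assume "T \<in> F i'"
      then have T: "subspace T" "dim T = k" by (auto simp: F_def)
      show "subspace T" by fact
      show "T \<noteq> {0}" using T(2) k0 by auto
      show "T \<noteq> UNIV" using T(2) less.prems by auto
    qed
    show False using spaces AEU fsu L(1)[of i] unfolding spaces_condition_def by blast
  qed
qed

end

section \<open>Exponential moments of long products\<close>

lemma norm_mult_vec_pos: "det (T::real^'n^'n) = 1 \<Longrightarrow> x \<noteq> 0 \<Longrightarrow> 0 < norm (T *v x)"
  using mult_vec_nz by simp

lemma ln_norm_mult_vec_le:
  fixes T :: "real^'n^'n"
  assumes T: "det T = 1" and x: "x \<noteq> 0"
  shows "ln (norm (T *v x)) \<le> ln (norm x) + ln (mnorm T)"
proof -
  have "ln (norm (T *v x)) \<le> ln (mnorm T * norm x)"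
    using norm_mult_vec_le[of T x] norm_mult_vec_pos[OF T x]
    by (intro ln_mono) auto
  then show ?thesis using mnorm_ge_1[OF T] x by (simp add: ln_mult_pos)
qed

text \<open>The additive constant in \<open>log_gauge\<close> below, which bounds \<open>\<bar>ln (norm (T *v u))\<bar>\<close> for matrices \<open>T\<close> of
  determinant 1 and unit vectors \<open>u\<close>. All integrability questions are settled by this bound.\<close>

definition log_inv :: "'n::finite itself \<Rightarrow> real" where
  "log_inv _ = ln (inv_const TYPE('n))"

lemma log_inv_nonneg: "0 \<le> log_inv TYPE('n::finite)"
  using inv_const_ge_1[where 'n='n] by (simp add: log_inv_def)

abbreviation log_gauge :: "real^'n^'n \<Rightarrow> real" where
  "log_gauge T \<equiv> log_inv TYPE('n) + real CARD('n) * ln (mnorm T)"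

lemma ln_norm_mult_vec_ge:
  fixes T :: "real^'n^'n"
  assumes T: "det T = 1" and x: "x \<noteq> 0"
  shows "ln (norm x) - log_gauge T \<le> ln (norm (T *v x))"
proof -
  have c: "0 < inv_const TYPE('n)" using inv_const_ge_1[where 'n='n] by linarith
  have m: "0 < mnorm T" using mnorm_ge_1[OF T] by simp
  have "ln (norm x) \<le> ln (inv_const TYPE('n) * mnorm T ^ CARD('n) * norm (T *v x))"
    using norm_le_mult_vec[OF T, of x] x norm_mult_vec_pos[OF T x] c m by (subst ln_le_cancel_iff) auto
  also have "\<dots> = log_gauge T + ln (norm (T *v x))"
    using c m norm_mult_vec_pos[OF T x] by (simp add: ln_mult_pos ln_realpow log_inv_def)
  finally show ?thesis by simp
qed

lemma abs_ln_norm_mult_vec_le: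
  fixes T :: "real^'n^'n"
  assumes T: "det T = 1" and u: "norm u = 1"
  shows "\<bar>ln (norm (T *v u))\<bar> \<le> log_gauge T"
proof -
  have "u \<noteq> 0" using u by auto
  have "0 \<le> ln (mnorm T)" using mnorm_ge_1[OF T] by simp
  moreover have "1 * ln (mnorm T) \<le> CARD('n) * ln (mnorm T)"
    using calculation by (intro mult_right_mono) (auto simp: Suc_leI)
  ultimately show ?thesis
    using ln_norm_mult_vec_le[OF T \<open>u \<noteq> 0\<close>] ln_norm_mult_vec_ge[OF T \<open>u \<noteq> 0\<close>] u log_inv_nonneg[where 'n='n]
    by simp
qed

lemma exp_le_quadratic:
  fixes y :: real
  shows "exp y \<le> 1 + y + y\<^sup>2 * exp \<bar>y\<bar>"
proof -
  have "\<exists>t. \<bar>t\<bar> \<le> \<bar>y\<bar> \<and> exp y = (\<Sum>m<2. y ^ m / fact m) + (exp t / fact 2) * y ^ 2"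
    by (rule Maclaurin_exp_le)
  then obtain t where t: "\<bar>t\<bar> \<le> \<bar>y\<bar>" "exp y = (\<Sum>m<2. y ^ m / fact m) + (exp t / fact 2) * y ^ 2" by blast
  have "exp t / fact 2 \<le> exp \<bar>y\<bar>"
  proof -
    have "exp t / fact 2 \<le> exp t" by (simp add: fact_2)
    also have "\<dots> \<le> exp \<bar>y\<bar>" using t(1) by simp
    finally show ?thesis .
  qed
  then have "(exp t / fact 2) * y ^ 2 \<le> exp \<bar>y\<bar> * y ^ 2" by (intro mult_right_mono) auto
  moreover have "(\<Sum>m<2. y ^ m / fact m) = 1 + y" by (simp add: numeral_2_eq_2)
  ultimately show ?thesis using t(2) by (simp add: mult.commute)
qed

lemma square_le_exp: "0 \<le> (z::real) \<Longrightarrow> z\<^sup>2 \<le> 2 * exp z"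
  using exp_lower_Taylor_quadratic[of z] by (simp add: field_simps)

lemma integrable_of_nn_integral_le:
  fixes f :: "'a \<Rightarrow> real"
  assumes "f \<in> borel_measurable M" "\<And>x. 0 \<le> f x" "(\<integral>\<^sup>+x. ennreal (f x) \<partial>M) \<le> ennreal b"
  shows "integrable M f"
proof (rule integrableI_bounded[OF assms(1)])
  have "(\<integral>\<^sup>+x. ennreal (norm (f x)) \<partial>M) \<le> ennreal b" using assms(2,3) by simp
  then show "(\<integral>\<^sup>+x. ennreal (norm (f x)) \<partial>M) < \<infinity>"
    by (rule order_le_less_trans) simp
qed

text \<open>Jensen's inequality for the exponential function.\<close>

lemma (in prob_space) expectation_le_of_exp_moment:
  assumes X: "integrable M X" and "(\<integral>\<^sup>+x. ennreal (exp (s * X x)) \<partial>M) \<le> ennreal (exp b)"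
  shows "s * expectation X \<le> b"
proof -
  have int: "integrable M (\<lambda>x. exp (s * X x))"
    by (rule integrable_of_nn_integral_le[OF _ _ assms(2)]) (use X in auto)
  have "expectation (\<lambda>x. exp (s * X x)) \<le> exp b"
    using assms(2) int by (subst (asm) nn_integral_eq_integral) auto
  then have "expectation (\<lambda>x. exp (s * X x)) * exp (- b) \<le> 1"
    by (simp add: exp_minus field_simps)
  moreover have "expectation (\<lambda>x. 1 + (s * X x - b)) \<le> expectation (\<lambda>x. exp (s * X x) * exp (- b))"
  proof (intro integral_mono)
    fix x show "1 + (s * X x - b) \<le> exp (s * X x) * exp (- b)"
      using exp_ge_add_one_self[of "s * X x - b"] by (simp add: exp_diff exp_minus field_simps)
  qed (use X int in auto)
  ultimately show ?thesis using X int by (simp add: prob_space)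
qed

lemma nn_integral_vlaw_return:
  fixes u :: "real^'n"
  assumes xs: "\<And>M. M \<in> set xs \<Longrightarrow> sl_prob M" and u: "u \<noteq> 0" and f: "f \<in> borel_measurable borel"
  shows "(\<integral>\<^sup>+y. f y \<partial>vlaw xs (return borel u)) = (\<integral>\<^sup>+T. f (T *v u) \<partial>law xs)"
proof -
  have "(\<integral>\<^sup>+y. f y \<partial>step (law xs) (return borel u)) = (\<integral>\<^sup>+T. \<integral>\<^sup>+x. f (T *v x) \<partial>return borel u \<partial>law xs)"
    using xs u f by (intro nn_integral_step sl_prob_law nz_prob_return)
  also have "\<dots> = (\<integral>\<^sup>+T. f (T *v u) \<partial>law xs)"
    using f by (subst nn_integral_return) auto
  finally show ?thesis using step_law[OF xs nz_prob_return[OF u]] by simp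
qed

abbreviation powr_moment :: "real \<Rightarrow> (real^'n^'n) measure list \<Rightarrow> real^'n \<Rightarrow> ennreal" where
  "powr_moment \<sigma> xs x \<equiv> \<integral>\<^sup>+T. ennreal (norm (T *v x) powr \<sigma>) \<partial>law xs"

locale moment_family = dissolving_family K for K :: "(real^'n^'n) measure set" +
  fixes \<gamma> C :: real
  assumes gamma: "0 < \<gamma>" and C1: "1 \<le> C"
    and moment: "M \<in> K \<Longrightarrow> (\<integral>\<^sup>+A. ennreal (mnorm A powr \<gamma>) \<partial>M) \<le> ennreal C"
begin

lemma card_ge_1: "1 \<le> real CARD('n)"
  by (simp add: Suc_leI)

lemma law_prob: "set xs \<subseteq> K \<Longrightarrow> prob_space (law xs)"
  using sl_prob_law[of xs] sl_prob_mem by (auto simp: sl_prob_def)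

lemma law_det: "set xs \<subseteq> K \<Longrightarrow> AE T in law xs. det T = 1"
  using sl_prob_law[of xs] sl_prob_mem by (auto simp: sl_prob_def)

lemma law_moment: "set xs \<subseteq> K \<Longrightarrow> (\<integral>\<^sup>+T. ennreal (mnorm T powr \<gamma>) \<partial>law xs) \<le> ennreal (C ^ length xs)"
proof (induction xs)
  case Nil
  have "mnorm (mat 1 :: real^'n^'n) = 1"
    by (intro antisym mnorm_ge_1 onorm_le) auto
  then show ?case by (simp add: nn_integral_return)
next
  case (Cons M xs)
  have M: "M \<in> K" "sl_prob M" and xs: "set xs \<subseteq> K" using Cons.prems sl_prob_mem[OF Cons.prems] by auto
  have lx: "sl_prob (law xs)" using sl_prob_law sl_prob_mem[OF xs] by blast
  have "(\<integral>\<^sup>+T. ennreal (mnorm T powr \<gamma>) \<partial>law (M # xs))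
      = (\<integral>\<^sup>+A. \<integral>\<^sup>+B. ennreal (mnorm (A ** B) powr \<gamma>) \<partial>law xs \<partial>M)"
    by (simp add: nn_integral_conv[OF M(2) lx])
  also have "\<dots> \<le> (\<integral>\<^sup>+A. \<integral>\<^sup>+B. ennreal (mnorm A powr \<gamma>) * ennreal (mnorm B powr \<gamma>) \<partial>law xs \<partial>M)"
  proof (intro nn_integral_mono)
    fix A B :: "real^'n^'n"
    have "mnorm (A ** B) powr \<gamma> \<le> (mnorm A * mnorm B) powr \<gamma>"
      using gamma by (intro powr_mono2 mnorm_mult_le mnorm_nonneg) auto
    then show "ennreal (mnorm (A ** B) powr \<gamma>) \<le> ennreal (mnorm A powr \<gamma>) * ennreal (mnorm B powr \<gamma>)"
      by (simp add: powr_mult mnorm_nonneg flip: ennreal_mult)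
  qed
  also have "\<dots> = (\<integral>\<^sup>+A. ennreal (mnorm A powr \<gamma>) * (\<integral>\<^sup>+B. ennreal (mnorm B powr \<gamma>) \<partial>law xs) \<partial>M)"
    by (intro nn_integral_cong nn_integral_cmult) simp
  also have "\<dots> = (\<integral>\<^sup>+A. ennreal (mnorm A powr \<gamma>) \<partial>M) * (\<integral>\<^sup>+B. ennreal (mnorm B powr \<gamma>) \<partial>law xs)"
    by (intro nn_integral_multc measurable_of_sl_prob[OF M(2)]) simp
  also have "\<dots> \<le> ennreal C * ennreal (C ^ length xs)"
    by (intro mult_mono moment Cons.IH M xs) auto
  finally show ?case using C1 by (simp add: ennreal_mult'')
qed

lemma integrable_ln_mnorm:
  assumes xs: "set xs \<subseteq> K"
  shows "integrable (law xs) (\<lambda>T. ln (mnorm T))"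
proof (rule Bochner_Integration.integrable_bound)
  show "integrable (law xs) (\<lambda>T. mnorm T powr \<gamma> / \<gamma>)"
    by (intro integrable_divide integrable_of_nn_integral_le[OF _ _ law_moment[OF xs]]) auto
  show "AE T in law xs. norm (ln (mnorm T)) \<le> norm (mnorm T powr \<gamma> / \<gamma>)"
    using law_det[OF xs]
  proof eventually_elim
    case (elim T)
    have "1 \<le> mnorm T" by (rule mnorm_ge_1[OF elim])
    moreover have "\<gamma> * ln (mnorm T) \<le> mnorm T powr \<gamma>"
      using ln_le_minus_one[of "mnorm T powr \<gamma>"] calculation by (simp add: ln_powr)
    ultimately show ?case using gamma by (simp add: field_simps)
  qed
qed simp

definition \<Lambda> :: "(real^'n^'n) measure list \<Rightarrow> real" where
  "\<Lambda> xs = (\<integral>T. ln (mnorm T) \<partial>law xs)"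

lemma Lambda_nonneg: "set xs \<subseteq> K \<Longrightarrow> 0 \<le> \<Lambda> xs"
  unfolding \<Lambda>_def
  by (rule integral_nonneg_AE, rule AE_mp[OF law_det]) (auto dest: mnorm_ge_1 intro!: AE_I2)

text \<open>An upper bound for the expected log-norm of a single factor.\<close>

definition rate :: real where "rate = ln C / \<gamma>"

lemma rate_nonneg: "0 \<le> rate"
  using C1 gamma by (simp add: rate_def)

lemma Lambda_le:
  assumes xs: "set xs \<subseteq> K"
  shows "\<Lambda> xs \<le> length xs * rate"
proof -
  interpret prob_space "law xs" by (rule law_prob[OF xs])
  have "\<gamma> * \<Lambda> xs \<le> length xs * ln C"
    unfolding \<Lambda>_def
  proof (rule expectation_le_of_exp_moment[OF integrable_ln_mnorm[OF xs]])
    have "(\<integral>\<^sup>+T. ennreal (exp (\<gamma> * ln (mnorm T))) \<partial>law xs) = (\<integral>\<^sup>+T. ennreal (mnorm T powr \<gamma>) \<partial>law xs)"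
      using law_det[OF xs]
      by (intro nn_integral_cong_AE) (auto elim!: eventually_mono dest!: mnorm_ge_1 simp: powr_def)
    also have "\<dots> \<le> ennreal (C ^ length xs)" by (rule law_moment[OF xs])
    also have "C ^ length xs = exp (length xs * ln C)" using C1 by (simp add: exp_of_nat_mult)
    finally show "(\<integral>\<^sup>+T. ennreal (exp (\<gamma> * ln (mnorm T))) \<partial>law xs) \<le> ennreal (exp (length xs * ln C))" .
  qed
  then show ?thesis using gamma by (simp add: rate_def field_simps)
qed

lemma integrable_ln_norm:
  assumes xs: "set xs \<subseteq> K" and u: "norm u = 1"
  shows "integrable (law xs) (\<lambda>T. ln (norm (T *v u)))"
proof (rule Bochner_Integration.integrable_bound)
  interpret prob_space "law xs" by (rule law_prob[OF xs])
  show "integrable (law xs) (\<lambda>T. log_gauge T)"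
    using integrable_ln_mnorm[OF xs] by auto
  show "AE T in law xs. norm (ln (norm (T *v u))) \<le> norm (log_gauge T)"
    using law_det[OF xs] by eventually_elim (use abs_ln_norm_mult_vec_le[OF _ u] in force)
qed simp

text \<open>The logarithmic form of \<open>row_functional\<close>: \<open>H\<close> is the orthogonal complement of the direction \<open>w\<close>.\<close>

lemma exists_hyperplane:
  fixes S :: "real^'n^'n"
  assumes S: "det S = 1" and r: "0 < r"
  shows "\<exists>H. subspace H \<and> dim H = CARD('n) - 1 \<and> (\<forall>x. x \<noteq> 0 \<longrightarrow> x \<notin> near r H \<longrightarrow>
     ln (mnorm S) + ln (norm x) \<le> ln (norm (S *v x)) + \<bar>ln ((real CARD('n))\<^sup>2 / r)\<bar>)"
proof -
  have m: "0 < mnorm S" using mnorm_ge_1[OF S] by simp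
  obtain w where w: "norm w = 1" "\<And>x. mnorm S * \<bar>w \<bullet> x\<bar> \<le> (real CARD('n))\<^sup>2 * norm (S *v x)"
    using row_functional[OF m] by blast
  let ?H = "{y. w \<bullet> y = 0}"
  have "dim ?H = CARD('n) - 1" using w(1) by (subst dim_hyperplane) auto
  moreover have "ln (mnorm S) + ln (norm x) \<le> ln (norm (S *v x)) + \<bar>ln ((real CARD('n))\<^sup>2 / r)\<bar>"
    if x: "x \<noteq> 0" "x \<notin> near r ?H" for x
  proof -
    have "r * norm x < \<bar>w \<bullet> x\<bar>" using near_hyperplane[OF w(1), of x r] x(2) by force
    then have "mnorm S * (r * norm x) \<le> mnorm S * \<bar>w \<bullet> x\<bar>" using m by (intro mult_left_mono) auto
    then have "mnorm S * norm x \<le> ((real CARD('n))\<^sup>2 / r) * norm (S *v x)"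
      using w(2)[of x] r by (simp add: field_simps)
    moreover have pos: "0 < norm (S *v x)" by (rule norm_mult_vec_pos[OF S x(1)])
    moreover have "0 < (real CARD('n))\<^sup>2 / r" using r by simp
    ultimately have "ln (mnorm S * norm x) \<le> ln (((real CARD('n))\<^sup>2 / r) * norm (S *v x))"
      using m x(1) by (intro ln_mono) auto
    then have "ln (mnorm S) + ln (norm x) \<le> ln ((real CARD('n))\<^sup>2 / r) + ln (norm (S *v x))"
      using ln_mult_pos[OF m, of "norm x"] ln_mult_pos[OF \<open>0 < (real CARD('n))\<^sup>2 / r\<close> pos] x(1)
      by simp
    then show ?thesis by linarith
  qed
  ultimately show ?thesis using subspace_hyperplane[of w] by blast
qed

text \<open>With \<open>S\<close> drawn from \<open>ys\<close> and \<open>T\<close> from \<open>zs\<close>, the loss \<open>ln \<parallel>S T\<parallel> - ln |S T u|\<close> is at most a term depending on \<open>T\<close>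
  alone, plus a constant, plus \<open>h S\<close> if \<open>T u\<close> is close to the hyperplane belonging to \<open>S\<close>. For each
  fixed \<open>S\<close> the last event has probability at most \<open>\<eta>\<close>, so independence gives the factor \<open>\<eta>\<close> in front of
  the only term that grows with the length of \<open>ys\<close>.\<close>

lemma block_deficit:
  assumes ys: "set ys \<subseteq> K" and zs: "set zs \<subseteq> K" and u: "norm u = 1" and r: "0 < r" and \<eta>: "0 \<le> \<eta>"
    and D: "\<And>H. subspace H \<Longrightarrow> dim H = CARD('n) - 1 \<Longrightarrow>
      measure (vlaw zs (return borel u)) (near r H) \<le> \<eta>"
  shows "\<Lambda> (ys @ zs) - (\<integral>T. ln (norm (T *v u)) \<partial>law (ys @ zs))
     \<le> log_inv TYPE('n) + (real CARD('n) + 1) * \<Lambda> zs + \<bar>ln ((real CARD('n))\<^sup>2 / r)\<bar> + \<eta> * (log_inv TYPE('n) + (real CARD('n) + 1) * \<Lambda> ys)"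
proof -
  have yz: "set (ys @ zs) \<subseteq> K" using ys zs by simp
  have u0: "u \<noteq> 0" using u by auto
  have Ly: "sl_prob (law ys)" and Lz: "sl_prob (law zs)"
    using sl_prob_law sl_prob_mem[OF ys] sl_prob_mem[OF zs] by blast+
  interpret Y: prob_space "law ys" by (rule law_prob[OF ys])
  interpret Z: prob_space "law zs" by (rule law_prob[OF zs])
  interpret YZ: prob_space "law (ys @ zs)" by (rule law_prob[OF yz])
  define deficit where "deficit T = ln (mnorm T) - ln (norm (T *v u))" for T :: "real^'n^'n"
  have deficit_meas [measurable]: "deficit \<in> borel_measurable borel" unfolding deficit_def by measurable
  have deficit_int: "integrable (law (ys @ zs)) deficit"
    unfolding deficit_def using integrable_ln_mnorm[OF yz] integrable_ln_norm[OF yz u] by auto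
  define h where "h T = log_inv TYPE('n) + (real CARD('n) + 1) * ln (mnorm T)" for T :: "real^'n^'n"
  have [measurable]: "h \<in> borel_measurable borel"
    unfolding h_def by measurable
  have h_nn: "0 \<le> h T" if "det T = 1" for T
    using mnorm_ge_1[OF that] log_inv_nonneg[where 'n='n] card_ge_1 by (auto simp: h_def)
  have h_int: "(\<integral>\<^sup>+T. ennreal (h T) \<partial>law ws) = ennreal (log_inv TYPE('n) + (real CARD('n) + 1) * \<Lambda> ws)"
    if ws: "set ws \<subseteq> K" for ws
  proof -
    interpret prob_space "law ws" by (rule law_prob[OF ws])
    have "(\<integral>\<^sup>+T. ennreal (h T) \<partial>law ws) = ennreal (\<integral>T. h T \<partial>law ws)"
      using integrable_ln_mnorm[OF ws] law_det[OF ws]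
      by (intro nn_integral_eq_integral) (auto simp: h_def[abs_def] intro: h_nn[unfolded h_def] elim!: eventually_mono)
    also have "(\<integral>T. h T \<partial>law ws) = log_inv TYPE('n) + (real CARD('n) + 1) * \<Lambda> ws"
      using integrable_ln_mnorm[OF ws] by (simp add: h_def \<Lambda>_def prob_space)
    finally show ?thesis .
  qed
  let ?q = "\<bar>ln ((real CARD('n))\<^sup>2 / r)\<bar>"
  let ?B = "log_inv TYPE('n) + (real CARD('n) + 1) * \<Lambda> zs"
  have B0: "0 \<le> ?B" using Lambda_nonneg[OF zs] log_inv_nonneg[where 'n='n] by simp
  have inner: "(\<integral>\<^sup>+T. ennreal (deficit (S ** T)) \<partial>law zs) \<le> ennreal ?B + ennreal ?q + ennreal \<eta> * ennreal (h S)"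
    if S: "det S = 1" for S
  proof -
    obtain H where H: "subspace H" "dim H = CARD('n) - 1"
      "\<And>x. x \<noteq> 0 \<Longrightarrow> x \<notin> near r H \<Longrightarrow> ln (mnorm S) + ln (norm x) \<le> ln (norm (S *v x)) + ?q"
      using exists_hyperplane[OF S r] by blast
    have pt: "ennreal (deficit (S ** T)) \<le> ennreal (h T) + (ennreal ?q + ennreal (h S) * indicator (near r H) (T *v u))"
      if T: "det T = 1" for T
    proof -
      let ?x = "T *v u"
      have x0: "?x \<noteq> 0" by (rule mult_vec_nz[OF T u0])
      have ST: "(S ** T) *v u = S *v ?x" by (simp add: matrix_vector_mul_assoc)
      have mS: "1 \<le> mnorm S" "1 \<le> mnorm T" using mnorm_ge_1 S T by auto
      have "det (S ** T) = 1" using S T by (simp add: det_mul)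
      then have "ln (mnorm (S ** T)) \<le> ln (mnorm S * mnorm T)"
        using mnorm_mult_le[of S T] mnorm_ge_1[of "S ** T"] mS by (subst ln_le_cancel_iff) auto
      then have n: "ln (mnorm (S ** T)) \<le> ln (mnorm S) + ln (mnorm T)" using mS by (simp add: ln_mult_pos)
      have xl: "- log_gauge T \<le> ln (norm ?x)" using ln_norm_mult_vec_ge[OF T u0] u by simp
      have "deficit (S ** T) \<le> h T + (?q + h S * indicator (near r H) ?x)"
      proof (cases "?x \<in> near r H")
        case True
        have "ln (norm ?x) - log_gauge S \<le> ln (norm (S *v ?x))"
          by (rule ln_norm_mult_vec_ge[OF S x0])
        then have "deficit (S ** T) \<le> h T + h S"
          using n xl by (simp add: deficit_def ST h_def algebra_simps)
        then show ?thesis using True by simp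
      next
        case False
        then have "deficit (S ** T) \<le> h T + ?q"
          using n xl H(3)[OF x0 False] by (simp add: deficit_def ST h_def algebra_simps)
        then show ?thesis using False by simp
      qed
      then have "ennreal (deficit (S ** T)) \<le> ennreal (h T + (?q + h S * indicator (near r H) ?x))"
        by (rule ennreal_leI)
      also have "\<dots> = ennreal (h T) + (ennreal ?q + ennreal (h S) * indicator (near r H) ?x)"
        using h_nn[OF T] h_nn[OF S] by (simp add: ennreal_plus ennreal_mult ennreal_indicator)
      finally show ?thesis .
    qed
    have near_le: "(\<integral>\<^sup>+T. indicator (near r H) (T *v u) \<partial>law zs) \<le> ennreal \<eta>"
    proof -
      interpret V: prob_space "vlaw zs (return borel u)"
        using nz_prob_vlaw_mem[OF zs nz_prob_return[OF u0]] by (simp add: nz_prob_def)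
      have sV: "sets (vlaw zs (return borel u)) = sets borel"
        using nz_prob_vlaw_mem[OF zs nz_prob_return[OF u0]] by (simp add: nz_prob_def)
      have "(\<integral>\<^sup>+T. indicator (near r H) (T *v u) \<partial>law zs) = (\<integral>\<^sup>+y. indicator (near r H) y \<partial>vlaw zs (return borel u))"
        using sl_prob_mem[OF zs] u0 by (intro nn_integral_vlaw_return[symmetric]) auto
      also have "\<dots> = ennreal (measure (vlaw zs (return borel u)) (near r H))"
        by (simp add: sV V.emeasure_eq_measure)
      also have "\<dots> \<le> ennreal \<eta>" using D[OF H(1,2)] by (rule ennreal_leI)
      finally show ?thesis .
    qed
    have "(\<integral>\<^sup>+T. ennreal (deficit (S ** T)) \<partial>law zs)
        \<le> (\<integral>\<^sup>+T. ennreal (h T) + (ennreal ?q + ennreal (h S) * indicator (near r H) (T *v u)) \<partial>law zs)"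
      using law_det[OF zs] pt by (intro nn_integral_mono_AE) (auto elim: eventually_mono)
    also have "\<dots> = (\<integral>\<^sup>+T. ennreal (h T) \<partial>law zs) + (ennreal ?q +
        ennreal (h S) * (\<integral>\<^sup>+T. indicator (near r H) (T *v u) \<partial>law zs))"
      by (simp add: nn_integral_add nn_integral_cmult Z.emeasure_space_1)
    also have "\<dots> \<le> ennreal ?B + (ennreal ?q + ennreal (h S) * ennreal \<eta>)"
      unfolding h_int[OF zs] by (intro add_mono mult_left_mono near_le order_refl) auto
    finally show ?thesis by (simp add: add.assoc mult.commute)
  qed
  have "(\<integral>\<^sup>+T. ennreal (deficit T) \<partial>law (ys @ zs)) = (\<integral>\<^sup>+S. \<integral>\<^sup>+T. ennreal (deficit (S ** T)) \<partial>law zs \<partial>law ys)"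
    using law_append[of ys zs] sl_prob_mem[OF yz] by (simp add: nn_integral_conv[OF Ly Lz])
  also have "\<dots> \<le> (\<integral>\<^sup>+S. ennreal ?B + ennreal ?q + ennreal \<eta> * ennreal (h S) \<partial>law ys)"
    using law_det[OF ys] inner by (intro nn_integral_mono_AE) (auto elim: eventually_mono)
  also have "\<dots> = ennreal ?B + ennreal ?q + ennreal \<eta> * ennreal (log_inv TYPE('n) + (real CARD('n) + 1) * \<Lambda> ys)"
    by (simp add: nn_integral_add nn_integral_cmult Y.emeasure_space_1 h_int[OF ys])
  also have "\<dots> = ennreal (?B + ?q + \<eta> * (log_inv TYPE('n) + (real CARD('n) + 1) * \<Lambda> ys))"
    using B0 \<eta> Lambda_nonneg[OF ys] log_inv_nonneg[where 'n='n]
    by (simp add: ennreal_plus ennreal_mult)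
  finally have "(\<integral>\<^sup>+T. ennreal (deficit T) \<partial>law (ys @ zs)) \<le> ennreal (?B + ?q + \<eta> * (log_inv TYPE('n) + (real CARD('n) + 1) * \<Lambda> ys))" .
  moreover have "AE T in law (ys @ zs). 0 \<le> deficit T"
    using law_det[OF yz]
  proof eventually_elim
    case (elim T)
    then show ?case using ln_norm_mult_vec_le[OF elim u0] u by (simp add: deficit_def)
  qed
  ultimately have "ennreal (\<integral>T. deficit T \<partial>law (ys @ zs)) \<le> ennreal (?B + ?q + \<eta> * (log_inv TYPE('n) + (real CARD('n) + 1) * \<Lambda> ys))"
    using deficit_int by (simp add: nn_integral_eq_integral)
  then have "(\<integral>T. deficit T \<partial>law (ys @ zs)) \<le> ?B + ?q + \<eta> * (log_inv TYPE('n) + (real CARD('n) + 1) * \<Lambda> ys)"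
    using B0 \<eta> Lambda_nonneg[OF ys] log_inv_nonneg[where 'n='n]
    by (subst (asm) ennreal_le_iff) auto
  then show ?thesis
    using integrable_ln_mnorm[OF yz] integrable_ln_norm[OF yz u] by (simp add: deficit_def \<Lambda>_def)
qed

text \<open>Keep the number \<open>k\<close> of factors in \<open>zs\<close> fixed, so that all terms of the deficit except the one with
  \<open>\<eta>\<close> are bounded by a constant \<open>B\<close>, and make the block long.\<close>

lemma block_growth:
  fixes \<epsilon> :: real
  assumes \<epsilon>: "0 < \<epsilon>"
  shows "\<exists>m>0. \<forall>xs u. set xs \<subseteq> K \<longrightarrow> length xs = m \<longrightarrow> norm u = 1 \<longrightarrow>
    \<Lambda> xs - \<epsilon> * m \<le> (\<integral>T. ln (norm (T *v u)) \<partial>law xs)"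
proof -
  \<comment> \<open>\<open>c * m\<close> bounds the factor of \<open>\<eta>\<close> in the deficit; the summand 1 makes \<open>c\<close> positive\<close>
  define c where "c = log_inv TYPE('n) + 1 + (real CARD('n) + 1) * rate"
  have c: "0 < c" using log_inv_nonneg[where 'n='n] rate_nonneg card_ge_1 by (simp add: c_def add_nonneg_pos add_pos_nonneg)
  define \<eta> where "\<eta> = \<epsilon> / (2 * c)"
  have \<eta>: "0 < \<eta>" using \<epsilon> c by (simp add: \<eta>_def)
  have "dissolves (CARD('n) - 1)" by (rule dissolves) simp
  then obtain k r where kr: "0 < r" "\<And>xs N S. set xs \<subseteq> K \<Longrightarrow> length xs = k \<Longrightarrow> nz_prob N \<Longrightarrow>
     subspace S \<Longrightarrow> dim S = CARD('n) - 1 \<Longrightarrow> measure (vlaw xs N) (near r S) \<le> \<eta>"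
    using \<eta> unfolding dissolves_def by blast
  define B where "B = log_inv TYPE('n) + (real CARD('n) + 1) * (k * rate) + \<bar>ln ((real CARD('n))\<^sup>2 / r)\<bar>"
  obtain n1 where n1: "B \<le> \<epsilon> / 2 * real n1"
    using reals_Archimedean3[of "\<epsilon> / 2"] \<epsilon> by (metis half_gt_zero less_imp_le mult.commute)
  define m where "m = max n1 (Suc k)"
  have "\<Lambda> xs - \<epsilon> * m \<le> (\<integral>T. ln (norm (T *v u)) \<partial>law xs)"
    if xs: "set xs \<subseteq> K" "length xs = m" and u: "norm u = 1" for xs u
  proof -
    define ys where "ys = take (m - k) xs"
    define zs where "zs = drop (m - k) xs"
    have yz: "xs = ys @ zs" "length ys = m - k" "length zs = k"
      using xs(2) by (auto simp: ys_def zs_def m_def)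
    have s: "set ys \<subseteq> K" "set zs \<subseteq> K" using xs(1) yz(1) by auto
    have u0: "u \<noteq> 0" using u by auto
    have "\<Lambda> xs - (\<integral>T. ln (norm (T *v u)) \<partial>law xs)
       \<le> log_inv TYPE('n) + (real CARD('n) + 1) * \<Lambda> zs + \<bar>ln ((real CARD('n))\<^sup>2 / r)\<bar> + \<eta> * (log_inv TYPE('n) + (real CARD('n) + 1) * \<Lambda> ys)"
      unfolding yz(1) using \<eta> kr(2)[OF s(2) yz(3) nz_prob_return[OF u0]]
      by (intro block_deficit s u kr(1)) auto
    also have "\<dots> \<le> B + \<eta> * (c * m)"
    proof (intro add_mono mult_left_mono)
      show "log_inv TYPE('n) + (real CARD('n) + 1) * \<Lambda> zs + \<bar>ln ((real CARD('n))\<^sup>2 / r)\<bar> \<le> B"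
        unfolding B_def using Lambda_le[OF s(2)] yz(3) card_ge_1 by (intro add_mono mult_left_mono) auto
      have m1: "1 \<le> real m" by (simp add: m_def)
      have "\<Lambda> ys \<le> real (m - k) * rate" using Lambda_le[OF s(1)] yz(2) by simp
      also have "\<dots> \<le> m * rate" using rate_nonneg by (intro mult_right_mono) auto
      finally have "(real CARD('n) + 1) * \<Lambda> ys \<le> (real CARD('n) + 1) * (m * rate)" using card_ge_1 by (intro mult_left_mono) auto
      moreover have "log_inv TYPE('n) * 1 \<le> log_inv TYPE('n) * m"
        using m1 log_inv_nonneg[where 'n='n] by (intro mult_left_mono) auto
      ultimately show "log_inv TYPE('n) + (real CARD('n) + 1) * \<Lambda> ys \<le> c * m"
        by (simp add: c_def algebra_simps)
    qed (use \<eta> in auto)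
    also have "\<dots> \<le> \<epsilon> / 2 * m + \<epsilon> / 2 * m"
    proof (rule add_mono)
      have "\<epsilon> / 2 * real n1 \<le> \<epsilon> / 2 * m" using \<epsilon> by (intro mult_left_mono) (auto simp: m_def)
      then show "B \<le> \<epsilon> / 2 * m" using n1 by linarith
      show "\<eta> * (c * m) \<le> \<epsilon> / 2 * m" using c by (simp add: \<eta>_def)
    qed
    finally show ?thesis by simp
  qed
  moreover have "0 < m" by (simp add: m_def)
  ultimately show ?thesis by blast
qed

text \<open>Chosen so that \<open>2 * s0\<close> times the bound \<open>log_gauge T\<close> is, up to a constant,
  \<open>\<gamma> * ln (mnorm T)\<close>: this is the exponent for which the moment condition applies.\<close>

definition s0 :: real where "s0 = \<gamma> / (2 * real CARD('n))"

lemma s0: "0 < s0"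
  using gamma card_ge_1 by (simp add: s0_def)

lemma exp_bound_moment:
  assumes xs: "set xs \<subseteq> K"
  shows "(\<integral>\<^sup>+T. ennreal (exp (2 * s0 * log_gauge T)) \<partial>law xs) \<le> ennreal (exp (2 * s0 * log_inv TYPE('n)) * C ^ length xs)"
proof -
  have "(\<integral>\<^sup>+T. ennreal (exp (2 * s0 * log_gauge T)) \<partial>law xs)
     = (\<integral>\<^sup>+T. ennreal (exp (2 * s0 * log_inv TYPE('n))) * ennreal (mnorm T powr \<gamma>) \<partial>law xs)"
  proof (rule nn_integral_cong_AE)
    show "AE T in law xs. ennreal (exp (2 * s0 * log_gauge T)) = ennreal (exp (2 * s0 * log_inv TYPE('n))) * ennreal (mnorm T powr \<gamma>)"
      using law_det[OF xs]
    proof eventually_elim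
      case (elim T)
      have "2 * s0 * log_gauge T = 2 * s0 * log_inv TYPE('n) + \<gamma> * ln (mnorm T)"
        using card_ge_1 by (simp add: s0_def field_simps)
      then show ?case
        using mnorm_ge_1[OF elim] by (simp add: exp_add powr_def ennreal_mult)
    qed
  qed
  also have "\<dots> = ennreal (exp (2 * s0 * log_inv TYPE('n))) * (\<integral>\<^sup>+T. ennreal (mnorm T powr \<gamma>) \<partial>law xs)"
    by (intro nn_integral_cmult) simp
  also have "\<dots> \<le> ennreal (exp (2 * s0 * log_inv TYPE('n))) * ennreal (C ^ length xs)"
    by (intro mult_left_mono law_moment[OF xs]) simp
  finally show ?thesis using C1 by (simp add: ennreal_mult)
qed

text \<open>Second-order expansion of \<open>exp (\<sigma> * X)\<close> for \<open>X = ln |T u|\<close>. The quadratic error is integrable because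
  \<open>X\<^sup>2\<close> is absorbed by one exponential with exponent \<open>s0\<close> and \<open>exp \<bar>\<sigma> * X\<bar>\<close> by another one.\<close>

lemma block_exp:
  assumes xs: "set xs \<subseteq> K" and u: "norm u = 1" and \<sigma>: "\<bar>\<sigma>\<bar> \<le> s0"
  shows "powr_moment \<sigma> xs u
    \<le> ennreal (exp (\<sigma> * (\<integral>T. ln (norm (T *v u)) \<partial>law xs) + \<sigma>\<^sup>2 * (2 / s0\<^sup>2 * (exp (2 * s0 * log_inv TYPE('n)) * C ^ length xs))))"
proof -
  interpret prob_space "law xs" by (rule law_prob[OF xs])
  have u0: "u \<noteq> 0" using u by auto
  define G where "G T = exp (2 * s0 * log_gauge T)" for T :: "real^'n^'n"
  have [measurable]: "G \<in> borel_measurable borel" unfolding G_def by measurable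
  have G_int: "integrable (law xs) G"
    by (rule integrable_of_nn_integral_le[OF _ _ exp_bound_moment[OF xs, folded G_def]]) (auto simp: G_def)
  have EG: "(\<integral>T. G T \<partial>law xs) \<le> exp (2 * s0 * log_inv TYPE('n)) * C ^ length xs"
    using exp_bound_moment[OF xs] G_int C1
    by (subst (asm) nn_integral_eq_integral) (auto simp: G_def[abs_def])
  define X where "X T = ln (norm (T *v u))" for T :: "real^'n^'n"
  have X_int: "integrable (law xs) X" unfolding X_def using integrable_ln_norm[OF xs u] .
  let ?R = "\<lambda>T. 1 + \<sigma> * X T + \<sigma>\<^sup>2 * (2 / s0\<^sup>2 * G T)"
  have R_int: "integrable (law xs) ?R" using X_int G_int by auto
  have pt: "AE T in law xs. norm (T *v u) powr \<sigma> \<le> ?R T"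
    using law_det[OF xs]
  proof eventually_elim
    case (elim T)
    define Y where "Y = log_gauge T"
    have XY: "\<bar>X T\<bar> \<le> Y" unfolding X_def Y_def by (rule abs_ln_norm_mult_vec_le[OF elim u])
    have Y0: "0 \<le> Y" using XY by linarith
    have "norm (T *v u) powr \<sigma> = exp (\<sigma> * X T)"
      using norm_mult_vec_pos[OF elim u0] by (simp add: powr_def X_def)
    also have "\<dots> \<le> 1 + \<sigma> * X T + (\<sigma> * X T)\<^sup>2 * exp \<bar>\<sigma> * X T\<bar>" by (rule exp_le_quadratic)
    also have "(\<sigma> * X T)\<^sup>2 * exp \<bar>\<sigma> * X T\<bar> \<le> \<sigma>\<^sup>2 * (2 / s0\<^sup>2 * G T)"
    proof -
      have "(X T)\<^sup>2 \<le> Y\<^sup>2" using XY by (metis abs_le_square_iff abs_of_nonneg Y0)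
      moreover have "(s0 * Y)\<^sup>2 \<le> 2 * exp (s0 * Y)" using s0 Y0 by (intro square_le_exp) simp
      then have "Y\<^sup>2 \<le> 2 / s0\<^sup>2 * exp (s0 * Y)" using s0 by (simp add: field_simps power_mult_distrib)
      ultimately have X2: "(X T)\<^sup>2 \<le> 2 / s0\<^sup>2 * exp (s0 * Y)" by linarith
      have "\<bar>\<sigma> * X T\<bar> \<le> s0 * Y" unfolding abs_mult using \<sigma> XY s0 by (intro mult_mono) auto
      then have "(X T)\<^sup>2 * exp \<bar>\<sigma> * X T\<bar> \<le> (2 / s0\<^sup>2 * exp (s0 * Y)) * exp (s0 * Y)"
        using X2 by (intro mult_mono) auto
      also have "\<dots> = 2 / s0\<^sup>2 * G T"
        by (simp add: G_def Y_def flip: exp_add)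
      finally have "\<sigma>\<^sup>2 * ((X T)\<^sup>2 * exp \<bar>\<sigma> * X T\<bar>) \<le> \<sigma>\<^sup>2 * (2 / s0\<^sup>2 * G T)"
        by (rule mult_left_mono) simp
      then show ?thesis by (simp only: power_mult_distrib mult.assoc)
    qed
    finally show ?case by simp
  qed
  have "powr_moment \<sigma> xs u \<le> (\<integral>\<^sup>+T. ennreal (?R T) \<partial>law xs)"
    using pt by (intro nn_integral_mono_AE) (auto elim!: eventually_mono intro: ennreal_leI)
  also have "\<dots> = ennreal (\<integral>T. ?R T \<partial>law xs)"
    using pt by (intro nn_integral_eq_integral R_int) (auto elim!: eventually_mono intro: order_trans[OF powr_ge_zero])
  also have "(\<integral>T. ?R T \<partial>law xs) = 1 + \<sigma> * (\<integral>T. X T \<partial>law xs) + \<sigma>\<^sup>2 * (2 / s0\<^sup>2 * (\<integral>T. G T \<partial>law xs))"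
    using X_int G_int by (simp add: prob_space)
  also have "ennreal \<dots> \<le> ennreal (exp (\<sigma> * (\<integral>T. X T \<partial>law xs) + \<sigma>\<^sup>2 * (2 / s0\<^sup>2 * (exp (2 * s0 * log_inv TYPE('n)) * C ^ length xs))))"
  proof (rule ennreal_leI)
    have "\<sigma>\<^sup>2 * (2 / s0\<^sup>2 * (\<integral>T. G T \<partial>law xs)) \<le> \<sigma>\<^sup>2 * (2 / s0\<^sup>2 * (exp (2 * s0 * log_inv TYPE('n)) * C ^ length xs))"
      using EG by (intro mult_left_mono) auto
    then show "1 + \<sigma> * (\<integral>T. X T \<partial>law xs) + \<sigma>\<^sup>2 * (2 / s0\<^sup>2 * (\<integral>T. G T \<partial>law xs))
      \<le> exp (\<sigma> * (\<integral>T. X T \<partial>law xs) + \<sigma>\<^sup>2 * (2 / s0\<^sup>2 * (exp (2 * s0 * log_inv TYPE('n)) * C ^ length xs)))"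
      using exp_ge_add_one_self[of "\<sigma> * (\<integral>T. X T \<partial>law xs) + \<sigma>\<^sup>2 * (2 / s0\<^sup>2 * (exp (2 * s0 * log_inv TYPE('n)) * C ^ length xs))"]
      by linarith
  qed
  finally show ?thesis by (simp add: X_def)
qed

lemma powr_moment_homogeneous:
  assumes xs: "set xs \<subseteq> K" and x: "x \<noteq> 0"
    and b: "\<And>u. norm u = 1 \<Longrightarrow> powr_moment \<sigma> xs u \<le> B"
  shows "powr_moment \<sigma> xs x \<le> B * ennreal (norm x powr \<sigma>)"
proof -
  let ?u = "(1 / norm x) *\<^sub>R x"
  have u: "norm ?u = 1" using x by simp
  have hom: "ennreal (norm (T *v x) powr \<sigma>) = ennreal (norm (T *v ?u) powr \<sigma>) * ennreal (norm x powr \<sigma>)" for T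
  proof -
    have "norm (T *v x) = norm (T *v ?u) * norm x" using x by (simp add: matrix_vector_mult_scaleR)
    then show ?thesis by (simp add: powr_mult flip: ennreal_mult)
  qed
  have "powr_moment \<sigma> xs x
     = (\<integral>\<^sup>+T. ennreal (norm (T *v ?u) powr \<sigma>) * ennreal (norm x powr \<sigma>) \<partial>law xs)"
    by (rule nn_integral_cong) (rule hom)
  also have "\<dots> = powr_moment \<sigma> xs ?u * ennreal (norm x powr \<sigma>)"
    by (intro nn_integral_multc) simp
  also have "\<dots> \<le> B * ennreal (norm x powr \<sigma>)" by (intro mult_right_mono b u) simp
  finally show ?thesis .
qed

text \<open>The bound for \<open>ys\<close> holds for every starting vector, hence also for the random vector produced
  by \<open>zs\<close>.\<close>

lemma powr_moment_append:
  assumes ys: "set ys \<subseteq> K" and zs: "set zs \<subseteq> K" and x: "x \<noteq> 0"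
    and b: "\<And>x. x \<noteq> 0 \<Longrightarrow> powr_moment \<sigma> ys x \<le> B * ennreal (norm x powr \<sigma>)"
  shows "powr_moment \<sigma> (ys @ zs) x
     \<le> B * powr_moment \<sigma> zs x"
proof -
  let ?f = "\<lambda>y :: real^'n. ennreal (norm y powr \<sigma>)"
  have f: "?f \<in> borel_measurable borel" by simp
  let ?V = "vlaw zs (return borel x)"
  have V: "nz_prob ?V" using nz_prob_vlaw_mem[OF zs nz_prob_return[OF x]] .
  have ysl: "\<And>M. M \<in> set ys \<Longrightarrow> sl_prob M" and zsl: "\<And>M. M \<in> set zs \<Longrightarrow> sl_prob M"
    and yzsl: "\<And>M. M \<in> set (ys @ zs) \<Longrightarrow> sl_prob M"
    using sl_prob_mem[OF ys] sl_prob_mem[OF zs] by auto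
  have "(\<integral>\<^sup>+T. ?f (T *v x) \<partial>law (ys @ zs)) = (\<integral>\<^sup>+y. ?f y \<partial>vlaw (ys @ zs) (return borel x))"
    by (rule nn_integral_vlaw_return[OF yzsl x f, symmetric])
  also have "vlaw (ys @ zs) (return borel x) = step (law ys) ?V"
    using step_law[OF ysl V] by (simp add: vlaw_append)
  also have "(\<integral>\<^sup>+y. ?f y \<partial>step (law ys) ?V) = (\<integral>\<^sup>+y. \<integral>\<^sup>+T. ?f (T *v y) \<partial>law ys \<partial>?V)"
    by (rule nn_integral_step_swap[OF sl_prob_law[OF ysl] V f])
  also have "\<dots> \<le> (\<integral>\<^sup>+y. B * ?f y \<partial>?V)"
  proof (rule nn_integral_mono_AE)
    have "AE y in ?V. y \<noteq> 0" using V by (simp add: nz_prob_def)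
    then show "AE y in ?V. (\<integral>\<^sup>+T. ?f (T *v y) \<partial>law ys) \<le> B * ?f y"
      by eventually_elim (rule b)
  qed
  also have "\<dots> = B * (\<integral>\<^sup>+y. ?f y \<partial>?V)"
    by (rule nn_integral_cmult[OF measurable_of_nz_prob[OF V f]])
  also have "(\<integral>\<^sup>+y. ?f y \<partial>?V) = (\<integral>\<^sup>+T. ?f (T *v x) \<partial>law zs)"
    by (rule nn_integral_vlaw_return[OF zsl x f])
  finally show ?thesis .
qed

text \<open>Over one block of length \<open>m\<close> the linear term of the expansion is \<open>\<sigma> * \<Lambda>\<close> up to \<open>s * \<epsilon> / 2 * m\<close> for both
  signs of \<open>\<sigma>\<close>, and \<open>s\<close> is so small that the quadratic term is at most as large. The blocks multiply;
  the last, incomplete block only contributes the constant \<open>C'\<close>. The centre \<open>c\<close> is the sum of the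
  \<open>\<Lambda>\<close> of the blocks. It must not be replaced by \<open>\<Lambda>\<close> of the whole product during the induction, because
  the comparison would cost an error proportional to the length at every step.\<close>

lemma exponential_moments:
  fixes \<epsilon> :: real
  assumes \<epsilon>: "0 < \<epsilon>"
  shows "\<exists>s>0. \<exists>C'. \<forall>xs. set xs \<subseteq> K \<longrightarrow> (\<exists>c. \<forall>x \<sigma>. x \<noteq> 0 \<longrightarrow> \<bar>\<sigma>\<bar> = s \<longrightarrow>
     powr_moment \<sigma> xs x
       \<le> ennreal (exp (\<sigma> * c + s * \<epsilon> * length xs + C')) * ennreal (norm x powr \<sigma>))"
proof -
  obtain m where m: "0 < m" "\<And>xs u. set xs \<subseteq> K \<Longrightarrow> length xs = m \<Longrightarrow> norm u = 1 \<Longrightarrow>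
    \<Lambda> xs - \<epsilon> / 2 * m \<le> (\<integral>T. ln (norm (T *v u)) \<partial>law xs)"
    using block_growth[OF half_gt_zero[OF \<epsilon>]] by blast
  define B where "B = 2 / s0\<^sup>2 * (exp (2 * s0 * log_inv TYPE('n)) * C ^ m)"
  have B: "0 < B" unfolding B_def using s0 C1 by (intro mult_pos_pos divide_pos_pos zero_less_power) auto
  \<comment> \<open>makes the quadratic error \<open>s\<^sup>2 * B\<close> at most \<open>s * \<epsilon> / 2 * m\<close>\<close>
  define s where "s = min s0 (\<epsilon> * m / (2 * B))"
  have s: "0 < s" "s \<le> s0" using s0 \<epsilon> m B by (auto simp: s_def)
  have sB: "s\<^sup>2 * B \<le> s * (\<epsilon> / 2 * m)"
  proof -
    have "s \<le> \<epsilon> * m / (2 * B)" by (simp add: s_def)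
    then have "s * B \<le> \<epsilon> / 2 * m" using B by (simp add: field_simps)
    then show ?thesis using s(1) by (simp add: power2_eq_square mult.assoc mult_left_mono)
  qed
  define C' where "C' = 2 * s0 * log_inv TYPE('n) + m * ln C"
  have short: "powr_moment \<sigma> xs x \<le> ennreal (exp C') * ennreal (norm x powr \<sigma>)"
    if xs: "set xs \<subseteq> K" "length xs < m" and x: "x \<noteq> 0" and \<sigma>: "\<bar>\<sigma>\<bar> = s" for xs x \<sigma>
  proof (rule powr_moment_homogeneous[OF xs(1) x])
    fix u :: "real^'n" assume u: "norm u = 1"
    have u0: "u \<noteq> 0" using u by auto
    have "powr_moment \<sigma> xs u
      \<le> (\<integral>\<^sup>+T. ennreal (exp (2 * s0 * log_gauge T)) \<partial>law xs)"
    proof (rule nn_integral_mono_AE)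
      show "AE T in law xs. ennreal (norm (T *v u) powr \<sigma>) \<le> ennreal (exp (2 * s0 * log_gauge T))"
        using law_det[OF xs(1)]
      proof eventually_elim
        case (elim T)
        have XY: "\<bar>ln (norm (T *v u))\<bar> \<le> log_gauge T"
          by (rule abs_ln_norm_mult_vec_le[OF elim u])
        have "\<sigma> * ln (norm (T *v u)) \<le> \<bar>\<sigma>\<bar> * \<bar>ln (norm (T *v u))\<bar>" by (metis abs_ge_self abs_mult)
        also have "\<dots> \<le> (2 * s0) * log_gauge T"
          using \<sigma> s s0 XY by (intro mult_mono) auto
        finally show ?case
          using norm_mult_vec_pos[OF elim u0] by (intro ennreal_leI) (simp add: powr_def)
      qed
    qed
    also have "\<dots> \<le> ennreal (exp (2 * s0 * log_inv TYPE('n)) * C ^ length xs)" by (rule exp_bound_moment[OF xs(1)])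
    also have "\<dots> \<le> ennreal (exp C')"
    proof (rule ennreal_leI)
      have "C ^ length xs \<le> C ^ m" using C1 xs(2) by (intro power_increasing) auto
      also have "C ^ m = exp (m * ln C)" using C1 by (simp add: exp_of_nat_mult)
      finally show "exp (2 * s0 * log_inv TYPE('n)) * C ^ length xs \<le> exp C'"
        by (simp add: C'_def exp_add)
    qed
    finally show "powr_moment \<sigma> xs u \<le> ennreal (exp C')" .
  qed
  have one_block: "powr_moment \<sigma> xs x
      \<le> ennreal (exp (\<sigma> * \<Lambda> xs + s * \<epsilon> * m)) * ennreal (norm x powr \<sigma>)"
    if xs: "set xs \<subseteq> K" "length xs = m" and x: "x \<noteq> 0" and \<sigma>: "\<bar>\<sigma>\<bar> = s" for xs x \<sigma>
  proof (rule powr_moment_homogeneous[OF xs(1) x])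
    fix u :: "real^'n" assume u: "norm u = 1"
    have u0: "u \<noteq> 0" using u by auto
    let ?E = "\<integral>T. ln (norm (T *v u)) \<partial>law xs"
    have lower: "\<Lambda> xs - \<epsilon> / 2 * m \<le> ?E" by (rule m(2)[OF xs u])
    have upper: "?E \<le> \<Lambda> xs"
      unfolding \<Lambda>_def
    proof (rule integral_mono_AE[OF integrable_ln_norm[OF xs(1) u] integrable_ln_mnorm[OF xs(1)]])
      show "AE T in law xs. ln (norm (T *v u)) \<le> ln (mnorm T)"
        using law_det[OF xs(1)] by eventually_elim (use ln_norm_mult_vec_le[OF _ u0] u in force)
    qed
    have "\<sigma> * ?E \<le> \<sigma> * \<Lambda> xs + s * (\<epsilon> / 2 * m)"
    proof (cases "0 \<le> \<sigma>")
      case True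
      have "\<sigma> * ?E \<le> \<sigma> * \<Lambda> xs" using upper True by (rule mult_left_mono)
      then show ?thesis using s \<epsilon> by (simp add: add_increasing2)
    next
      case False
      then have "\<sigma> = - s" using \<sigma> by simp
      moreover have "s * (\<Lambda> xs - \<epsilon> / 2 * m) \<le> s * ?E" using lower s by (intro mult_left_mono) auto
      ultimately show ?thesis by (simp add: algebra_simps)
    qed
    moreover have "\<sigma>\<^sup>2 * B \<le> s * (\<epsilon> / 2 * m)" using sB \<sigma> by (metis power2_abs)
    moreover have "s * (\<epsilon> / 2 * m) + s * (\<epsilon> / 2 * m) = s * \<epsilon> * m" by simp
    ultimately have "\<sigma> * ?E + \<sigma>\<^sup>2 * B \<le> \<sigma> * \<Lambda> xs + s * \<epsilon> * m" by linarith
    moreover have "powr_moment \<sigma> xs u \<le> ennreal (exp (\<sigma> * ?E + \<sigma>\<^sup>2 * B))"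
      using block_exp[OF xs(1) u, of \<sigma>] \<sigma> s(2) xs(2) by (simp add: B_def)
    ultimately show "powr_moment \<sigma> xs u \<le> ennreal (exp (\<sigma> * \<Lambda> xs + s * \<epsilon> * m))"
      by (meson ennreal_leI exp_le_cancel_iff order_trans)
  qed
  have "\<exists>c. \<forall>x \<sigma>. x \<noteq> 0 \<longrightarrow> \<bar>\<sigma>\<bar> = s \<longrightarrow>
     powr_moment \<sigma> xs x
       \<le> ennreal (exp (\<sigma> * c + s * \<epsilon> * length xs + C')) * ennreal (norm x powr \<sigma>)"
    if "set xs \<subseteq> K" for xs
    using that
  proof (induction "length xs" arbitrary: xs rule: less_induct)
    case less
    show ?case
    proof (cases "length xs < m")
      case True
      have exp_le: "ennreal (exp C') \<le> ennreal (exp (\<sigma> * 0 + s * \<epsilon> * length xs + C'))" for \<sigma>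
        using s \<epsilon> by (intro ennreal_leI) simp
      show ?thesis
      proof (intro exI[of _ 0] allI impI)
        fix x :: "real^'n" and \<sigma> assume x: "x \<noteq> 0" and \<sigma>: "\<bar>\<sigma>\<bar> = s"
        show "powr_moment \<sigma> xs x
           \<le> ennreal (exp (\<sigma> * 0 + s * \<epsilon> * length xs + C')) * ennreal (norm x powr \<sigma>)"
          by (rule order_trans[OF short[OF less.prems True x \<sigma>] mult_right_mono[OF exp_le]]) simp
      qed
    next
      case False
      define ys where "ys = take m xs"
      define zs where "zs = drop m xs"
      have yz: "xs = ys @ zs" "length ys = m" "length xs = m + length zs" using False by (auto simp: ys_def zs_def)
      have sets: "set ys \<subseteq> K" "set zs \<subseteq> K" using less.prems yz(1) by auto
      have "length zs < length xs" using yz(3) m(1) by simp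
      from less.hyps[OF this sets(2)] obtain c where c: "\<And>x \<sigma>. x \<noteq> 0 \<Longrightarrow> \<bar>\<sigma>\<bar> = s \<Longrightarrow>
         powr_moment \<sigma> zs x
         \<le> ennreal (exp (\<sigma> * c + s * \<epsilon> * length zs + C')) * ennreal (norm x powr \<sigma>)" by blast
      have "powr_moment \<sigma> xs x
         \<le> ennreal (exp (\<sigma> * (\<Lambda> ys + c) + s * \<epsilon> * length xs + C')) * ennreal (norm x powr \<sigma>)"
        if x: "x \<noteq> 0" and \<sigma>: "\<bar>\<sigma>\<bar> = s" for x \<sigma>
      proof -
        have "powr_moment \<sigma> xs x
          \<le> ennreal (exp (\<sigma> * \<Lambda> ys + s * \<epsilon> * m)) * powr_moment \<sigma> zs x"
          unfolding yz(1) by (rule powr_moment_append[OF sets x one_block[OF sets(1) yz(2) _ \<sigma>]])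
        also have "\<dots> \<le> ennreal (exp (\<sigma> * \<Lambda> ys + s * \<epsilon> * m)) *
            (ennreal (exp (\<sigma> * c + s * \<epsilon> * length zs + C')) * ennreal (norm x powr \<sigma>))"
          by (intro mult_left_mono c x \<sigma>) simp
        also have "\<dots> = ennreal (exp (\<sigma> * \<Lambda> ys + s * \<epsilon> * m) * exp (\<sigma> * c + s * \<epsilon> * length zs + C')) * ennreal (norm x powr \<sigma>)"
          by (simp add: ennreal_mult mult.assoc)
        also have "exp (\<sigma> * \<Lambda> ys + s * \<epsilon> * m) * exp (\<sigma> * c + s * \<epsilon> * length zs + C')
           = exp (\<sigma> * (\<Lambda> ys + c) + s * \<epsilon> * length xs + C')"
          unfolding exp_add[symmetric] yz(3) by (simp add: algebra_simps)
        finally show ?thesis .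
      qed
      then show ?thesis by blast
    qed
  qed
  then show ?thesis using s(1) by blast
qed

end

section \<open>The large deviation estimate\<close>

lemma (in prob_space) deviation_of_exp_moments:
  assumes Z: "Z \<in> borel_measurable M" and s: "0 < s"
    and E: "\<And>\<sigma>. \<bar>\<sigma>\<bar> = s \<Longrightarrow> (\<integral>\<^sup>+x. ennreal (exp (\<sigma> * Z x)) \<partial>M) \<le> ennreal (exp (\<sigma> * c + \<beta>))"
  shows "prob {x \<in> space M. t < \<bar>Z x - c\<bar>} \<le> 2 * exp (\<beta> - s * t)"
proof -
  have one: "prob {x \<in> space M. s * t \<le> \<sigma> * (Z x - c)} \<le> exp (\<beta> - s * t)" if \<sigma>: "\<bar>\<sigma>\<bar> = s" for \<sigma>
  proof -
    have [measurable]: "Z \<in> borel_measurable M" by fact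
    have int: "integrable M (\<lambda>x. exp (\<sigma> * Z x))"
      by (rule integrable_of_nn_integral_le[OF _ _ E[OF \<sigma>]]) auto
    have le: "expectation (\<lambda>x. exp (\<sigma> * Z x)) \<le> exp (\<sigma> * c + \<beta>)"
      using E[OF \<sigma>] int by (subst (asm) nn_integral_eq_integral) auto
    have "prob {x \<in> space M. exp (\<sigma> * c + s * t) \<le> exp (\<sigma> * Z x)}
      \<le> expectation (\<lambda>x. exp (\<sigma> * Z x)) / exp (\<sigma> * c + s * t)"
      by (rule integral_Markov_inequality_measure[where A = "{}"]) (use int in auto)
    also have "\<dots> \<le> exp (\<sigma> * c + \<beta>) / exp (\<sigma> * c + s * t)"
      using le by (intro divide_right_mono) auto
    also have "\<dots> = exp (\<beta> - s * t)" by (simp flip: exp_diff)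
    finally show ?thesis by (simp add: algebra_simps)
  qed
  have [measurable]: "Z \<in> borel_measurable M" by fact
  have "prob {x \<in> space M. t < \<bar>Z x - c\<bar>} \<le>
     prob ({x \<in> space M. s * t \<le> s * (Z x - c)} \<union> {x \<in> space M. s * t \<le> - s * (Z x - c)})"
  proof (rule finite_measure_mono)
    show "{x \<in> space M. t < \<bar>Z x - c\<bar>} \<subseteq> {x \<in> space M. s * t \<le> s * (Z x - c)} \<union> {x \<in> space M. s * t \<le> - s * (Z x - c)}"
    proof
      fix x assume "x \<in> {x \<in> space M. t < \<bar>Z x - c\<bar>}"
      then have x: "x \<in> space M" "t \<le> Z x - c \<or> t \<le> - (Z x - c)" by auto
      then have "s * t \<le> s * (Z x - c) \<or> s * t \<le> s * (- (Z x - c))"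
        using s by (meson less_imp_le mult_left_mono)
      then have "s * t \<le> s * (Z x - c) \<or> s * t \<le> - s * (Z x - c)" by (simp only: minus_mult_commute)
      then show "x \<in> {x \<in> space M. s * t \<le> s * (Z x - c)} \<union> {x \<in> space M. s * t \<le> - s * (Z x - c)}"
        using x(1) by blast
    qed
  qed measurable
  also have "\<dots> \<le> prob {x \<in> space M. s * t \<le> s * (Z x - c)} + prob {x \<in> space M. s * t \<le> - s * (Z x - c)}"
    by (rule measure_Un_le) measurable
  also have "\<dots> \<le> exp (\<beta> - s * t) + exp (\<beta> - s * t)"
    by (intro add_mono one) (use s in auto)
  finally show ?thesis by simp
qed

lemma (in prob_space) expectation_of_exp_moments:
  assumes Z: "integrable M Z" and s: "0 < s"
    and E: "\<And>\<sigma>. \<bar>\<sigma>\<bar> = s \<Longrightarrow> (\<integral>\<^sup>+x. ennreal (exp (\<sigma> * Z x)) \<partial>M) \<le> ennreal (exp (\<sigma> * c + \<beta>))"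
  shows "\<bar>expectation Z - c\<bar> \<le> \<beta> / s"
proof -
  have "s * expectation Z \<le> s * c + \<beta>"
    by (rule expectation_le_of_exp_moment[OF Z E]) (use s in simp)
  moreover have "- s * expectation Z \<le> - s * c + \<beta>"
    by (rule expectation_le_of_exp_moment[OF Z E]) (use s in simp)
  ultimately have "s * \<bar>expectation Z - c\<bar> \<le> \<beta>"
    using s by (auto simp: abs_if algebra_simps)
  then show ?thesis using s by (simp add: field_simps)
qed

lemma mnorm_le_columns:
  fixes T :: "real^'n^'n"
  shows "\<exists>i. mnorm T \<le> real CARD('n) * norm (T *v axis i 1)"
proof -
  define b where "b = Max (range (\<lambda>i. norm (T *v axis i 1)))"
  have "b \<in> range (\<lambda>i. norm (T *v axis i 1))" unfolding b_def by (rule Max_in) auto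
  then obtain i where i: "b = norm (T *v axis i 1)" by auto
  have le: "norm (T *v axis j 1) \<le> b" for j unfolding b_def by (rule Max_ge) auto
  have "mnorm T \<le> real CARD('n) * b"
  proof (rule onorm_le)
    fix x :: "real^'n"
    have "T *v x = T *v (\<Sum>j\<in>UNIV. (x $ j) *\<^sub>R axis j 1)"
      using basis_expansion[of x] by (simp add: scalar_mult_eq_scaleR)
    also have "\<dots> = (\<Sum>j\<in>UNIV. (x $ j) *\<^sub>R (T *v axis j 1))"
      by (simp add: matrix_vector_mult_scaleR linear_sum[OF matrix_vector_mul_linear])
    also have "norm \<dots> \<le> (\<Sum>j\<in>(UNIV::'n set). norm x * b)"
    proof (rule sum_norm_le)
      fix j show "norm ((x $ j) *\<^sub>R (T *v axis j 1)) \<le> norm x * b"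
        unfolding norm_scaleR real_norm_def by (intro mult_mono le component_le_norm_cart) auto
    qed
    finally have "norm (T *v x) \<le> (\<Sum>j\<in>(UNIV::'n set). norm x * b)" .
    then show "norm (T *v x) \<le> real CARD('n) * b * norm x" by (simp add: mult_ac)
  qed
  then show ?thesis using i by auto
qed

context moment_family
begin

definition concentrated ::
  "real \<Rightarrow> real \<Rightarrow> (real^'n^'n) measure list \<Rightarrow> (real^'n^'n \<Rightarrow> real) \<Rightarrow> bool" where
  "concentrated \<epsilon> \<delta> xs Z \<longleftrightarrow>
     measure (law xs) {T. \<epsilon> * real (length xs) < \<bar>Z T - \<Lambda> xs\<bar>} < exp (- \<delta> * real (length xs))"

text \<open>With \<open>\<epsilon> / 4\<close> in the exponential moments, the distance of \<open>\<Lambda>\<close> from the centre \<open>c\<close> costs \<open>\<epsilon> / 4\<close>, the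
  growth of the moments costs another \<open>\<epsilon> / 4\<close>, and a rate \<open>s * \<epsilon> / 2\<close> remains, half of which absorbs
  the constants.\<close>

lemma large_deviations:
  fixes \<epsilon> :: real
  assumes \<epsilon>: "0 < \<epsilon>"
  shows "\<exists>\<delta>>0. \<exists>n0. \<forall>xs. set xs \<subseteq> K \<longrightarrow> n0 \<le> length xs \<longrightarrow>
    concentrated \<epsilon> \<delta> xs (\<lambda>T. ln (mnorm T)) \<and>
    (\<forall>v. norm v = 1 \<longrightarrow>
      concentrated \<epsilon> \<delta> xs (\<lambda>T. ln (norm (T *v v))))"
proof -
  let ?d = "real CARD('n)"
  obtain s C' where s: "0 < s" and E: "\<And>xs. set xs \<subseteq> K \<Longrightarrow> \<exists>c. \<forall>x \<sigma>. x \<noteq> 0 \<longrightarrow> \<bar>\<sigma>\<bar> = s \<longrightarrow>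
     powr_moment \<sigma> xs x
       \<le> ennreal (exp (\<sigma> * c + s * (\<epsilon> / 4) * real (length xs) + C')) * ennreal (norm x powr \<sigma>)"
    using exponential_moments[of "\<epsilon> / 4"] \<epsilon> by auto
  define C2 where "C2 = \<bar>C'\<bar> + (s + 1) * ln ?d"
  have lnd: "0 \<le> ln ?d" using card_ge_1 by simp
  have "0 \<le> (s + 1) * ln ?d" using lnd s by simp
  then have C2: "C' \<le> C2" "C' + (s + 1) * ln ?d \<le> C2" "0 \<le> C2"
    unfolding C2_def by linarith+
  define \<delta> where "\<delta> = s * \<epsilon> / 4"
  have \<delta>: "0 < \<delta>" using s \<epsilon> by (simp add: \<delta>_def)
  obtain n0 :: nat where n0: "ln 2 + 2 * C2 < \<delta> * n0"
    using reals_Archimedean3[OF \<delta>] by (metis mult.commute)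
  have main: "concentrated \<epsilon> \<delta> xs (\<lambda>T. ln (mnorm T)) \<and>
    (\<forall>v. norm v = 1 \<longrightarrow>
      concentrated \<epsilon> \<delta> xs (\<lambda>T. ln (norm (T *v v))))"
    if xs: "set xs \<subseteq> K" "n0 \<le> length xs" for xs
  proof -
    interpret prob_space "law xs" by (rule law_prob[OF xs(1)])
    have space: "space (law xs) = UNIV" using sets_eq_imp_space_eq[OF sets_law] by simp
    define n where "n = length xs"
    define \<beta> where "\<beta> = s * (\<epsilon> / 4) * n + C2"
    obtain c where c: "\<And>x \<sigma>. x \<noteq> 0 \<Longrightarrow> \<bar>\<sigma>\<bar> = s \<Longrightarrow>
     powr_moment \<sigma> xs x
       \<le> ennreal (exp (\<sigma> * c + s * (\<epsilon> / 4) * n + C')) * ennreal (norm x powr \<sigma>)"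
      using E[OF xs(1)] unfolding n_def by blast
    have vec: "(\<integral>\<^sup>+T. ennreal (exp (\<sigma> * ln (norm (T *v v)))) \<partial>law xs) \<le> ennreal (exp (\<sigma> * c + (s * (\<epsilon> / 4) * n + C')))"
      if v: "norm v = 1" and \<sigma>: "\<bar>\<sigma>\<bar> = s" for v \<sigma>
    proof -
      have v0: "v \<noteq> 0" using v by auto
      have "(\<integral>\<^sup>+T. ennreal (exp (\<sigma> * ln (norm (T *v v)))) \<partial>law xs) = (\<integral>\<^sup>+T. ennreal (norm (T *v v) powr \<sigma>) \<partial>law xs)"
      proof (rule nn_integral_cong_AE)
        show "AE T in law xs. ennreal (exp (\<sigma> * ln (norm (T *v v)))) = ennreal (norm (T *v v) powr \<sigma>)"
          using law_det[OF xs(1)] by eventually_elim (use norm_mult_vec_pos[OF _ v0] in \<open>simp add: powr_def\<close>)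
      qed
      also have "\<dots> \<le> ennreal (exp (\<sigma> * c + s * (\<epsilon> / 4) * n + C')) * ennreal (norm v powr \<sigma>)" by (rule c[OF v0 \<sigma>])
      finally show ?thesis by (simp add: v add.assoc)
    qed
    have vec': "(\<integral>\<^sup>+T. ennreal (exp (\<sigma> * ln (norm (T *v v)))) \<partial>law xs) \<le> ennreal (exp (\<sigma> * c + \<beta>))"
      if v: "norm v = 1" and \<sigma>: "\<bar>\<sigma>\<bar> = s" for v \<sigma>
      by (rule order_trans[OF vec[OF v \<sigma>] ennreal_leI]) (use C2 in \<open>simp add: \<beta>_def\<close>)
    have mat: "(\<integral>\<^sup>+T. ennreal (exp (\<sigma> * ln (mnorm T))) \<partial>law xs) \<le> ennreal (exp (\<sigma> * c + \<beta>))"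
      if \<sigma>: "\<bar>\<sigma>\<bar> = s" for \<sigma>
    proof (cases "\<sigma> = s")
      case True
      have "(\<integral>\<^sup>+T. ennreal (exp (\<sigma> * ln (mnorm T))) \<partial>law xs)
        \<le> (\<integral>\<^sup>+T. (\<Sum>i\<in>UNIV. ennreal (exp (s * ln ?d)) * ennreal (exp (\<sigma> * ln (norm (T *v axis i 1))))) \<partial>law xs)"
      proof (rule nn_integral_mono_AE)
        show "AE T in law xs. ennreal (exp (\<sigma> * ln (mnorm T)))
           \<le> (\<Sum>i\<in>UNIV. ennreal (exp (s * ln ?d)) * ennreal (exp (\<sigma> * ln (norm (T *v axis i 1)))))"
          using law_det[OF xs(1)]
        proof eventually_elim
          case (elim T)
          obtain i where i: "mnorm T \<le> ?d * norm (T *v axis i 1)" using mnorm_le_columns by blast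
          have pos: "0 < norm (T *v axis i 1)" by (rule norm_mult_vec_pos[OF elim]) simp
          have "ln (mnorm T) \<le> ln (?d * norm (T *v axis i 1))"
            using i mnorm_ge_1[OF elim] by (intro ln_mono) auto
          also have "\<dots> = ln ?d + ln (norm (T *v axis i 1))"
            using pos card_ge_1 by (intro ln_mult_pos) auto
          finally have "\<sigma> * ln (mnorm T) \<le> s * ln ?d + \<sigma> * ln (norm (T *v axis i 1))"
            using s True by (simp flip: distrib_left)
          then have "ennreal (exp (\<sigma> * ln (mnorm T))) \<le> ennreal (exp (s * ln ?d)) * ennreal (exp (\<sigma> * ln (norm (T *v axis i 1))))"
            by (simp flip: ennreal_mult exp_add)
          also have "\<dots> \<le> (\<Sum>i\<in>UNIV. ennreal (exp (s * ln ?d)) * ennreal (exp (\<sigma> * ln (norm (T *v axis i 1)))))"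
            by (rule member_le_sum) auto
          finally show ?case .
        qed
      qed
      also have "\<dots> = (\<Sum>i\<in>UNIV. ennreal (exp (s * ln ?d)) * (\<integral>\<^sup>+T. ennreal (exp (\<sigma> * ln (norm (T *v axis i 1)))) \<partial>law xs))"
        by (simp add: nn_integral_sum nn_integral_cmult)
      also have "\<dots> \<le> (\<Sum>i\<in>(UNIV::'n set). ennreal (exp (s * ln ?d)) * ennreal (exp (\<sigma> * c + (s * (\<epsilon> / 4) * n + C'))))"
        by (intro sum_mono mult_left_mono vec \<sigma>) auto
      also have "\<dots> = ennreal (?d * (exp (s * ln ?d) * exp (\<sigma> * c + (s * (\<epsilon> / 4) * n + C'))))"
        by (simp add: ennreal_mult ennreal_of_nat_eq_real_of_nat)
      also have "\<dots> \<le> ennreal (exp (\<sigma> * c + \<beta>))"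
      proof (rule ennreal_leI)
        have "?d * (exp (s * ln ?d) * exp (\<sigma> * c + (s * (\<epsilon> / 4) * n + C')))
          = exp (ln ?d + (s * ln ?d + (\<sigma> * c + (s * (\<epsilon> / 4) * n + C'))))"
          using card_ge_1 by (simp only: exp_add exp_ln)
        also have "\<dots> \<le> exp (\<sigma> * c + \<beta>)"
          using C2(2) unfolding exp_le_cancel_iff \<beta>_def by (simp add: algebra_simps)
        finally show "?d * (exp (s * ln ?d) * exp (\<sigma> * c + (s * (\<epsilon> / 4) * n + C'))) \<le> exp (\<sigma> * c + \<beta>)" .
      qed
      finally show ?thesis .
    next
      case False
      then have sg: "\<sigma> = - s" using \<sigma> by auto
      let ?e = "axis undefined 1 :: real^'n"
      have e: "norm ?e = 1" "?e \<noteq> 0" by (auto simp: norm_axis_1)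
      have "(\<integral>\<^sup>+T. ennreal (exp (\<sigma> * ln (mnorm T))) \<partial>law xs) \<le> (\<integral>\<^sup>+T. ennreal (exp (\<sigma> * ln (norm (T *v ?e)))) \<partial>law xs)"
      proof (rule nn_integral_mono_AE)
        show "AE T in law xs. ennreal (exp (\<sigma> * ln (mnorm T))) \<le> ennreal (exp (\<sigma> * ln (norm (T *v ?e))))"
          using law_det[OF xs(1)]
        proof eventually_elim
          case (elim T)
          have "ln (norm (T *v ?e)) \<le> ln (mnorm T)" using ln_norm_mult_vec_le[OF elim e(2)] e(1) by simp
          then show ?case using s sg by (intro ennreal_leI) simp
        qed
      qed
      also have "\<dots> \<le> ennreal (exp (\<sigma> * c + \<beta>))" by (rule vec'[OF e(1) \<sigma>])
      finally show ?thesis .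
    qed
    have center: "\<bar>\<Lambda> xs - c\<bar> \<le> \<beta> / s"
      unfolding \<Lambda>_def by (rule expectation_of_exp_moments[OF integrable_ln_mnorm[OF xs(1)] s mat])
    have tail: "measure (law xs) {T. \<epsilon> * n < \<bar>Z T - \<Lambda> xs\<bar>} < exp (- \<delta> * n)"
      if Z: "Z \<in> borel_measurable (law xs)"
        and ZE: "\<And>\<sigma>. \<bar>\<sigma>\<bar> = s \<Longrightarrow> (\<integral>\<^sup>+T. ennreal (exp (\<sigma> * Z T)) \<partial>law xs) \<le> ennreal (exp (\<sigma> * c + \<beta>))" for Z
    proof -
      have [measurable]: "Z \<in> borel_measurable (law xs)" by fact
      have "measure (law xs) {T. \<epsilon> * n < \<bar>Z T - \<Lambda> xs\<bar>}
         \<le> prob {T \<in> space (law xs). \<epsilon> * n - \<beta> / s < \<bar>Z T - c\<bar>}"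
      proof (rule finite_measure_mono)
        show "{T. \<epsilon> * n < \<bar>Z T - \<Lambda> xs\<bar>} \<subseteq> {T \<in> space (law xs). \<epsilon> * n - \<beta> / s < \<bar>Z T - c\<bar>}"
          using center by (auto simp: space)
      qed measurable
      also have "\<dots> \<le> 2 * exp (\<beta> - s * (\<epsilon> * n - \<beta> / s))"
        by (rule deviation_of_exp_moments[OF Z s ZE])
      also have "\<dots> = exp (ln 2 + (2 * \<beta> - s * \<epsilon> * n))"
      proof -
        have eq: "\<beta> - s * (\<epsilon> * n - \<beta> / s) = 2 * \<beta> - s * \<epsilon> * n" using s by (simp add: field_simps)
        show ?thesis unfolding eq exp_add[of "ln 2"] by simp
      qed
      also have "\<dots> < exp (- \<delta> * n)"
      proof -
        have "\<delta> * n0 \<le> \<delta> * n" using xs(2) \<delta> by (intro mult_left_mono) (auto simp: n_def)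
        then have "ln 2 + 2 * C2 < \<delta> * n" using n0 by linarith
        then show ?thesis by (simp add: \<beta>_def \<delta>_def algebra_simps)
      qed
      finally show ?thesis .
    qed
    have "measure (law xs) {T. \<epsilon> * n < \<bar>ln (mnorm T) - \<Lambda> xs\<bar>} < exp (- \<delta> * n)"
      by (rule tail) (use mat in auto)
    moreover have "measure (law xs) {T. \<epsilon> * n < \<bar>ln (norm (T *v v)) - \<Lambda> xs\<bar>} < exp (- \<delta> * n)" if "norm v = 1" for v
      by (rule tail) (use vec'[OF that] in auto)
    ultimately show ?thesis unfolding n_def concentrated_def by blast
  qed
  show ?thesis using \<delta> main by blast
qed

end

lemma rand_prod_cong: "(\<And>i. i \<in> {1..n} \<Longrightarrow> A i = B i) \<Longrightarrow> rand_prod n A = rand_prod n B"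
  by (induction n) auto

text \<open>The list is reversed since its head is the last factor \<open>\<mu> n\<close>. Measures are prescribed at all
  indices so that \<open>\<mu>\<close> forms a family of probability spaces.\<close>

lemma rand_prod_law:
  fixes \<mu> :: "nat \<Rightarrow> (real^'n^'n) measure"
  assumes \<mu>: "\<And>i. sl_prob (\<mu> i)"
  shows "rand_prod n \<in> borel_measurable (\<Pi>\<^sub>M i\<in>{1..n}. \<mu> i) \<and>
    distr (\<Pi>\<^sub>M i\<in>{1..n}. \<mu> i) borel (rand_prod n) = law (map \<mu> (rev [1..<Suc n]))"
proof (induction n)
  interpret product_prob_space \<mu>
    by (intro product_prob_spaceI) (use \<mu> in \<open>simp add: sl_prob_def\<close>)
  {
    case 0
    have "(\<integral>\<^sup>+x. f x \<partial>distr (\<Pi>\<^sub>M i\<in>{}. \<mu> i) borel (\<lambda>_. mat 1 :: real^'n^'n)) = (\<integral>\<^sup>+x. f x \<partial>return borel (mat 1))"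
      if "f \<in> borel_measurable borel" for f :: "real^'n^'n \<Rightarrow> ennreal"
      using that by (simp add: nn_integral_distr nn_integral_return space_PiM_empty)
    then have "distr (\<Pi>\<^sub>M i\<in>{}. \<mu> i) borel (\<lambda>_. mat 1 :: real^'n^'n) = return borel (mat 1)"
      by (intro measure_eq_borelI) auto
    moreover have "rand_prod 0 = (\<lambda>_. mat 1)" by auto
    ultimately show ?case by simp
  next
    case (Suc n)
    let ?P = "\<Pi>\<^sub>M i\<in>{1..n}. \<mu> i"
    let ?P' = "\<Pi>\<^sub>M i\<in>{1..Suc n}. \<mu> i"
    have ins: "{1..Suc n} = insert (Suc n) {1..n}" by auto
    let ?l = "law (map \<mu> (rev [1..<Suc n]))"
    have rn [measurable]: "rand_prod n \<in> borel_measurable ?P" and dn: "distr ?P borel (rand_prod n) = ?l"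
      using Suc by auto
    have sl_l: "sl_prob ?l" by (rule sl_prob_law) (use \<mu> in auto)
    have meas: "rand_prod (Suc n) \<in> borel_measurable ?P'"
    proof -
      have comp: "(\<lambda>X. X (Suc n)) \<in> ?P' \<rightarrow>\<^sub>M \<mu> (Suc n)" by (intro measurable_component_singleton) auto
      have "(\<lambda>A. A) \<in> borel_measurable (\<mu> (Suc n))" using \<mu> by (simp add: sl_prob_def)
      from measurable_compose[OF comp this]
      have 1: "(\<lambda>X. X (Suc n)) \<in> borel_measurable ?P'" .
      have "(\<lambda>X. restrict X {1..n}) \<in> ?P' \<rightarrow>\<^sub>M ?P" by (intro measurable_restrict_subset) auto
      then have restr: "(\<lambda>X. rand_prod n (restrict X {1..n})) \<in> borel_measurable ?P'"
        by (rule measurable_compose[OF _ rn])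
      have eq: "(\<lambda>X :: nat \<Rightarrow> real^'n^'n. rand_prod n (restrict X {1..n})) = rand_prod n"
        by (intro ext rand_prod_cong) auto
      have "rand_prod n \<in> borel_measurable ?P'" using restr by (simp only: eq)
      then have "(\<lambda>X. X (Suc n) ** rand_prod n X) \<in> borel_measurable ?P'"
        by (intro borel_measurable_mult_mat 1)
      moreover have "rand_prod (Suc n) = (\<lambda>X :: nat \<Rightarrow> real^'n^'n. X (Suc n) ** rand_prod n X)"
        by (rule ext) simp
      ultimately show ?thesis by (simp only:)
    qed
    moreover have "distr ?P' borel (rand_prod (Suc n)) = conv (\<mu> (Suc n)) ?l"
    proof (rule measure_eq_borelI)
      fix f :: "real^'n^'n \<Rightarrow> ennreal" assume f: "f \<in> borel_measurable borel"
      have "(\<integral>\<^sup>+x. f x \<partial>distr ?P' borel (rand_prod (Suc n))) = (\<integral>\<^sup>+X. f (rand_prod (Suc n) X) \<partial>?P')"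
        using f meas by (intro nn_integral_distr) auto
      also have "\<dots> = (\<integral>\<^sup>+y. \<integral>\<^sup>+X. f (rand_prod (Suc n) (X(Suc n := y))) \<partial>?P \<partial>\<mu> (Suc n))"
        unfolding ins
        by (rule product_nn_integral_insert_rev) (simp_all only: measurable_compose[OF meas f, unfolded ins], auto)
      also have "\<dots> = (\<integral>\<^sup>+y. \<integral>\<^sup>+X. f (y ** rand_prod n X) \<partial>?P \<partial>\<mu> (Suc n))"
      proof (intro nn_integral_cong)
        fix y :: "real^'n^'n" and X
        have "rand_prod n (X(Suc n := y)) = rand_prod n X" by (rule rand_prod_cong) auto
        then show "f (rand_prod (Suc n) (X(Suc n := y))) = f (y ** rand_prod n X)" by simp
      qed
      also have "\<dots> = (\<integral>\<^sup>+y. \<integral>\<^sup>+B. f (y ** B) \<partial>?l \<partial>\<mu> (Suc n))"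
      proof (intro nn_integral_cong)
        fix y :: "real^'n^'n"
        have f': "(\<lambda>B. f (y ** B)) \<in> borel_measurable borel" using f by measurable
        show "(\<integral>\<^sup>+X. f (y ** rand_prod n X) \<partial>?P) = (\<integral>\<^sup>+B. f (y ** B) \<partial>?l)"
          unfolding dn[symmetric] using f' by (intro nn_integral_distr[symmetric] rn) auto
      qed
      also have "\<dots> = (\<integral>\<^sup>+x. f x \<partial>conv (\<mu> (Suc n)) ?l)"
        by (rule nn_integral_conv[OF \<mu> sl_l f, symmetric])
      finally show "(\<integral>\<^sup>+x. f x \<partial>distr ?P' borel (rand_prod (Suc n))) = (\<integral>\<^sup>+x. f x \<partial>conv (\<mu> (Suc n)) ?l)" .
    qed auto
    moreover have "map \<mu> (rev [1..<Suc (Suc n)]) = \<mu> (Suc n) # map \<mu> (rev [1..<Suc n])"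
      by simp
    ultimately show ?case by (simp only: law_simps)
  }
qed

lemma borel_prob_measures_sl_borel:
  "M \<in> borel_prob_measures (top_of_set special_linear) \<Longrightarrow> sl_borel (M :: (real^'n^'n) measure)"
  by (simp add: borel_prob_measures_def sl_borel_def sets_borel_of_top_of_set)

lemma compactin_weak_limits:
  fixes K :: "(real^'n^'n) measure set"
  assumes K: "compactin (weak_topology (top_of_set special_linear)) K" and U: "ultra U" and f: "\<And>j. f j \<in> K"
  shows "\<exists>L\<in>K. \<forall>g :: real^'n^'n \<Rightarrow> real. continuous_on special_linear g \<longrightarrow> bounded (g ` special_linear) \<longrightarrow>
      ((\<lambda>j. \<integral>A. g A \<partial>f j) \<longlongrightarrow> (\<integral>A. g A \<partial>L)) U"
proof -
  from ultra_compactin[of U _ K f, OF U K f] obtain L where L: "L \<in> K"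
    "\<forall>V. openin (weak_topology (top_of_set special_linear)) V \<and> L \<in> V \<longrightarrow> eventually (\<lambda>j. f j \<in> V) U" ..
  have "L \<in> borel_prob_measures (top_of_set special_linear)"
    using compactin_subset_topspace[OF K] L(1) by auto
  then show ?thesis
    using L by (intro bexI[of _ L] allI impI weak_topology_tendsto) auto
qed

theorem theorem1p3:
  fixes K :: "(real^'n^'n) measure set"
  assumes "CARD('n) \<ge> 2"
    and "compactin (weak_topology (top_of_set special_linear)) K"
    and "finite_moment_condition K"
    and "measures_condition K"
    and "spaces_condition K"
  shows "\<forall>\<epsilon>>0. \<exists>\<delta>>0. \<exists>n\<^sub>0. \<forall>n\<ge>n\<^sub>0. \<forall>\<mu> :: nat \<Rightarrow> (real^'n^'n) measure. (\<forall>i\<in>{1..n}. \<mu> i \<in> K) \<longrightarrow>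
    (let P = (\<Pi>\<^sub>M i\<in>{1..n}. \<mu> i); L = expected_log_norm n \<mu> in
      measure P {A \<in> space P. \<bar>ln (onorm ((*v) (rand_prod n A))) - L\<bar> > \<epsilon> * real n}
        < exp (- \<delta> * real n) \<and>
      (\<forall>v :: real^'n. norm v = 1 \<longrightarrow>
        measure P {A \<in> space P. \<bar>ln (norm (rand_prod n A *v v)) - L\<bar> > \<epsilon> * real n}
          < exp (- \<delta> * real n)))"
proof (intro allI impI)
  fix \<epsilon> :: real assume \<epsilon>: "0 < \<epsilon>"
  let ?goal = "\<lambda>(\<delta>::real) n (\<mu> :: nat \<Rightarrow> (real^'n^'n) measure). let P = (\<Pi>\<^sub>M i\<in>{1..n}. \<mu> i); L = expected_log_norm n \<mu> in
      measure P {A \<in> space P. \<bar>ln (onorm ((*v) (rand_prod n A))) - L\<bar> > \<epsilon> * real n}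
        < exp (- \<delta> * real n) \<and>
      (\<forall>v :: real^'n. norm v = 1 \<longrightarrow>
        measure P {A \<in> space P. \<bar>ln (norm (rand_prod n A *v v)) - L\<bar> > \<epsilon> * real n}
          < exp (- \<delta> * real n))"
  obtain \<gamma> C where \<gamma>: "0 < \<gamma>" and C: "\<And>M. M \<in> K \<Longrightarrow> (\<integral>\<^sup>+A. ennreal (mnorm A powr \<gamma>) \<partial>M) < ennreal C"
    using assms(3) unfolding finite_moment_condition_def by blast
  have Kb: "M \<in> borel_prob_measures (top_of_set special_linear)" if "M \<in> K" for M
    using compactin_subset_topspace[OF assms(2)] that by auto
  interpret moment_family K \<gamma> "max 1 C"
  proof
    show "sl_borel M" if "M \<in> K" for M using borel_prob_measures_sl_borel[OF Kb[OF that]] .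
    show "\<exists>L\<in>K. \<forall>g :: real^'n^'n \<Rightarrow> real. continuous_on special_linear g \<longrightarrow> bounded (g ` special_linear) \<longrightarrow>
      ((\<lambda>j. \<integral>A. g A \<partial>f j) \<longlongrightarrow> (\<integral>A. g A \<partial>L)) U" if "ultra U" "\<And>j. f j \<in> K" for U f
      using compactin_weak_limits[OF assms(2) that] .
    show "spaces_condition K" by fact
    show "0 < \<gamma>" by fact
    show "(\<integral>\<^sup>+A. ennreal (mnorm A powr \<gamma>) \<partial>M) \<le> ennreal (max 1 C)" if "M \<in> K" for M
      using C[OF that] by (meson ennreal_leI less_imp_le max.cobounded2 order_trans)
  qed simp
  obtain \<delta> n0 where \<delta>: "0 < \<delta>" and ld: "\<And>xs. set xs \<subseteq> K \<Longrightarrow> n0 \<le> length xs \<Longrightarrow>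
    concentrated \<epsilon> \<delta> xs (\<lambda>T. ln (mnorm T)) \<and>
    (\<forall>v. norm v = 1 \<longrightarrow>
      concentrated \<epsilon> \<delta> xs (\<lambda>T. ln (norm (T *v v))))"
    using large_deviations[OF \<epsilon>] by blast
  have "?goal \<delta> n \<mu>"
    if n: "max 1 n0 \<le> n" and \<mu>: "\<forall>i\<in>{1..n}. \<mu> i \<in> K" for n and \<mu> :: "nat \<Rightarrow> (real^'n^'n) measure"
  proof -
    \<comment> \<open>\<open>rand_prod_law\<close> asks for probability measures at all indices; \<open>\<mu> 1\<close> lies in \<open>K\<close> as \<open>n \<ge> 1\<close>\<close>
    define \<mu>' where "\<mu>' i = (if i \<in> {1..n} then \<mu> i else \<mu> 1)" for i
    have \<mu>'K: "\<mu>' i \<in> K" for i using \<mu> n by (auto simp: \<mu>'_def)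
    have sl': "sl_prob (\<mu>' i)" for i using sl_borel_mem[OF \<mu>'K] by (rule sl_borel_sl_prob)
    define P where "P = (\<Pi>\<^sub>M i\<in>{1..n}. \<mu> i)"
    have P': "P = (\<Pi>\<^sub>M i\<in>{1..n}. \<mu>' i)" unfolding P_def by (rule PiM_cong) (auto simp: \<mu>'_def)
    define xs where "xs = map \<mu>' (rev [1..<Suc n])"
    have meas [measurable]: "rand_prod n \<in> borel_measurable P" and dist: "distr P borel (rand_prod n) = law xs"
      using rand_prod_law[of \<mu>' n, OF sl'] unfolding P' xs_def by auto
    have xs: "set xs \<subseteq> K" "length xs = n" using \<mu>'K by (auto simp: xs_def)
    have L: "expected_log_norm n \<mu> = \<Lambda> xs"
    proof -
      have "expected_log_norm n \<mu> = (\<integral>A. ln (mnorm (rand_prod n A)) \<partial>P)"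
        by (simp add: expected_log_norm_def P_def)
      also have "\<dots> = (\<integral>T. ln (mnorm T) \<partial>distr P borel (rand_prod n))"
        by (rule integral_distr[symmetric, OF meas]) simp
      finally show ?thesis by (simp add: dist \<Lambda>_def)
    qed
    have pr: "measure P {A \<in> space P. Q (rand_prod n A)} = measure (law xs) {T. Q T}"
      if "{T. Q T} \<in> sets borel" for Q
    proof -
      have "measure (distr P borel (rand_prod n)) {T. Q T} = measure P (rand_prod n -` {T. Q T} \<inter> space P)"
        by (rule measure_distr[OF meas that])
      also have "rand_prod n -` {T. Q T} \<inter> space P = {A \<in> space P. Q (rand_prod n A)}" by auto
      finally show ?thesis by (simp add: dist)
    qed
    have ld': "measure (law xs) {T. \<epsilon> * real n < \<bar>ln (mnorm T) - \<Lambda> xs\<bar>} < exp (- \<delta> * real n)"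
      "\<And>v. norm v = 1 \<Longrightarrow> measure (law xs) {T. \<epsilon> * real n < \<bar>ln (norm (T *v v)) - \<Lambda> xs\<bar>} < exp (- \<delta> * real n)"
      using ld[of xs] xs n by (auto simp: concentrated_def)
    have "measure P {A \<in> space P. \<epsilon> * real n < \<bar>ln (mnorm (rand_prod n A)) - \<Lambda> xs\<bar>} < exp (- \<delta> * real n)"
      by (subst pr) (use ld'(1) in auto)
    moreover have "measure P {A \<in> space P. \<epsilon> * real n < \<bar>ln (norm (rand_prod n A *v v)) - \<Lambda> xs\<bar>} < exp (- \<delta> * real n)"
      if "norm v = 1" for v
      by (subst pr) (use ld'(2)[OF that] in auto)
    ultimately show ?thesis unfolding Let_def L P_def[symmetric] by blast
  qed
  then show "\<exists>\<delta>>0. \<exists>n\<^sub>0. \<forall>n\<ge>n\<^sub>0. \<forall>\<mu> :: nat \<Rightarrow> (real^'n^'n) measure.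
      (\<forall>i\<in>{1..n}. \<mu> i \<in> K) \<longrightarrow> ?goal \<delta> n \<mu>"
    using \<delta> by blast
qed

end
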